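(* Let $(T,\mathfrak{m})$ be a complete local ring, let $\Pi$ be the prime subring of $T$, and let $C=\{Q_1,Q_2,\ldots,Q_k\}$ ($k\ge 1$) be a finite set of nonmaximal, pairwise incomparable (with respect to inclusion) prime ideals of $T$. Let $p\in\bigcap_{i=1}^k Q_i$ with $p\neq 0$. Then there exists a local domain $A\subseteq T$ with $p\in A$ such that $\widehat{A}=T$ and $pA$ is a prime ideal of $A$ whose formal fiber is semilocal with maximal ideals the elements of $C$, if and only if the following three conditions all hold: (i) $P\cap\Pi[p]=(0)$ for all $P\in\operatorname{Ass}T$; (ii) for every $P'\in\operatorname{Ass}(T/pT)$ we have $P'\subseteq Q_i$ for some $i\in\{1,2,\ldots,k\}$; (iii) for all $i\in\{1,2,\ldots,k\}$, $\big((Q_i\setminus pT)\,\Pi[p]\big)\cap\Pi[p]\subseteq\{0\}$, i.e. this set contains no nonzero element.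
   Context: All rings are commutative with unity. A "quasilocal" ring is a ring with exactly one maximal ideal; a "local" ring is a Noetherian quasilocal ring. Complete means complete with respect to the topology defined by the maximal ideal. The prime subring $\Pi$ of $T$ is the smallest subring of $T$ (the image of $\mathbb{Z}$), and $\Pi[p]$ is the subring of $T$ generated by $\Pi$ and $p$. $\operatorname{Ass}$ denotes the set of associated prime ideals, and $\operatorname{Ass}(T/pT)$ consists of the associated primes of the $T$-module $T/pT$ (primes of $T$). For a subring $R$ of $T$, $(Q_i\setminus pT)R=\{t\in T\mid t=qr\text{ for some }q\in Q_i\setminus pT,\ r\in R\}$ (a set of products, not an ideal). For a local subring $A\subseteq T$ with maximal ideal $A\cap\mathfrak{m}$, "$\widehat{A}=T$" means that the natural homomorphism from the completion $\widehat{A}$ of $A$ at its maximal ideal to $T$ is an isomorphism. The formal fiber of a prime $P$ of $A$ is $\operatorname{Spec}(\widehat{A}\otimes_A k(P))$, where $k(P)=A_P/PA_P$; its points correspond to the primes $Q$ of $\widehat{A}=T$ with $Q\cap A=P$. Saying that the formal fiber of $P$ is semilocal with maximal ideals the elements of $C$ means that the maximal ideals of $\widehat{A}\otimes_A k(P)$ correspond exactly to the elements of $C$, i.e. the maximal elements (under inclusion) of $\{Q\in\operatorname{Spec}T\mid Q\cap A=P\}$ are exactly the elements of $C$. *)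

theory Defs
  imports "HOL-Algebra.Algebra"
begin

locale quasilocal_ring = cring +
  assumes unique_maximalideal: "\<exists>!M. maximalideal M R"

locale local_ring = quasilocal_ring + noetherian_ring

text \<open>The power \<open>I\<^sup>n\<close> of an ideal is taken in the multiplicative monoid of ideals; in particular
  \<open>I\<^sup>0\<close> is the whole ring.\<close>

abbreviation ideal_power :: "('a, 'b) ring_scheme \<Rightarrow> 'a set \<Rightarrow> nat \<Rightarrow> 'a set" where
  "ideal_power R I n \<equiv> I [^]\<^bsub>ideals_set R\<^esub> n"

definition adic_Cauchy :: "('a, 'b) ring_scheme \<Rightarrow> 'a set \<Rightarrow> (nat \<Rightarrow> 'a) \<Rightarrow> bool" where
  "adic_Cauchy R I x \<longleftrightarrow>
     (\<forall>n. \<exists>N. \<forall>i\<ge>N. \<forall>j\<ge>N. x i \<ominus>\<^bsub>R\<^esub> x j \<in> ideal_power R I n)"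

definition adic_limit :: "('a, 'b) ring_scheme \<Rightarrow> 'a set \<Rightarrow> (nat \<Rightarrow> 'a) \<Rightarrow> 'a \<Rightarrow> bool" where
  "adic_limit R I x l \<longleftrightarrow> (\<forall>n. \<exists>N. \<forall>i\<ge>N. x i \<ominus>\<^bsub>R\<^esub> l \<in> ideal_power R I n)"

text \<open>Uniqueness of the limit says that the topology is Hausdorff; for local rings this is
  automatic by Krull's intersection theorem.\<close>

locale complete_local_ring = local_ring T + maximalideal \<mm> T for T (structure) and \<mm> +
  assumes complete:
    "\<lbrakk> \<And>n. x n \<in> carrier T; adic_Cauchy T \<mm> x \<rbrakk> \<Longrightarrow> \<exists>!l. l \<in> carrier T \<and> adic_limit T \<mm> x l"

text \<open>The completion as the inverse limit of the rings \<open>R/I\<^sup>n\<close>. The transition map sends a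
  coset of \<open>I\<^sup>n\<^sup>+\<^sup>1\<close> to the unique coset of \<open>I\<^sup>n\<close> containing it, so that compatible
  families are exactly the decreasing ones.\<close>

definition adic_completion :: "('a, 'b) ring_scheme \<Rightarrow> 'a set \<Rightarrow> (nat \<Rightarrow> 'a set) ring" where
  "adic_completion R I =
    \<lparr> carrier = {x. (\<forall>n. x n \<in> carrier (R Quot ideal_power R I n)) \<and> (\<forall>n. x (Suc n) \<subseteq> x n)},
      monoid.mult = (\<lambda>x y n. x n \<otimes>\<^bsub>R Quot ideal_power R I n\<^esub> y n),
      one = (\<lambda>n. \<one>\<^bsub>R Quot ideal_power R I n\<^esub>),
      ring.zero = (\<lambda>n. \<zero>\<^bsub>R Quot ideal_power R I n\<^esub>),
      ring.add = (\<lambda>x y n. x n \<oplus>\<^bsub>R Quot ideal_power R I n\<^esub> y n) \<rparr>"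

abbreviation subring_of :: "('a, 'b) ring_scheme \<Rightarrow> 'a set \<Rightarrow> ('a, 'b) ring_scheme" where
  "subring_of T A \<equiv> T\<lparr>carrier := A\<rparr>"

text \<open>The natural homomorphism to the complete ring \<open>T\<close> from the completion of a subring
  \<open>A\<close> at \<open>A \<inter> \<mm>\<close>: a compatible family of cosets \<open>a\<^sub>n + (A \<inter> \<mm>)\<^sup>n\<close> is sent to the limit
  of \<open>(a\<^sub>n)\<close> in \<open>T\<close>, i.e. to the only \<open>t\<close> such that \<open>a\<^sub>n + (A \<inter> \<mm>)\<^sup>n \<subseteq> t + \<mm>\<^sup>n\<close> for all \<open>n\<close>.\<close>

definition completion_map :: "('a, 'b) ring_scheme \<Rightarrow> 'a set \<Rightarrow> (nat \<Rightarrow> 'a set) \<Rightarrow> 'a" where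
  "completion_map T \<mm> x =
     (THE t. t \<in> carrier T \<and> (\<forall>n. x n \<subseteq> ideal_power T \<mm> n +>\<^bsub>T\<^esub> t))"

definition completion_eq :: "('a, 'b) ring_scheme \<Rightarrow> 'a set \<Rightarrow> 'a set \<Rightarrow> bool" where
  "completion_eq T \<mm> A \<longleftrightarrow>
     maximalideal (A \<inter> \<mm>) (subring_of T A) \<and>
     completion_map T \<mm> \<in> ring_iso (adic_completion (subring_of T A) (A \<inter> \<mm>)) T"

definition prime_subring :: "('a, 'b) ring_scheme \<Rightarrow> 'a set" where
  "prime_subring T = generate_ring T {}"

definition prime_subring_adjoin :: "('a, 'b) ring_scheme \<Rightarrow> 'a \<Rightarrow> 'a set" where
  "prime_subring_adjoin T p = generate_ring T (prime_subring T \<union> {p})"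

definition associated_primes ::
    "('a, 'c) ring_scheme \<Rightarrow> ('a, 'm, 'd) module_scheme \<Rightarrow> 'a set set" where
  "associated_primes R M =
     {P. primeideal P R \<and> (\<exists>x\<in>carrier M. P = {r \<in> carrier R. r \<odot>\<^bsub>M\<^esub> x = \<zero>\<^bsub>M\<^esub>})}"

definition regular_module :: "('a, 'b) ring_scheme \<Rightarrow> ('a, 'a) module" where
  "regular_module R =
    \<lparr> carrier = carrier R, monoid.mult = monoid.mult R, one = one R,
      ring.zero = ring.zero R, ring.add = ring.add R,
      smult = monoid.mult R \<rparr>"

definition quotient_module :: "('a, 'b) ring_scheme \<Rightarrow> 'a set \<Rightarrow> ('a, 'a set) module" where
  "quotient_module R I =
    \<lparr> carrier = carrier (R Quot I), monoid.mult = monoid.mult (R Quot I), one = one (R Quot I),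
      ring.zero = ring.zero (R Quot I), ring.add = ring.add (R Quot I),
      smult = (\<lambda>r x. (I +>\<^bsub>R\<^esub> r) \<otimes>\<^bsub>R Quot I\<^esub> x) \<rparr>"

text \<open>The points of the formal fiber of \<open>P\<close>, that is of the spectrum of the tensor product over
  \<open>A\<close> of \<open>T\<close> (the completion of \<open>A\<close>) with the residue field of \<open>P\<close>, are identified with the
  primes of \<open>T\<close> lying over \<open>P\<close>; the closed points are then the maximal ones.\<close>

definition formal_fiber :: "('a, 'b) ring_scheme \<Rightarrow> 'a set \<Rightarrow> 'a set \<Rightarrow> 'a set set" where
  "formal_fiber T A P = {Q. primeideal Q T \<and> Q \<inter> A = P}"

definition formal_fiber_maximal :: "('a, 'b) ring_scheme \<Rightarrow> 'a set \<Rightarrow> 'a set \<Rightarrow> 'a set set" where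
  "formal_fiber_maximal T A P =
     {Q \<in> formal_fiber T A P. \<forall>Q'\<in>formal_fiber T A P. Q \<subseteq> Q' \<longrightarrow> Q' = Q}"

end

theory Submission
  imports Defs
begin

text \<open>
  Suppose \<open>A\<close> exists. By faithful flatness of completion, nonzero elements of \<open>A\<close> are regular on \<open>T\<close>
  and elements of \<open>A\<close> outside \<open>pA\<close> are regular on \<open>T/pT\<close>. Hence associated primes of \<open>T\<close> meet \<open>A\<close>
  in \<open>0\<close>, and those of \<open>T/pT\<close> lie over \<open>pA\<close>, so below some \<open>Q\<^sub>i\<close>. If \<open>q r \<in> A\<close> with \<open>r \<in> A\<close> and
  \<open>q \<in> Q\<^sub>i - pT\<close>, then \<open>q r \<in> Q\<^sub>i \<inter> A = pA\<close>, so \<open>r \<in> pA\<close>; dividing both by \<open>p\<close> repeatedly gives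
  \<open>r \<in> \<Inter>\<^sub>n p\<^sup>nT = 0\<close>.

  Conversely, call a subring \<open>R \<ni> p\<close> good if \<open>R = T \<inter> Frac R\<close> and \<open>R \<inter> Q\<^sub>i \<subseteq> pT\<close> for all \<open>i\<close>. Since \<open>p\<close>
  is regular and elements outside all \<open>Q\<^sub>i\<close> are regular modulo \<open>p\<close>, writing \<open>r = p\<^sup>k r'\<close> shows that nonzero
  elements \<open>r\<close> of \<open>R\<close> are regular, so \<open>Ass T\<close> plays no further role. By (iii),
  inverting elements of \<open>\<Pi>[p]\<close> inside \<open>T\<close> gives a countable good ring. If \<open>|R| < |T|\<close> and \<open>y\<close> lies
  outside all \<open>Q\<^sub>i\<close>, then some \<open>u + y t\<close> is transcendental modulo every \<open>Q\<^sub>i\<close> over \<open>R\<close>, because \<open>T\<close>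
  contains \<open>|T|\<close> elements that are pairwise incongruent modulo all \<open>Q\<^sub>i\<close> (power series in an element of
  \<open>\<mm>\<close> outside all \<open>Q\<^sub>i\<close>) while each polynomial has finitely many roots modulo \<open>Q\<^sub>i\<close>; such an element can
  be adjoined. A transfinite recursion of length \<open>|T|\<close> yields a good \<open>A\<close> that meets all cosets
  \<open>u + y T\<close> and satisfies \<open>IT \<inter> A = I\<close> for all finitely generated ideals \<open>I\<close>; this makes \<open>A\<close> Noetherian
  with completion \<open>T\<close>, and every prime of \<open>T\<close> not below some \<open>Q\<^sub>i\<close> meets \<open>A\<close> outside \<open>pA\<close>.
\<close>

section \<open>Ideals and subrings\<close>

text \<open>A good ring \<open>R\<close> meets all members of \<open>C\<close> in the same ideal
  \<open>pR\<close>, so \<open>R/pR\<close> embeds into every \<open>T/Q\<close>. Adjoining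
  \<open>x\<close> transcendental modulo every \<open>Q\<close> preserves this: a polynomial value
  in one \<open>Q\<close> has all its coefficients in \<open>pR\<close>, and \<open>p\<close>
  divides out. The factor \<open>y\<close> of a coset \<open>u + yT\<close> has to be cancellable
  modulo each \<open>Q\<close>: only then do incongruent parameters \<open>t\<close> give
  incongruent elements \<open>u + y t\<close>, so that each polynomial excludes finitely many of
  them. The count succeeds as long as the ring is smaller than \<open>T\<close>; therefore every
  extension lemma carries a bound by an infinite \<open>Y\<close> with
  \<open>|Y| <o |carrier T|\<close>. The coset condition is used twice. With \<open>y = z^k\<close>,
  \<open>z\<close> in \<open>\<mm>\<close> outside all \<open>Q\<close>, it makes \<open>A\<close>
  dense in \<open>T\<close>; with a multiple of an element of a prime not below \<open>C\<close>, it
  puts an element of that prime outside \<open>pA\<close> into \<open>A\<close>. Flatness is avoided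
  in both directions. The elementary substitute is a weak Artin-Rees lemma together with two facts
  equivalent to \<open>A\<close> having completion \<open>T\<close>: \<open>A\<close> is dense, and
  powers of \<open>\<mm>\<close> contract to powers of \<open>A \<inter> \<mm>\<close>.\<close>

lemma (in cring) idealD:
  assumes "ideal I R"
  shows "\<And>x. x \<in> I \<Longrightarrow> x \<in> carrier R" "\<zero> \<in> I"
    "\<And>x y. x \<in> I \<Longrightarrow> y \<in> I \<Longrightarrow> x \<oplus> y \<in> I"
    "\<And>x y. x \<in> I \<Longrightarrow> y \<in> I \<Longrightarrow> x \<ominus> y \<in> I"
    "\<And>x. x \<in> I \<Longrightarrow> \<ominus> x \<in> I"
    "\<And>x r. x \<in> I \<Longrightarrow> r \<in> carrier R \<Longrightarrow> r \<otimes> x \<in> I"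
    "\<And>x r. x \<in> I \<Longrightarrow> r \<in> carrier R \<Longrightarrow> x \<otimes> r \<in> I"
proof -
  interpret ideal I R by fact
  show "\<And>x. x \<in> I \<Longrightarrow> x \<in> carrier R" "\<zero> \<in> I"
    "\<And>x y. x \<in> I \<Longrightarrow> y \<in> I \<Longrightarrow> x \<oplus> y \<in> I" "\<And>x. x \<in> I \<Longrightarrow> \<ominus> x \<in> I"
    "\<And>x r. x \<in> I \<Longrightarrow> r \<in> carrier R \<Longrightarrow> r \<otimes> x \<in> I"
    "\<And>x r. x \<in> I \<Longrightarrow> r \<in> carrier R \<Longrightarrow> x \<otimes> r \<in> I"
    by (auto intro: I_l_closed I_r_closed)
  then show "\<And>x y. x \<in> I \<Longrightarrow> y \<in> I \<Longrightarrow> x \<ominus> y \<in> I"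
    by (simp add: minus_eq)
qed

lemma (in cring) idealI_comm:
  assumes "I \<subseteq> carrier R" "\<zero> \<in> I" "\<And>x y. x \<in> I \<Longrightarrow> y \<in> I \<Longrightarrow> x \<oplus> y \<in> I"
    and mult: "\<And>x r. x \<in> I \<Longrightarrow> r \<in> carrier R \<Longrightarrow> r \<otimes> x \<in> I"
  shows "ideal I R"
proof (rule idealI)
  show "subgroup I (add_monoid R)"
  proof (rule add.subgroupI)
    fix x assume "x \<in> I"
    with mult[of x "\<ominus> \<one>"] assms(1) show "\<ominus> x \<in> I"
      by (auto simp: l_minus subset_iff)
  qed (use assms in auto)
  fix a x assume "a \<in> I" "x \<in> carrier R"
  with assms show "x \<otimes> a \<in> I" "a \<otimes> x \<in> I"
    by (auto simp: m_comm subset_iff)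
qed (rule ring_axioms)

lemma (in cring) primeD:
  assumes "primeideal Q R"
  shows "ideal Q R" "\<one> \<notin> Q"
    "\<And>x y. x \<in> carrier R \<Longrightarrow> y \<in> carrier R \<Longrightarrow> x \<otimes> y \<in> Q \<longleftrightarrow> x \<in> Q \<or> y \<in> Q"
    "\<And>x n. x \<in> carrier R \<Longrightarrow> x [^] (n::nat) \<in> Q \<Longrightarrow> x \<in> Q"
proof -
  interpret primeideal Q R by fact
  show "ideal Q R" by (rule is_ideal)
  show 1: "\<one> \<notin> Q" using I_notcarr one_imp_carrier by auto
  show "\<And>x y. x \<in> carrier R \<Longrightarrow> y \<in> carrier R \<Longrightarrow> x \<otimes> y \<in> Q \<longleftrightarrow> x \<in> Q \<or> y \<in> Q"
    by (auto dest: I_prime intro: I_l_closed I_r_closed)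
  show "x \<in> Q" if "x \<in> carrier R" "x [^] (n::nat) \<in> Q" for x n
    using that(2) by (induct n) (use that(1) 1 I_prime[of "x [^] (_::nat)" x] in auto)
qed

lemma (in cring) subringD:
  assumes "subring A R"
  shows "\<And>x. x \<in> A \<Longrightarrow> x \<in> carrier R" "\<zero> \<in> A" "\<one> \<in> A" "\<And>x. x \<in> A \<Longrightarrow> \<ominus> x \<in> A"
    "\<And>x y. x \<in> A \<Longrightarrow> y \<in> A \<Longrightarrow> x \<oplus> y \<in> A"  "\<And>x y. x \<in> A \<Longrightarrow> y \<in> A \<Longrightarrow> x \<ominus> y \<in> A"
    "\<And>x y. x \<in> A \<Longrightarrow> y \<in> A \<Longrightarrow> x \<otimes> y \<in> A" "\<And>x n. x \<in> A \<Longrightarrow> x [^] (n::nat) \<in> A"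
proof -
  note s = subringE[OF assms]
  show "\<And>x. x \<in> A \<Longrightarrow> x \<in> carrier R" "\<zero> \<in> A" "\<one> \<in> A" "\<And>x. x \<in> A \<Longrightarrow> \<ominus> x \<in> A"
    "\<And>x y. x \<in> A \<Longrightarrow> y \<in> A \<Longrightarrow> x \<oplus> y \<in> A"  "\<And>x y. x \<in> A \<Longrightarrow> y \<in> A \<Longrightarrow> x \<ominus> y \<in> A"
    "\<And>x y. x \<in> A \<Longrightarrow> y \<in> A \<Longrightarrow> x \<otimes> y \<in> A"
    using s by (auto simp: minus_eq)
  show "x [^] (n::nat) \<in> A" if "x \<in> A" for x n
    by (induct n) (use that s in auto)
qed

lemma (in cring) subring_cring:
  assumes "subring A R" shows "cring (subring_of R A)"
  using subcringI'[OF assms] subcring_iff[of A] subringE(1)[OF assms] by auto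

lemma (in cring) mem_PIdl: "x \<in> PIdl a \<longleftrightarrow> (\<exists>r\<in>carrier R. x = a \<otimes> r)" if "a \<in> carrier R"
  using that by (auto simp: cgenideal_def m_comm)

lemma (in cring) mem_PIdl_subring:
  assumes "subring A R" "a \<in> A"
  shows "x \<in> PIdl\<^bsub>subring_of R A\<^esub> a \<longleftrightarrow> (\<exists>r\<in>A. x = a \<otimes> r)"
  using cring.mem_PIdl[OF subring_cring[OF assms(1)], of a x] assms(2) by simp

lemma (in cring) ideal_inter_subring:
  assumes "subring A R" "ideal I R"
  shows "ideal (I \<inter> A) (subring_of R A)"
proof -
  interpret S: cring "subring_of R A" by (rule subring_cring) fact
  show ?thesis
    by (rule S.idealI_comm) (use subringD[OF assms(1)] idealD[OF assms(2)] in auto)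
qed

lemma (in cring) prime_inter_subring:
  assumes "subring A R" "primeideal Q R"
  shows "primeideal (Q \<inter> A) (subring_of R A)"
proof (rule primeidealI)
  show "ideal (Q \<inter> A) (subring_of R A)"
    using ideal_inter_subring[OF assms(1)] primeD(1)[OF assms(2)] .
  show "cring (subring_of R A)" by (rule subring_cring) fact
  show "carrier (subring_of R A) \<noteq> Q \<inter> A"
    using primeD(2)[OF assms(2)] subringD(3)[OF assms(1)] by auto
  fix a b assume "a \<in> carrier (subring_of R A)" "b \<in> carrier (subring_of R A)"
    "a \<otimes>\<^bsub>subring_of R A\<^esub> b \<in> Q \<inter> A"
  then show "a \<in> Q \<inter> A \<or> b \<in> Q \<inter> A"
    using subringD(1)[OF assms(1)] primeD(3)[OF assms(2), of a b] by auto
qed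

section \<open>Powers of ideals\<close>

lemma ideals_set_simps [simp]: "one (ideals_set R) = carrier R" "monoid.mult (ideals_set R) = ideal_prod R"
  by (auto simp: ideals_set_def)

lemma ideal_power_0: "ideal_power R I 0 = carrier R"
  by (simp add: nat_pow_def ideals_set_def)

lemma ideal_power_Suc: "ideal_power R I (Suc n) = ideal_power R I n \<cdot>\<^bsub>R\<^esub> I"
  by (simp add: nat_pow_def ideals_set_def)

lemma (in cring) ideal_ideal_power: "ideal I R \<Longrightarrow> ideal (ideal_power R I n) R"
  by (induct n) (auto simp: ideal_power_0 ideal_power_Suc oneideal intro: ideal_prod_is_ideal)

lemma (in cring) ideal_power_mult:
  "x \<in> ideal_power R I n \<Longrightarrow> y \<in> I \<Longrightarrow> x \<otimes> y \<in> ideal_power R I (Suc n)"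
  unfolding ideal_power_Suc by (rule ideal_prod.prod)

lemma (in cring) ideal_power_Suc_subset:
  assumes "\<And>x y. x \<in> ideal_power R I n \<Longrightarrow> y \<in> I \<Longrightarrow> x \<otimes> y \<in> J"
    and "\<And>x y. x \<in> J \<Longrightarrow> y \<in> J \<Longrightarrow> x \<oplus> y \<in> J"
  shows "ideal_power R I (Suc n) \<subseteq> J"
proof
  fix x assume "x \<in> ideal_power R I (Suc n)"
  then show "x \<in> J"
    unfolding ideal_power_Suc by (induct rule: ideal_prod.induct) (use assms in auto)
qed

lemma (in cring) ideal_power_decreasing:
  assumes "ideal I R" "m \<le> n"
  shows "ideal_power R I n \<subseteq> ideal_power R I m"
  using assms(2)
proof (induct rule: dec_induct)
  case (step n)
  have "ideal_power R I (Suc n) \<subseteq> ideal_power R I n"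
    by (rule ideal_power_Suc_subset)
      (use idealD[OF ideal_ideal_power[OF assms(1)]] idealD(1)[OF assms(1)] in auto)
  with step show ?case by blast
qed simp

lemma (in cring) ideal_power_1: "ideal I R \<Longrightarrow> ideal_power R I (Suc 0) = I"
  using ideal_power_Suc_subset[of I 0 I] ideal_power_mult[of \<one> I 0]
  by (auto simp: ideal_power_0 subset_iff idealD)

lemma (in cring) elem_power_mem:
  assumes "ideal I R" "x \<in> I" shows "x [^] (n::nat) \<in> ideal_power R I n"
  by (induct n) (use assms ideal_power_mult in \<open>auto simp: ideal_power_0\<close>)

lemma (in cring) ideal_power_inter_subring:
  assumes A: "subring A R" and I: "ideal I R" and J: "ideal J (subring_of R A)" and JI: "J \<subseteq> I"
  shows "ideal_power (subring_of R A) J n \<subseteq> ideal_power R I n"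
proof (induct n)
  case 0
  then show ?case using subringD(1)[OF A] by (auto simp: ideal_power_0)
next
  case (Suc n)
  interpret S: cring "subring_of R A" by (rule subring_cring) fact
  show ?case
    by (rule S.ideal_power_Suc_subset)
      (use Suc JI ideal_power_mult[of _ I n] idealD(3)[OF ideal_ideal_power[OF I, of "Suc n"]] in \<open>auto simp: subset_iff\<close>)
qed

section \<open>Linear combinations\<close>

context ring begin

text \<open>The coefficient set is a parameter so that one list of generators can be read over
  \<open>T\<close> and over a subring; moving coefficients from the former to the latter is the task
  of the construction. The recursion isolates the coefficient of the head, the one that is modified
  there.\<close>

primrec lin_span :: "'a set \<Rightarrow> 'a list \<Rightarrow> 'a set" where
  "lin_span A [] = {\<zero>}"
| "lin_span A (f # F) = {a \<otimes> f \<oplus> s | a s. a \<in> A \<and> s \<in> lin_span A F}"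

lemma lin_spanI: "x = a \<otimes> f \<oplus> s \<Longrightarrow> a \<in> A \<Longrightarrow> s \<in> lin_span A F \<Longrightarrow> x \<in> lin_span A (f # F)"
  by auto

end

lemma (in cring) lin_span_subring:
  assumes A: "subring A R" and F: "set F \<subseteq> A"
  shows lin_span_ideal: "ideal (lin_span A F) (subring_of R A)"
    and lin_span_mem: "set F \<subseteq> lin_span A F"
    and lin_span_le: "\<And>I. ideal I (subring_of R A) \<Longrightarrow> set F \<subseteq> I \<Longrightarrow> lin_span A F \<subseteq> I"
proof -
  interpret S: cring "subring_of R A" by (rule subring_cring) fact
  note a = subringD[OF A]
  have 1: "lin_span A F \<subseteq> A \<and> \<zero> \<in> lin_span A F \<and>
    (\<forall>x\<in>lin_span A F. \<forall>y\<in>lin_span A F. x \<oplus> y \<in> lin_span A F) \<and>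
    (\<forall>x\<in>lin_span A F. \<forall>r\<in>A. r \<otimes> x \<in> lin_span A F)"
    if "set F \<subseteq> A" for F
    using that
  proof (induct F)
    case Nil
    then show ?case using a by auto
  next
    case (Cons f F)
    then have c: "f \<in> A" "lin_span A F \<subseteq> A" "f \<in> carrier R"
      "\<And>x. x \<in> lin_span A F \<Longrightarrow> x \<in> carrier R" using a by auto
    have "\<zero> \<otimes> f \<oplus> \<zero> = \<zero>" using c by simp
    then have z: "\<zero> \<in> lin_span A (f # F)" by (intro lin_spanI[of _ \<zero> _ \<zero>]) (use a(2) Cons in auto)
    have "x \<oplus> y \<in> lin_span A (f # F)" if xy: "x \<in> lin_span A (f # F)" "y \<in> lin_span A (f # F)" for x y
    proof -
      obtain u s v t where e: "x = u \<otimes> f \<oplus> s" "y = v \<otimes> f \<oplus> t" "u \<in> A" "v \<in> A"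
         "s \<in> lin_span A F" "t \<in> lin_span A F" using xy by auto
      then have "u \<in> carrier R" "v \<in> carrier R" "s \<in> carrier R" "t \<in> carrier R" using a c by auto
      then have "x \<oplus> y = (u \<oplus> v) \<otimes> f \<oplus> (s \<oplus> t)" unfolding e using c(3) by algebra
      then show ?thesis by (rule lin_spanI) (use e a Cons in auto)
    qed
    moreover have "r \<otimes> x \<in> lin_span A (f # F)" if xr: "x \<in> lin_span A (f # F)" "r \<in> A" for x r
    proof -
      obtain u s where e: "x = u \<otimes> f \<oplus> s" "u \<in> A" "s \<in> lin_span A F" using xr by auto
      then have "u \<in> carrier R" "r \<in> carrier R" "s \<in> carrier R" using a c xr by auto
      then have "r \<otimes> x = (r \<otimes> u) \<otimes> f \<oplus> (r \<otimes> s)" unfolding e using c(3) by algebra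
      then show ?thesis by (rule lin_spanI) (use e a Cons xr in auto)
    qed
    ultimately show ?case using z c a by auto
  qed
  show "ideal (lin_span A F) (subring_of R A)"
    using 1[OF F] by (intro S.idealI_comm) auto
  show "set F \<subseteq> lin_span A F" using F
  proof (induct F)
    case (Cons f F)
    have z: "\<zero> \<in> lin_span A F"
      using 1[of F] Cons.prems by auto
    have "f = \<one> \<otimes> f \<oplus> \<zero>" using Cons a by auto
    then have "f \<in> lin_span A (f # F)" by (rule lin_spanI) (use z a in auto)
    moreover have "x \<in> lin_span A (f # F)" if x: "x \<in> lin_span A F" "x \<in> A" for x
    proof -
      have "x = \<zero> \<otimes> f \<oplus> x" using Cons a x by auto
      then show ?thesis by (rule lin_spanI) (use x a in auto)
    qed
    ultimately show ?case using Cons by (auto simp del: lin_span.simps)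
  qed simp
  show "lin_span A F \<subseteq> I" if "ideal I (subring_of R A)" "set F \<subseteq> I" for I
    using that(2) by (induct F) (use S.idealD[OF that(1)] in auto)
qed

lemma (in cring) Idl_eq_lin_span:
  assumes "subring A R" "set F \<subseteq> A"
  shows "Idl\<^bsub>subring_of R A\<^esub> (set F) = lin_span A F"
  using lin_span_subring[OF assms] unfolding genideal_def by blast

lemma (in cring) lin_span_carrier:
  assumes "set F \<subseteq> carrier R"
  shows "ideal (lin_span (carrier R) F) R" "Idl (set F) = lin_span (carrier R) F"
  using Idl_eq_lin_span[OF carrier_is_subring assms] lin_span_ideal[OF carrier_is_subring assms]
  by auto

lemma (in ring) lin_span_mono: "A \<subseteq> B \<Longrightarrow> lin_span A F \<subseteq> lin_span B F"
  by (induct F) auto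

section \<open>Noetherian rings\<close>

locale noetherian_cring = cring + noetherian_ring

text \<open>In a Noetherian ring the union of a chain of ideals is a member of the chain, so Zorn's
  lemma applies to any family of ideals whatever.\<close>

lemma (in noetherian_ring) ideals_maximal:
  assumes "F \<noteq> {}" "\<And>I. I \<in> F \<Longrightarrow> ideal I R"
  shows "\<exists>M\<in>F. \<forall>I\<in>F. M \<subseteq> I \<longrightarrow> I = M"
proof (rule subset_Zorn_nonempty[OF assms(1)])
  fix C assume C: "C \<noteq> {}" "subset.chain F C"
  then have "subset.chain {I. ideal I R} C"
    using assms(2) by (auto simp: subset_chain_def)
  from ideal_chain_is_trivial[OF C(1) this] show "\<Union>C \<in> F"
    using C by (auto simp: subset_chain_def)
qed

lemma (in noetherian_ring) ideals_maximalE: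
  assumes "I \<in> F" "\<And>I. I \<in> F \<Longrightarrow> ideal I R"
  obtains M where "M \<in> F" "\<And>I. I \<in> F \<Longrightarrow> M \<subseteq> I \<Longrightarrow> I = M"
proof -
  have "\<exists>M\<in>F. \<forall>I\<in>F. M \<subseteq> I \<longrightarrow> I = M" using ideals_maximal[of F] assms by auto
  then show thesis using that by blast
qed

lemma (in noetherian_cring) ideal_generated_list:
  assumes "ideal I R"
  obtains F where "set F \<subseteq> I" "I = lin_span (carrier R) F"
proof -
  obtain A where A: "A \<subseteq> carrier R" "finite A" "I = Idl A" using finetely_gen[OF assms] by auto
  obtain F where F: "A = set F" using A(2) finite_list by auto
  show thesis
    using that[of F] lin_span_carrier(2)[of F] A F genideal_self[of A] by auto
qed

section \<open>Colon ideals, powers of sums, the weak Artin-Rees lemma and Krull's theorem\<close>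

lemma (in cring) colon_ideal:
  assumes "ideal B R" "x \<in> carrier R"
  shows "ideal {r \<in> carrier R. x \<otimes> r \<in> B} R"
  by (rule idealI_comm) (use idealD[OF assms(1)] assms(2) in \<open>auto simp: r_distr m_lcomm\<close>)

lemma (in cring) mem_ideal_sum:
  assumes "ideal I R" "ideal J R"
  shows "x \<in> I <+>\<^bsub>R\<^esub> J \<longleftrightarrow> (\<exists>i\<in>I. \<exists>j\<in>J. x = i \<oplus> j)"
  by (auto simp: set_add_def')

text \<open>One further factor \<open>z = i + j\<close> is distributed over two decompositions of
  the same \<open>x\<close>: multiplying by \<open>i\<close> raises the exponent of \<open>I\<close>
  in the one for \<open>(k - 1, l)\<close>, and multiplying by \<open>j\<close> that of
  \<open>J\<close> in the one for \<open>(k, l - 1)\<close>. Hence the induction on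
  \<open>k + l\<close>.\<close>

lemma (in cring) ideal_power_sum:
  assumes I: "ideal I R" and J: "ideal J R" and K: "ideal K R" "K \<subseteq> I <+>\<^bsub>R\<^esub> J"
  shows "ideal_power R K (k + l) \<subseteq> ideal_power R I k <+>\<^bsub>R\<^esub> ideal_power R J l"
proof (induct "k + l" arbitrary: k l rule: less_induct)
  case (less k l)
  note pI = ideal_ideal_power[OF I] and pJ = ideal_ideal_power[OF J] and pK = ideal_ideal_power[OF K(1)]
  note sum = add_ideals[OF pI pJ] and mem = mem_ideal_sum[OF pI pJ]
  have c: "x \<in> carrier R" if "x \<in> ideal_power R K n" for x n
    using idealD(1)[OF pK] that by blast
  show ?case
  proof (cases "k = 0 \<or> l = 0")
    case True
    then show ?thesis
    proof
      assume k: "k = 0"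
      show ?thesis
      proof
        fix x assume x: "x \<in> ideal_power R K (k + l)"
        have "x \<in> ideal_power R I k" using c[OF x] k by (simp add: ideal_power_0)
        moreover have "x = x \<oplus> \<zero>" using c[OF x] by simp
        ultimately show "x \<in> ideal_power R I k <+>\<^bsub>R\<^esub> ideal_power R J l"
          unfolding mem using idealD(2)[OF pJ, of l] \<open>x \<in> ideal_power R I k\<close> by blast
      qed
    next
      assume k: "l = 0"
      show ?thesis
      proof
        fix x assume x: "x \<in> ideal_power R K (k + l)"
        have "x \<in> ideal_power R J l" using c[OF x] k by (simp add: ideal_power_0)
        moreover have "x = \<zero> \<oplus> x" using c[OF x] by simp
        ultimately show "x \<in> ideal_power R I k <+>\<^bsub>R\<^esub> ideal_power R J l"
          unfolding mem using idealD(2)[OF pI, of k] \<open>x \<in> ideal_power R J l\<close> by blast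
      qed
    qed
  next
    case False
    then obtain k' l' where kl: "k = Suc k'" "l = Suc l'" by (metis not0_implies_Suc)
    define s where "s = k' + l"
    define S where "S = ideal_power R I k <+>\<^bsub>R\<^esub> ideal_power R J l"
    have S: "ideal S R" unfolding S_def by (rule sum)
    have "ideal_power R K (Suc s) \<subseteq> S"
    proof (rule ideal_power_Suc_subset)
      fix x z assume x: "x \<in> ideal_power R K s" and "z \<in> K"
      then obtain i j where ij: "i \<in> I" "j \<in> J" "z = i \<oplus> j" using K(2) by (auto simp: set_add_def')
      have cij: "i \<in> carrier R" "j \<in> carrier R" using ij idealD(1) I J by auto
      have 1: "k' + l = s" "k + l' = s" "s < k + l" using kl by (auto simp: s_def)
      obtain a b where ab: "a \<in> ideal_power R I k'" "b \<in> ideal_power R J l" "x = a \<oplus> b"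
        using less[of k' l, THEN subsetD, of x] x 1 unfolding mem by auto
      obtain d e where de: "d \<in> ideal_power R I k" "e \<in> ideal_power R J l'" "x = d \<oplus> e"
        using less[of k l', THEN subsetD, of x] x 1 unfolding mem by auto
      have cc: "a \<in> carrier R" "b \<in> carrier R" "d \<in> carrier R" "e \<in> carrier R"
        using ab de idealD(1)[OF pI] idealD(1)[OF pJ] by blast+
      have "x \<otimes> i = a \<otimes> i \<oplus> b \<otimes> i" unfolding ab using cc cij by (simp add: l_distr)
      moreover have "a \<otimes> i \<in> ideal_power R I k" unfolding kl by (rule ideal_power_mult) fact+
      moreover have "b \<otimes> i \<in> ideal_power R J l" using idealD(7)[OF pJ] ab(2) cij by blast
      ultimately have 2: "x \<otimes> i \<in> S" unfolding S_def mem by blast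
      have "x \<otimes> j = d \<otimes> j \<oplus> e \<otimes> j" unfolding de using cc cij by (simp add: l_distr)
      moreover have "e \<otimes> j \<in> ideal_power R J l" unfolding kl by (rule ideal_power_mult) fact+
      moreover have "d \<otimes> j \<in> ideal_power R I k" using idealD(7)[OF pI] de(1) cij by blast
      ultimately have 3: "x \<otimes> j \<in> S" unfolding S_def mem by blast
      have "x \<otimes> z = x \<otimes> i \<oplus> x \<otimes> j" unfolding ij using c[OF x] cij by (simp add: r_distr)
      then show "x \<otimes> z \<in> S" using idealD(3)[OF S] 2 3 by simp
    qed (use idealD(3)[OF S] in auto)
    moreover have "k + l = Suc s" by (simp add: s_def kl)
    ultimately show ?thesis by (simp only: S_def)
  qed
qed

lemma (in cring) PIdl_power:
  assumes g: "g \<in> carrier R" shows "ideal_power R (PIdl g) n \<subseteq> PIdl (g [^] n)"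
proof (induct n)
  case 0
  then show ?case using cgenideal_self[of \<one>] by (auto simp: ideal_power_0 mem_PIdl)
next
  case (Suc n)
  show ?case
  proof (rule ideal_power_Suc_subset)
    fix x y assume "x \<in> ideal_power R (PIdl g) n" "y \<in> PIdl g"
    then obtain r s where *: "r \<in> carrier R" "s \<in> carrier R" "x = g [^] n \<otimes> r" "y = g \<otimes> s"
      using Suc g mem_PIdl[of g y] mem_PIdl[of "g [^] n" x] by auto
    then have "x \<otimes> y = g [^] Suc n \<otimes> (r \<otimes> s)" using g by (simp add: m_ac)
    then show "x \<otimes> y \<in> PIdl (g [^] Suc n)" using * g mem_PIdl[of "g [^] Suc n"] by blast
  qed (use idealD(3)[OF cgenideal_ideal] g in auto)
qed

text \<open>Each generator is nilpotent modulo \<open>B\<close>. By \<open>ideal_power_sum\<close>,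
  a new generator adds its own exponent to the one found for the rest.\<close>

lemma (in cring) lin_span_power:
  assumes B: "ideal B R" and "set F \<subseteq> carrier R" "\<And>f. f \<in> set F \<Longrightarrow> \<exists>j::nat. f [^] j \<in> B"
  shows "\<exists>k. ideal_power R (lin_span (carrier R) F) k \<subseteq> B"
  using assms(2-)
proof (induct F)
  case Nil
  have "ideal_power R {\<zero>} (Suc 0) = {\<zero>}" by (rule ideal_power_1) (rule zeroideal)
  then show ?case using idealD(2)[OF B] by (metis empty_subsetI insert_subset lin_span.simps(1))
next
  case (Cons f F)
  then obtain k where k: "ideal_power R (lin_span (carrier R) F) k \<subseteq> B" by auto
  obtain j :: nat where "f [^] j \<in> B" using Cons(3)[of f] by auto
  note jk = this k
  have f: "f \<in> carrier R" "set F \<subseteq> carrier R" using Cons(2) by auto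
  have i: "ideal (PIdl f) R" "ideal (lin_span (carrier R) F) R" "ideal (lin_span (carrier R) (f # F)) R"
    using cgenideal_ideal[OF f(1)] lin_span_carrier(1)[OF Cons(2)] lin_span_carrier(1)[OF f(2)] by blast+
  have "lin_span (carrier R) (f # F) \<subseteq> PIdl f <+>\<^bsub>R\<^esub> lin_span (carrier R) F"
    using f idealD(1)[OF i(2)] by (fastforce simp: set_add_def' mem_PIdl m_comm)
  from ideal_power_sum[OF i this, of j k]
  have "ideal_power R (lin_span (carrier R) (f # F)) (j + k)
     \<subseteq> ideal_power R (PIdl f) j <+>\<^bsub>R\<^esub> ideal_power R (lin_span (carrier R) F) k" .
  moreover have "ideal_power R (PIdl f) j \<subseteq> B"
    using PIdl_power[OF f(1), of j] cgenideal_minimal[OF B jk(1)] by auto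
  ultimately have "ideal_power R (lin_span (carrier R) (f # F)) (j + k) \<subseteq> B"
    using jk(2) idealD(3)[OF B] unfolding set_add_def' by blast
  then show ?case ..
qed

text \<open>This weak form of the Artin-Rees lemma follows as in Herstein's proof of Krull's intersection
  theorem: an ideal \<open>B \<supseteq> B0\<close> that is maximal with \<open>B \<inter> N = B0\<close> contains a power of every element of \<open>M\<close>.\<close>

lemma (in noetherian_cring) power_inter_subset:
  assumes M: "ideal M R" and N: "ideal N R" and B0: "ideal B0 R" "B0 \<subseteq> N"
    and n: "\<And>x y. x \<in> ideal_power R M n \<Longrightarrow> y \<in> N \<Longrightarrow> x \<otimes> y \<in> B0"
  shows "\<exists>k. ideal_power R M k \<inter> N \<subseteq> B0"
proof -
  define F where "F = {B. ideal B R \<and> B0 \<subseteq> B \<and> B \<inter> N = B0}"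
  have "B0 \<in> F" using B0 by (auto simp: F_def)
  then obtain B where B: "B \<in> F" "\<And>I. I \<in> F \<Longrightarrow> B \<subseteq> I \<Longrightarrow> I = B"
    by (rule ideals_maximalE) (auto simp: F_def)
  then have iB: "ideal B R" and B0B: "B0 \<subseteq> B" "B \<inter> N = B0" by (auto simp: F_def)
  have pow: "\<exists>j::nat. x [^] j \<in> B" if x: "x \<in> M" for x
  proof -
    have xc: "x \<in> carrier R" using idealD(1)[OF M x] .
    \<comment> \<open>The exponent is kept at least \<open>n\<close> so that \<open>x [^] j\<close>
      lies in the \<open>n\<close>-th power of \<open>M\<close> and multiplies \<open>N\<close> into
      \<open>B0\<close>. The colon ideals increase with \<open>j\<close>, so at a maximal one they
      are stationary, in particular from \<open>j\<close> to \<open>j + j\<close>.\<close>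
    define col where "col j = {r \<in> carrier R. x [^] (j::nat) \<otimes> r \<in> B}" for j
    have "\<exists>Z\<in>col ` {n..}. \<forall>I\<in>col ` {n..}. Z \<subseteq> I \<longrightarrow> I = Z"
      by (rule ideals_maximal) (use colon_ideal[OF iB] xc in \<open>auto simp: col_def\<close>)
    then obtain j where j: "j \<ge> n" "\<And>i. i \<ge> n \<Longrightarrow> col j \<subseteq> col i \<Longrightarrow> col i = col j" by auto
    have "col j \<subseteq> col (j + j)"
      using xc idealD(6)[OF iB] by (auto simp: col_def nat_pow_mult[symmetric] m_assoc)
    then have col: "col (j + j) = col j" using j by auto
    have iP: "ideal (PIdl (x [^] j)) R" using xc by (simp add: cgenideal_ideal)
    \<comment> \<open>Enlarging \<open>B\<close> by \<open>x [^] j\<close> leaves its intersection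
      with \<open>N\<close> unchanged, so maximality of \<open>B\<close> forces
      \<open>x [^] j\<close> into \<open>B\<close>.\<close>
    define B' where "B' = B <+>\<^bsub>R\<^esub> PIdl (x [^] j)"
    have BB': "B \<subseteq> B'"
    proof
      fix b assume "b \<in> B"
      then have "b = b \<oplus> \<zero>" using idealD(1)[OF iB] by simp
      with \<open>b \<in> B\<close> show "b \<in> B'" unfolding B'_def mem_ideal_sum[OF iB iP] using idealD(2)[OF iP] by blast
    qed
    have "B' \<inter> N \<subseteq> B"
    proof
      fix u assume u: "u \<in> B' \<inter> N"
      then obtain b r where br: "b \<in> B" "r \<in> carrier R" "u = b \<oplus> x [^] j \<otimes> r"
        unfolding B'_def set_add_def' using mem_PIdl[of "x [^] j"] xc by auto
      have bc: "b \<in> carrier R" using idealD(1)[OF iB br(1)] .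
      have "x [^] j \<in> ideal_power R M n"
        using elem_power_mem[OF M x, of j] ideal_power_decreasing[OF M j(1)] by auto
      then have "x [^] j \<otimes> u \<in> B" using n u B0B by blast
      then have "x [^] j \<otimes> u \<ominus> x [^] j \<otimes> b \<in> B" using idealD(4,6)[OF iB] br xc by simp
      moreover have "x [^] j \<otimes> u \<ominus> x [^] j \<otimes> b = x [^] (j + j) \<otimes> r"
        unfolding br nat_pow_mult[OF xc, symmetric] using xc bc br(2) nat_pow_closed[OF xc, of j] by algebra
      ultimately have "r \<in> col j" using br col by (auto simp: col_def)
      then show "u \<in> B" unfolding br using idealD(3)[OF iB] br by (auto simp: col_def)
    qed
    then have "B' \<in> F" unfolding F_def using B0B BB' add_ideals[OF iB iP] by (auto simp: B'_def)
    then have "B' = B" using B(2) BB' by blast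
    moreover have "\<zero> \<oplus> x [^] j \<in> B'" unfolding B'_def mem_ideal_sum[OF iB iP]
      using cgenideal_self[of "x [^] j"] xc idealD(2)[OF iB] by blast
    ultimately show ?thesis using xc by auto
  qed
  obtain G where G: "set G \<subseteq> M" "M = lin_span (carrier R) G" using ideal_generated_list[OF M] .
  have "\<exists>k. ideal_power R (lin_span (carrier R) G) k \<subseteq> B"
    by (rule lin_span_power[OF iB]) (use G(1) pow idealD(1)[OF M] in auto)
  then show ?thesis using G(2) B0B by blast
qed

lemma (in cring) ideal_add_scaled:
  assumes N: "ideal N R" and M: "ideal M R" and x: "x \<in> carrier R"
  shows "ideal {y \<oplus> x \<otimes> \<mu> | y \<mu>. y \<in> N \<and> \<mu> \<in> M} R" (is "ideal ?B R")
proof (rule idealI_comm)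
  note N' = idealD[OF N] and M' = idealD[OF M]
  show "?B \<subseteq> carrier R" using N' M' x by auto
  have "\<zero> \<oplus> x \<otimes> \<zero> = \<zero>" using x by simp
  then show "\<zero> \<in> ?B" using N' M' by (metis (mono_tags, lifting) mem_Collect_eq)
  fix a b assume "a \<in> ?B"
  then obtain y \<mu> where 1: "a = y \<oplus> x \<otimes> \<mu>" "y \<in> N" "\<mu> \<in> M" by auto
  { assume "b \<in> ?B"
    then obtain z \<nu> where 2: "b = z \<oplus> x \<otimes> \<nu>" "z \<in> N" "\<nu> \<in> M" by auto
    have "y \<in> carrier R" "z \<in> carrier R" "\<mu> \<in> carrier R" "\<nu> \<in> carrier R" using 1 2 N' M' by auto
    then have "a \<oplus> b = (y \<oplus> z) \<oplus> x \<otimes> (\<mu> \<oplus> \<nu>)" unfolding 1 2 using x by algebra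
    then show "a \<oplus> b \<in> ?B" using 1 2 N'(3) M'(3) by blast }
  { assume b: "b \<in> carrier R"
    have "y \<in> carrier R" "\<mu> \<in> carrier R" using 1 N' M' by auto
    then have "b \<otimes> a = b \<otimes> y \<oplus> x \<otimes> (b \<otimes> \<mu>)" unfolding 1 using x b by algebra
    then show "b \<otimes> a \<in> ?B" using 1 b N'(6) M'(6) by blast }
qed

text \<open>Put \<open>N2 = N + xR\<close> and \<open>B0 = N + xM\<close>. Since \<open>M N2\<close>
  lies in \<open>B0\<close>, the weak Artin-Rees lemma puts \<open>x - y\<close> into
  \<open>B0\<close> as soon as \<open>y\<close> in \<open>N\<close> approximates \<open>x\<close>
  well enough. This gives \<open>x (1 - \<mu>)\<close> in \<open>N\<close> with \<open>\<mu>\<close>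
  in \<open>M\<close>, and \<open>1 - \<mu>\<close> is a unit.\<close>

lemma (in noetherian_cring) ideal_closed:
  assumes M: "ideal M R" and u: "\<And>x. x \<in> M \<Longrightarrow> \<one> \<ominus> x \<in> Units R"
    and N: "ideal N R" and x: "x \<in> carrier R" "\<And>k. \<exists>y\<in>N. x \<ominus> y \<in> ideal_power R M k"
  shows "x \<in> N"
proof -
  define B0 where "B0 = {y \<oplus> x \<otimes> \<mu> | y \<mu>. y \<in> N \<and> \<mu> \<in> M}"
  note N' = idealD[OF N] and M' = idealD[OF M]
  have B0: "ideal B0 R" unfolding B0_def by (rule ideal_add_scaled) fact+
  have iP: "ideal (PIdl x) R" using cgenideal_ideal[OF x(1)] .
  define N2 where "N2 = N <+>\<^bsub>R\<^esub> PIdl x"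
  have N2: "ideal N2 R" unfolding N2_def using add_ideals[OF N iP] .
  have N2m: "y \<oplus> x \<otimes> r \<in> N2" if "y \<in> N" "r \<in> carrier R" for y r
    unfolding N2_def mem_ideal_sum[OF N iP] using that mem_PIdl[OF x(1)] by blast
  have 1: "B0 \<subseteq> N2" unfolding B0_def using N2m M'(1) by blast
  have 2: "m \<otimes> z \<in> B0" if m: "m \<in> ideal_power R M (Suc 0)" "z \<in> N2" for m z
  proof -
    have mM: "m \<in> M" using m(1) ideal_power_1[OF M] by simp
    obtain y r where z: "z = y \<oplus> x \<otimes> r" "y \<in> N" "r \<in> carrier R"
      using m(2) mem_PIdl[OF x(1)] unfolding N2_def set_add_def' by auto
    then have "y \<in> carrier R" "m \<in> carrier R" using N' M' mM by auto
    then have "m \<otimes> z = m \<otimes> y \<oplus> x \<otimes> (r \<otimes> m)" unfolding z using x(1) z(3) by algebra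
    then show ?thesis unfolding B0_def using z N'(6) M'(6) M'(1) mM by blast
  qed
  obtain k where k: "ideal_power R M k \<inter> N2 \<subseteq> B0" using power_inter_subset[OF M N2 B0 1 2] by blast
  obtain y where y: "y \<in> N" "x \<ominus> y \<in> ideal_power R M k" using x(2) by blast
  have yc: "y \<in> carrier R" using N' y by auto
  have "x \<ominus> y = (\<ominus> y) \<oplus> x \<otimes> \<one>" using x(1) yc by algebra
  then have "x \<ominus> y \<in> N2" using N2m[of "\<ominus> y" \<one>] N'(5)[OF y(1)] by simp
  then obtain z \<mu> where z: "x \<ominus> y = z \<oplus> x \<otimes> \<mu>" "z \<in> N" "\<mu> \<in> M" using y(2) k by (auto simp: B0_def)
  have c: "z \<in> carrier R" "\<mu> \<in> carrier R" using z N' M' by auto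
  have "x \<otimes> (\<one> \<ominus> \<mu>) = (x \<ominus> y) \<ominus> x \<otimes> \<mu> \<oplus> y" using x(1) yc c by algebra
  also have "\<dots> = z \<oplus> y" unfolding z(1) using x(1) yc c by algebra
  finally have "x \<otimes> (\<one> \<ominus> \<mu>) \<in> N" using z y N' by simp
  then have "x \<otimes> (\<one> \<ominus> \<mu>) \<otimes> inv (\<one> \<ominus> \<mu>) \<in> N" using u[OF z(3)] N'(7) by simp
  then show "x \<in> N" using u[OF z(3)] x(1) c by (simp add: m_assoc)
qed

section \<open>Maximal ideals, associated primes and prime avoidance\<close>

lemma (in noetherian_cring) exists_maximal_ideal:
  assumes "ideal I R" "\<one> \<notin> I"
  shows "\<exists>M. maximalideal M R \<and> I \<subseteq> M"
proof -
  have "I \<in> {J. ideal J R \<and> I \<subseteq> J \<and> \<one> \<notin> J}" using assms by auto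
  then obtain M where M': "M \<in> {J. ideal J R \<and> I \<subseteq> J \<and> \<one> \<notin> J}"
     "\<And>K. K \<in> {J. ideal J R \<and> I \<subseteq> J \<and> \<one> \<notin> J} \<Longrightarrow> M \<subseteq> K \<Longrightarrow> K = M"
    by (rule ideals_maximalE) auto
  then have M: "ideal M R" "I \<subseteq> M" "\<one> \<notin> M" by auto
  have max: "K = M" if "ideal K R" "\<one> \<notin> K" "M \<subseteq> K" for K using M'(2)[of K] M that by auto
  have "maximalideal M R"
  proof (rule maximalidealI)
    show "carrier R \<noteq> M" using M(3) by auto
    fix J assume "ideal J R" "M \<subseteq> J" "J \<subseteq> carrier R"
    then show "J = M \<or> J = carrier R" using max[of J] ideal.one_imp_carrier[of J R] by auto
  qed (rule M)
  then show ?thesis using M by blast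
qed

text \<open>Among the annihilators of nonzero classes modulo \<open>I\<close>, a maximal one is
  prime; looking only at those that contain \<open>r\<close> keeps \<open>r\<close> in it. The case
  \<open>I = 0\<close> serves \<open>Ass T\<close>, the case \<open>I = pT\<close> serves
  \<open>Ass (T/pT)\<close>.\<close>

lemma (in noetherian_cring) zero_divisor_in_associated_prime:
  assumes I: "ideal I R" and z: "z \<in> carrier R" "z \<notin> I" and r: "r \<in> carrier R" "r \<otimes> z \<in> I"
  shows "\<exists>P w. primeideal P R \<and> w \<in> carrier R \<and> P = {s \<in> carrier R. s \<otimes> w \<in> I} \<and> r \<in> P"
proof -
  define col where "col w = {s \<in> carrier R. s \<otimes> w \<in> I}" for w
  have ic: "ideal (col w) R" if "w \<in> carrier R" for w
  proof -
    have "col w = {s \<in> carrier R. w \<otimes> s \<in> I}" using that by (auto simp: col_def m_comm)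
    then show ?thesis using colon_ideal[OF I that] by simp
  qed
  have "col z \<in> col ` {w \<in> carrier R - I. r \<in> col w}" using z r by (auto simp: col_def)
  then obtain M where M: "M \<in> col ` {w \<in> carrier R - I. r \<in> col w}"
    "\<And>K. K \<in> col ` {w \<in> carrier R - I. r \<in> col w} \<Longrightarrow> M \<subseteq> K \<Longrightarrow> K = M"
    by (rule ideals_maximalE) (use ic in auto)
  then obtain w where w: "w \<in> carrier R" "w \<notin> I" "r \<in> col w" "M = col w" by auto
  have max: "col v = col w" if "v \<in> carrier R" "v \<notin> I" "r \<in> col v" "col w \<subseteq> col v" for v
    using M(2)[of "col v"] that w(4) by auto
  have "primeideal (col w) R"
  proof (rule primeidealI[OF ic[OF w(1)] is_cring])
    have "\<one> \<notin> col w" using w by (simp add: col_def)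
    then show "carrier R \<noteq> col w" by auto
    fix a b assume ab: "a \<in> carrier R" "b \<in> carrier R" "a \<otimes> b \<in> col w"
    show "a \<in> col w \<or> b \<in> col w"
    proof (rule disjCI)
      assume "b \<notin> col w"
      then have b: "b \<otimes> w \<notin> I" using ab by (auto simp: col_def)
      have "col w \<subseteq> col (b \<otimes> w)"
      proof
        fix s assume s: "s \<in> col w"
        then have "s \<otimes> (b \<otimes> w) = b \<otimes> (s \<otimes> w)" using ab(2) w(1) by (auto simp: col_def m_lcomm)
        then show "s \<in> col (b \<otimes> w)" using s idealD(6)[OF I, of "s \<otimes> w" b] ab(2) by (simp add: col_def)
      qed
      moreover then have "r \<in> col (b \<otimes> w)" using w(3) by blast
      ultimately have "col (b \<otimes> w) = col w" using max[of "b \<otimes> w"] b ab w(1) by simp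
      moreover have "a \<in> col (b \<otimes> w)" using ab w(1) by (simp add: col_def m_assoc)
      ultimately show "a \<in> col w" by simp
    qed
  qed
  then show ?thesis using w unfolding col_def by blast
qed

lemma (in cring) prime_not_contains_inter:
  assumes "finite C" "\<And>Q. Q \<in> C \<Longrightarrow> ideal Q R \<and> \<not> Q \<subseteq> P" "primeideal P R" "ideal I R" "\<not> I \<subseteq> P"
  shows "\<exists>y\<in>I. y \<notin> P \<and> (\<forall>Q\<in>C. y \<in> Q)"
  using assms(1,2)
proof (induct C)
  case empty
  then show ?case using assms(5) by auto
next
  case (insert Q C)
  then obtain y where y: "y \<in> I" "y \<notin> P" "\<forall>Q\<in>C. y \<in> Q" by auto
  obtain w where w: "w \<in> Q" "w \<notin> P" using insert by blast
  have c: "y \<in> carrier R" "w \<in> carrier R" using idealD(1)[of I] assms(4) y w idealD(1)[of Q] insert by auto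
  have "y \<otimes> w \<in> I" "y \<otimes> w \<notin> P" using y w c idealD(7)[OF assms(4)] primeD(3)[OF assms(3)] by auto
  moreover have "y \<otimes> w \<in> Q'" if "Q' \<in> insert Q C" for Q'
    using that idealD(6,7)[of Q'] insert.prems y w c by auto
  ultimately show ?case by blast
qed

text \<open>If the element \<open>x\<close> found so far lies in the new prime \<open>Q\<close>,
  incomparability provides some \<open>y\<close> in \<open>I\<close> that lies in all earlier primes
  but not in \<open>Q\<close>; then \<open>x + y\<close> avoids them all.\<close>

lemma (in cring) prime_avoidance:
  assumes "finite C" "\<And>Q. Q \<in> C \<Longrightarrow> primeideal Q R \<and> \<not> I \<subseteq> Q" "ideal I R"
    "\<And>Q Q'. Q \<in> C \<Longrightarrow> Q' \<in> C \<Longrightarrow> Q \<noteq> Q' \<Longrightarrow> \<not> Q \<subseteq> Q'"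
  shows "\<exists>x\<in>I. \<forall>Q\<in>C. x \<notin> Q"
  using assms(1,2,4)
proof (induct C)
  case empty
  then show ?case using idealD(2)[OF assms(3)] by auto
next
  case (insert Q C)
  then obtain x where x: "x \<in> I" "\<forall>Q\<in>C. x \<notin> Q" by auto
  show ?case
  proof (cases "x \<in> Q")
    case True
    have "\<exists>y\<in>I. y \<notin> Q \<and> (\<forall>Q\<in>C. y \<in> Q)"
      by (rule prime_not_contains_inter) (use insert assms(3) primeD(1) in auto)
    then obtain y where y: "y \<in> I" "y \<notin> Q" "\<forall>Q\<in>C. y \<in> Q" by blast
    have c: "x \<in> carrier R" "y \<in> carrier R" using x y idealD(1)[OF assms(3)] by auto
    have e: "x \<oplus> y \<ominus> x = y" "x \<oplus> y \<ominus> y = x" using c by algebra+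
    have "x \<oplus> y \<notin> Q"
    proof
      assume *: "x \<oplus> y \<in> Q"
      have "ideal Q R" using insert primeD(1) by auto
      then have "x \<oplus> y \<ominus> x \<in> Q" using idealD(4) * True by blast
      then show False using e y by simp
    qed
    moreover have "x \<oplus> y \<notin> Q'" if Q': "Q' \<in> C" for Q'
    proof
      assume *: "x \<oplus> y \<in> Q'"
      have "ideal Q' R" using insert primeD(1) Q' by auto
      then have "x \<oplus> y \<ominus> y \<in> Q'" using idealD(4) * y Q' by blast
      then show False using e x Q' by simp
    qed
    moreover have "x \<oplus> y \<in> I" using x y idealD(3)[OF assms(3)] by simp
    ultimately show ?thesis by blast
  qed (use x in auto)
qed

section \<open>Complete local rings\<close>

context complete_local_ring begin

sublocale noetherian_cring T by unfold_locales

abbreviation "MT n \<equiv> ideal_power T \<mm> n"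

lemma max_ideal: "ideal \<mm> T" by (rule is_ideal)

lemma power_ideal: "ideal (MT n) T" by (rule ideal_ideal_power) (rule max_ideal)

lemma one_not_max: "\<one> \<notin> \<mm>" using I_notcarr one_imp_carrier by auto

lemma unit_iff: assumes "x \<in> carrier T" shows "x \<in> Units T \<longleftrightarrow> x \<notin> \<mm>"
proof
  assume x: "x \<in> Units T"
  show "x \<notin> \<mm>"
  proof
    assume "x \<in> \<mm>"
    then show False using idealD(7)[OF max_ideal _ Units_inv_closed[OF x], of x] x one_not_max by simp
  qed
next
  assume x: "x \<notin> \<mm>"
  have "\<one> \<in> PIdl x"
  proof (rule ccontr)
    assume "\<one> \<notin> PIdl x"
    then obtain M where "maximalideal M T" "PIdl x \<subseteq> M"
      using exists_maximal_ideal[OF cgenideal_ideal[OF assms]] by auto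
    moreover have "M = \<mm>" using unique_maximalideal \<open>maximalideal M T\<close> is_maximalideal by blast
    ultimately show False using x cgenideal_self[OF assms] by auto
  qed
  then obtain r where "r \<in> carrier T" "\<one> = x \<otimes> r" using mem_PIdl[OF assms] by auto
  then show "x \<in> Units T" unfolding Units_def using assms by (auto simp: m_comm)
qed

lemma one_minus_unit: "x \<in> \<mm> \<Longrightarrow> \<one> \<ominus> x \<in> Units T"
proof -
  assume x: "x \<in> \<mm>"
  have xc: "x \<in> carrier T" using x idealD(1)[OF max_ideal] by auto
  have "\<one> \<ominus> x \<oplus> x = \<one>" using xc by algebra
  then have "\<one> \<ominus> x \<notin> \<mm>" using idealD(3)[OF max_ideal, of "\<one> \<ominus> x" x] x one_not_max by auto
  then show ?thesis using unit_iff xc by simp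
qed

lemmas closed = ideal_closed[OF max_ideal one_minus_unit]

lemma prime_le_max: assumes "primeideal Q T" shows "Q \<subseteq> \<mm>"
proof -
  obtain M where "maximalideal M T" "Q \<subseteq> M"
    using exists_maximal_ideal[of Q] primeD[OF assms] by auto
  moreover have "M = \<mm>" using unique_maximalideal \<open>maximalideal M T\<close> is_maximalideal by blast
  ultimately show ?thesis by simp
qed

lemma hausdorff:
  assumes "x \<in> carrier T" "\<And>k. x \<in> MT k" shows "x = \<zero>"
proof -
  have "x \<in> {\<zero>}"
  proof (rule closed[OF _ zeroideal assms(1)])
    show "\<exists>y\<in>{\<zero>}. x \<ominus> y \<in> MT k" for k
      using assms by (simp add: minus_eq)
  qed
  then show ?thesis by simp
qed

lemma hausdorff_eq:
  assumes "x \<in> carrier T" "y \<in> carrier T" "\<And>k. x \<ominus> y \<in> MT k" shows "x = y"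
  using hausdorff[of "x \<ominus> y"] assms by simp

text \<open>All terms from the \<open>n\<close>-th on are congruent modulo the \<open>n\<close>-th
  power of \<open>\<mm>\<close>, so comparing with a term far out gives the limit with an explicit
  rate. That rate is exactly what the completion map asks for.\<close>

lemma limit_exists:
  assumes "\<And>n. x n \<in> carrier T" "\<And>n. x (Suc n) \<ominus> x n \<in> MT n"
  shows "\<exists>l\<in>carrier T. \<forall>n. x n \<ominus> l \<in> MT n"
proof -
  have 1: "x i \<ominus> x n \<in> MT n" if "n \<le> i" for n i
    using that
  proof (induct rule: dec_induct)
    case base
    show ?case using idealD(2)[OF power_ideal] assms(1) by (simp add: a_minus_def r_neg)
  next
    case (step i)
    have "x (Suc i) \<ominus> x n = (x (Suc i) \<ominus> x i) \<oplus> (x i \<ominus> x n)" using assms(1)[of "Suc i"] assms(1)[of i] assms(1)[of n] by algebra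
    moreover have "x (Suc i) \<ominus> x i \<in> MT n"
      using assms(2)[of i] ideal_power_decreasing[OF max_ideal, of n i] step by auto
    ultimately show ?case using step idealD(3)[OF power_ideal] by simp
  qed
  have "adic_Cauchy T \<mm> x"
    unfolding adic_Cauchy_def
  proof (intro allI exI[where x = n for n] impI)
    fix n i j :: nat assume "n \<le> i" "n \<le> j"
    have "x i \<ominus> x j = (x i \<ominus> x n) \<ominus> (x j \<ominus> x n)"
      using assms(1)[of i] assms(1)[of j] assms(1)[of n] by algebra
    then show "x i \<ominus> x j \<in> MT n"
      using 1[OF \<open>n \<le> i\<close>] 1[OF \<open>n \<le> j\<close>] idealD(4)[OF power_ideal] by simp
  qed
  then obtain l where l: "l \<in> carrier T" "adic_limit T \<mm> x l" using complete[of x] assms(1) by blast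
  have "x n \<ominus> l \<in> MT n" for n
  proof -
    obtain N where N: "\<And>i. i \<ge> N \<Longrightarrow> x i \<ominus> l \<in> MT n" using l by (auto simp: adic_limit_def)
    define i where "i = max n N"
    have "x n \<ominus> l = (x i \<ominus> l) \<ominus> (x i \<ominus> x n)" using assms(1)[of i] assms(1)[of n] l by algebra
    moreover have "x i \<ominus> l \<in> MT n" "x i \<ominus> x n \<in> MT n"
      using N[of i] 1[of n i] by (auto simp: i_def)
    ultimately show ?thesis using idealD(4)[OF power_ideal] by simp
  qed
  then show ?thesis using l by blast
qed

end

section \<open>Completion\<close>

lemma (in cring) mem_coset: "ideal I R \<Longrightarrow> t \<in> carrier R \<Longrightarrow> x \<in> I +> t \<longleftrightarrow> x \<in> carrier R \<and> x \<ominus> t \<in> I"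
proof -
  assume I: "ideal I R" and t: "t \<in> carrier R"
  have "x = (x \<ominus> t) \<oplus> t" if "x \<in> carrier R" using that t by algebra
  moreover have "i \<oplus> t \<ominus> t = i" if "i \<in> carrier R" for i using that t by algebra
  ultimately show ?thesis using idealD(1)[OF I] t by (auto simp: a_r_coset_def')
qed

lemma (in cring) quot_simps:
  "carrier (R Quot I) = (\<lambda>a. I +> a) ` carrier R"
  "\<zero>\<^bsub>R Quot I\<^esub> = I" "\<one>\<^bsub>R Quot I\<^esub> = I +> \<one>"
  "ideal I R \<Longrightarrow> a \<in> carrier R \<Longrightarrow> b \<in> carrier R \<Longrightarrow> (I +> a) \<oplus>\<^bsub>R Quot I\<^esub> (I +> b) = I +> (a \<oplus> b)"
  "ideal I R \<Longrightarrow> a \<in> carrier R \<Longrightarrow> b \<in> carrier R \<Longrightarrow> (I +> a) \<otimes>\<^bsub>R Quot I\<^esub> (I +> b) = I +> (a \<otimes> b)"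
  by (auto simp: FactRing_def A_RCOSETS_def' ideal.rcoset_mult_add abelian_subgroup.a_rcos_sum ideal.a_rcos_sum)

text \<open>Negation is a definite description over the carrier, so restricting the carrier changes
  the term; agreement comes from uniqueness of inverses.\<close>

lemma (in cring) a_minus_subring:
  assumes A: "subring A R" "x \<in> A" "y \<in> A" shows "x \<ominus>\<^bsub>subring_of R A\<^esub> y = x \<ominus> y"
proof -
  interpret S: cring "subring_of R A" by (rule subring_cring) fact
  have "x \<ominus>\<^bsub>subring_of R A\<^esub> y \<oplus> y = x" using S.minus_eq[of x y] S.l_neg[of y] S.a_assoc[of x "\<ominus>\<^bsub>subring_of R A\<^esub> y" y]
      S.a_inv_closed[of y] S.r_zero[of x] A
    by simp
  moreover have "x \<ominus>\<^bsub>subring_of R A\<^esub> y \<in> A" using S.minus_closed A by simp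
  ultimately show ?thesis using A subringD(1)[OF A(1)]
    by (metis (no_types, lifting) a_minus_def a_inv_closed add.inv_solve_right)
qed

lemma (in cring) subring_idealD:
  assumes "subring A R" "ideal I (subring_of R A)"
  shows "\<And>x. x \<in> I \<Longrightarrow> x \<in> A" "\<zero> \<in> I"
    "\<And>x y. x \<in> I \<Longrightarrow> y \<in> I \<Longrightarrow> x \<oplus> y \<in> I"
    "\<And>x y. x \<in> I \<Longrightarrow> y \<in> I \<Longrightarrow> x \<ominus> y \<in> I"
    "\<And>x r. x \<in> I \<Longrightarrow> r \<in> A \<Longrightarrow> r \<otimes> x \<in> I"
    "\<And>x r. x \<in> I \<Longrightarrow> r \<in> A \<Longrightarrow> x \<otimes> r \<in> I"
proof -
  interpret S: cring "subring_of R A" by (rule subring_cring) fact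
  note d = S.idealD[OF assms(2)]
  show 1: "\<And>x. x \<in> I \<Longrightarrow> x \<in> A" "\<zero> \<in> I"
    "\<And>x y. x \<in> I \<Longrightarrow> y \<in> I \<Longrightarrow> x \<oplus> y \<in> I"
    "\<And>x r. x \<in> I \<Longrightarrow> r \<in> A \<Longrightarrow> r \<otimes> x \<in> I"
    "\<And>x r. x \<in> I \<Longrightarrow> r \<in> A \<Longrightarrow> x \<otimes> r \<in> I"
    using d by auto
  show "\<And>x y. x \<in> I \<Longrightarrow> y \<in> I \<Longrightarrow> x \<ominus> y \<in> I"
    using d(4) a_minus_subring[OF assms(1)] 1(1) by metis
qed

lemma (in cring) mem_coset_subring:
  assumes "subring A R" "ideal I (subring_of R A)" "a \<in> A"
  shows "x \<in> I +>\<^bsub>subring_of R A\<^esub> a \<longleftrightarrow> x \<in> A \<and> x \<ominus> a \<in> I"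
proof -
  interpret S: cring "subring_of R A" by (rule subring_cring) fact
  show ?thesis using S.mem_coset[OF assms(2), of a x] a_minus_subring[OF assms(1) _ assms(3)] assms(3) by auto
qed

lemma (in cring) mult_diff_mem:
  assumes I: "ideal I R" and c: "a \<in> carrier R" "a' \<in> carrier R" "b \<in> carrier R" "b' \<in> carrier R"
    and d: "a \<ominus> a' \<in> I" "b \<ominus> b' \<in> I"
  shows "a \<otimes> b \<ominus> a' \<otimes> b' \<in> I"
proof -
  have "a \<otimes> b \<ominus> a' \<otimes> b' = a \<otimes> (b \<ominus> b') \<oplus> (a \<ominus> a') \<otimes> b'" using c by algebra
  then show ?thesis using d c idealD[OF I] by simp
qed

lemma (in cring) add_diff_mem:
  assumes I: "ideal I R" and c: "a \<in> carrier R" "a' \<in> carrier R" "b \<in> carrier R" "b' \<in> carrier R"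
    and d: "a \<ominus> a' \<in> I" "b \<ominus> b' \<in> I"
  shows "(a \<oplus> b) \<ominus> (a' \<oplus> b') \<in> I"
proof -
  have "(a \<oplus> b) \<ominus> (a' \<oplus> b') = (a \<ominus> a') \<oplus> (b \<ominus> b')" using c by algebra
  then show ?thesis using d c idealD[OF I] by simp
qed

lemma (in cring) diff_trans:
  assumes I: "ideal I R" and c: "a \<in> carrier R" "b \<in> carrier R" "c \<in> carrier R"
    and d: "a \<ominus> b \<in> I" "b \<ominus> c \<in> I"
  shows "a \<ominus> c \<in> I"
proof -
  have "a \<ominus> c = (a \<ominus> b) \<oplus> (b \<ominus> c)" using c by algebra
  then show ?thesis using d c idealD[OF I] by simp
qed

lemma (in cring) diff_sym:
  assumes I: "ideal I R" and c: "a \<in> carrier R" "b \<in> carrier R" and d: "a \<ominus> b \<in> I"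
  shows "b \<ominus> a \<in> I"
proof -
  have "b \<ominus> a = \<ominus> (a \<ominus> b)" using c by algebra
  then show ?thesis using d c idealD[OF I] by simp
qed

locale subring_of_complete = complete_local_ring +
  fixes A assumes subring: "subring A T"
begin

abbreviation "S \<equiv> subring_of T A"
abbreviation "M \<equiv> A \<inter> \<mm>"
abbreviation "MS n \<equiv> ideal_power S M n"
abbreviation "coset n a \<equiv> MS n +>\<^bsub>S\<^esub> a"
abbreviation "PS a \<equiv> PIdl\<^bsub>S\<^esub> a"

lemma M_ideal: "ideal M S"
  using ideal_inter_subring[OF subring max_ideal] by (simp add: Int_commute)

sublocale S: cring S by (rule subring_cring[OF subring])

lemma MS_ideal: "ideal (MS n) S" by (rule S.ideal_ideal_power[OF M_ideal])

lemma MS_le: "MS n \<subseteq> MT n" by (rule ideal_power_inter_subring[OF subring max_ideal M_ideal]) auto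

lemmas A = subringD[OF subring]
lemmas MS = subring_idealD[OF subring MS_ideal]
lemmas MT = idealD[OF power_ideal]

abbreviation "Ahat \<equiv> adic_completion S M"
abbreviation "\<phi> \<equiv> completion_map T \<mm>"

text \<open>Since the cosets decrease, a representative at stage \<open>n + 1\<close> also lies in
  the coset at stage \<open>n\<close>; this is the coherence of the representatives.\<close>

lemma carrier_completion:
  "x \<in> carrier Ahat \<longleftrightarrow>
    (\<exists>a. (\<forall>n. a n \<in> A) \<and> (\<forall>n. a (Suc n) \<ominus> a n \<in> MS n) \<and> x = (\<lambda>n. coset n (a n)))"
proof
  assume x: "x \<in> carrier Ahat"
  then have "\<And>n. x n \<in> carrier (S Quot MS n)" by (simp add: adic_completion_def)
  then have "\<forall>n. \<exists>a\<in>A. x n = coset n a" unfolding S.quot_simps(1) image_iff by simp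
  then obtain a where a: "\<And>n. a n \<in> A" "\<And>n. x n = coset n (a n)" by metis
  have "a (Suc n) \<ominus> a n \<in> MS n" for n
  proof -
    have "a (Suc n) \<in> x (Suc n)" unfolding a(2) mem_coset_subring[OF subring MS_ideal a(1)]
      using a(1) MS(2)[of "Suc n"] A(1) by (simp add: a_minus_def r_neg)
    then have "a (Suc n) \<in> x n" using x by (auto simp: adic_completion_def)
    then show ?thesis unfolding a(2) mem_coset_subring[OF subring MS_ideal a(1)] by simp
  qed
  then show "\<exists>a. (\<forall>n. a n \<in> A) \<and> (\<forall>n. a (Suc n) \<ominus> a n \<in> MS n) \<and> x = (\<lambda>n. coset n (a n))"
    using a by blast
next
  assume "\<exists>a. (\<forall>n. a n \<in> A) \<and> (\<forall>n. a (Suc n) \<ominus> a n \<in> MS n) \<and> x = (\<lambda>n. coset n (a n))"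
  then obtain a where a: "\<And>n. a n \<in> A" "\<And>n. a (Suc n) \<ominus> a n \<in> MS n" "x = (\<lambda>n. coset n (a n))" by blast
  have "coset (Suc n) (a (Suc n)) \<subseteq> coset n (a n)" for n
  proof
    fix z assume "z \<in> coset (Suc n) (a (Suc n))"
    then have z: "z \<in> A" "z \<ominus> a (Suc n) \<in> MS (Suc n)"
      unfolding mem_coset_subring[OF subring MS_ideal a(1)] by auto
    have "z \<ominus> a (Suc n) \<in> MS n" using z S.ideal_power_decreasing[OF M_ideal, of n "Suc n"] by auto
    moreover have "z \<ominus> a n = (z \<ominus> a (Suc n)) \<oplus> (a (Suc n) \<ominus> a n)"
      using A(1)[OF a(1)[of n]] A(1)[OF a(1)[of "Suc n"]] A(1)[OF z(1)] by algebra
    ultimately have "z \<ominus> a n \<in> MS n" using MS(3) a(2) by simp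
    then show "z \<in> coset n (a n)" unfolding mem_coset_subring[OF subring MS_ideal a(1)] using z by simp
  qed
  then show "x \<in> carrier Ahat" using a by (auto simp: adic_completion_def S.quot_simps simp del: nat_pow_Suc)
qed

lemma coset_subset_iff:
  assumes "a \<in> A" "t \<in> carrier T"
  shows "coset n a \<subseteq> MT n +> t \<longleftrightarrow> a \<ominus> t \<in> MT n"
proof
  assume "coset n a \<subseteq> MT n +> t"
  moreover have "a \<in> coset n a" unfolding mem_coset_subring[OF subring MS_ideal assms(1)]
    using assms(1) MS(2) A(1) by (simp add: a_minus_def r_neg)
  ultimately show "a \<ominus> t \<in> MT n" using mem_coset[OF power_ideal assms(2)] by auto
next
  assume a: "a \<ominus> t \<in> MT n"
  show "coset n a \<subseteq> MT n +> t"
  proof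
    fix z assume "z \<in> coset n a"
    then have z: "z \<in> A" "z \<ominus> a \<in> MT n"
      unfolding mem_coset_subring[OF subring MS_ideal assms(1)] using MS_le by auto
    then show "z \<in> MT n +> t" unfolding mem_coset[OF power_ideal assms(2)]
      using diff_trans[OF power_ideal, of z a t] a A(1) assms by auto
  qed
qed

text \<open>The description that defines the map has at most one solution because \<open>T\<close>
  is Hausdorff.\<close>

lemma completion_map_unique:
  assumes a: "\<And>n. a n \<in> A" and t: "t \<in> carrier T" "\<And>n. a n \<ominus> t \<in> MT n"
  shows "\<phi> (\<lambda>n. coset n (a n)) = t"
  unfolding completion_map_def
proof (rule the_equality)
  show "t \<in> carrier T \<and> (\<forall>n. coset n (a n) \<subseteq> MT n +> t)"
    using coset_subset_iff[OF a t(1)] t by simp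
  fix s assume s: "s \<in> carrier T \<and> (\<forall>n. coset n (a n) \<subseteq> MT n +> s)"
  show "s = t"
  proof (rule hausdorff_eq)
    fix k
    have *: "a k \<ominus> s \<in> MT k" using s coset_subset_iff[OF a, of s k k] by simp
    have "s \<ominus> a k \<in> MT k" using diff_sym[OF power_ideal _ _ *] s A(1)[OF a] by simp
    then show "s \<ominus> t \<in> MT k" using diff_trans[OF power_ideal, of s "a k" t] t s A(1)[OF a] by simp
  qed (use s t in auto)
qed

lemma completion_map_eq:
  assumes "\<And>n. a n \<in> A" "\<And>n. a (Suc n) \<ominus> a n \<in> MS n"
  shows "\<phi> (\<lambda>n. coset n (a n)) \<in> carrier T \<and> (\<forall>n. a n \<ominus> \<phi> (\<lambda>n. coset n (a n)) \<in> MT n)"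
proof -
  obtain l where "l \<in> carrier T" "\<forall>n. a n \<ominus> l \<in> MT n"
    using limit_exists[of a] assms MS_le A(1) by blast
  then show ?thesis using completion_map_unique[of a l] assms by simp
qed

lemma coset_eq_subring:
  assumes "a \<in> A" "b \<in> A" shows "coset n a = coset n b \<longleftrightarrow> a \<ominus> b \<in> MS n"
  using S.quotient_eq_iff_same_a_r_cos[OF MS_ideal, of a b n] a_minus_subring[OF subring assms] assms by simp

text \<open>Surjectivity makes every element of \<open>T\<close> the limit of a coherent sequence in
  \<open>A\<close>, which gives density. Injectivity says that coherent sequences with the same
  limit agree modulo \<open>MS n\<close>; this is applied to the constant sequence at
  \<open>a\<close> in \<open>MT n \<inter> A\<close> and a sequence with limit \<open>a\<close>
  whose \<open>n\<close>-th term lies in \<open>MS n\<close>.\<close>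

lemma completion_eqD:
  assumes "completion_eq T \<mm> A"
  shows completion_eq_dense: "\<And>t n. t \<in> carrier T \<Longrightarrow> \<exists>a\<in>A. t \<ominus> a \<in> MT n"
    and completion_eq_power: "\<And>n. MT n \<inter> A \<subseteq> MS n"
proof -
  have bij: "bij_betw \<phi> (carrier Ahat) (carrier T)"
    using assms by (auto simp: completion_eq_def ring_iso_def)
  define co where "co a t \<longleftrightarrow> (\<forall>n. a n \<in> A \<and> a (Suc n) \<ominus> a n \<in> MS n \<and> a n \<ominus> t \<in> MT n)" for a t
  have ex: "\<exists>a. co a t" if t: "t \<in> carrier T" for t
  proof -
    have "t \<in> \<phi> ` carrier Ahat" using t unfolding bij_betw_imp_surj_on[OF bij] .
    then obtain x where x: "x \<in> carrier Ahat" "\<phi> x = t" by (elim imageE) simp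
    then obtain a where "\<And>n. a n \<in> A" "\<And>n. a (Suc n) \<ominus> a n \<in> MS n" "x = (\<lambda>n. coset n (a n))"
      unfolding carrier_completion by blast
    then have "co a t" using completion_map_eq[of a] x(2) by (auto simp: co_def)
    then show ?thesis by blast
  qed
  have un: "a n \<ominus> b n \<in> MS n" if t: "t \<in> carrier T" and co: "co a t" "co b t" for a b t n
  proof -
    let ?x = "\<lambda>n. coset n (a n)" and ?y = "\<lambda>n. coset n (b n)"
    have "?x \<in> carrier Ahat" "?y \<in> carrier Ahat" unfolding carrier_completion using co by (auto simp: co_def)
    moreover have "\<phi> ?x = t" "\<phi> ?y = t" using co completion_map_unique[OF _ t] by (auto simp: co_def)
    ultimately have "?x = ?y" using bij by (auto simp: bij_betw_def inj_on_def)
    then have "coset n (a n) = coset n (b n)" by meson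
    then show ?thesis using coset_eq_subring[of "a n" "b n" n] co by (auto simp: co_def)
  qed
  show "\<exists>a\<in>A. t \<ominus> a \<in> MT n" if t: "t \<in> carrier T" for t n
  proof -
    obtain a where "co a t" using ex[OF t] ..
    then have "a n \<in> A" "a n \<ominus> t \<in> MT n" by (auto simp: co_def)
    then show ?thesis using diff_sym[OF power_ideal] t A(1) by blast
  qed
  \<comment> \<open>The limits of coherent sequences in \<open>A\<close> with \<open>n\<close>-th term in \<open>MS n\<close> form an ideal containing \<open>\<mm>\<^sup>n\<close>.\<close>
  have J: "MT n \<subseteq> {t \<in> carrier T. \<exists>a. co a t \<and> a n \<in> MS n}" for n
  proof (induct n)
    case 0
    show ?case using ex MT(1) by (fastforce simp: co_def ideal_power_0)
  next
    case (Suc n)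
    show ?case
    proof (rule ideal_power_Suc_subset)
      fix u v assume u: "u \<in> MT n" and v: "v \<in> \<mm>"
      obtain a where a: "co a u" "a n \<in> MS n" using Suc u by auto
      have c: "u \<in> carrier T" "v \<in> carrier T" using u MT(1) v idealD(1)[OF max_ideal] by auto
      obtain b where b: "co b v" using ex[OF c(2)] ..
      have ab: "a k \<in> A" "b k \<in> A" "a k \<in> carrier T" "b k \<in> carrier T" for k
        using a b A(1) by (auto simp: co_def)
      have "co (\<lambda>k. a k \<otimes> b k) (u \<otimes> v)" unfolding co_def
      proof (intro allI conjI)
        fix k
        show "a k \<otimes> b k \<in> A" using ab A by simp
        show "a k \<otimes> b k \<ominus> u \<otimes> v \<in> MT k"
          by (rule mult_diff_mem[OF power_ideal]) (use ab c a b in \<open>auto simp: co_def\<close>)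
        have "a (Suc k) \<otimes> b (Suc k) \<ominus>\<^bsub>S\<^esub> a k \<otimes> b k \<in> MS k"
          using S.mult_diff_mem[OF MS_ideal, of "a (Suc k)" "a k" "b (Suc k)" "b k" k] ab a b
            a_minus_subring[OF subring] by (auto simp: co_def)
        then show "a (Suc k) \<otimes> b (Suc k) \<ominus> a k \<otimes> b k \<in> MS k"
          using a_minus_subring[OF subring] ab A(7) by simp
      qed
      moreover have "b (Suc n) \<in> M"
      proof -
        have "b (Suc n) \<ominus> v \<in> \<mm>" using b ideal_power_decreasing[OF max_ideal, of "Suc 0" "Suc n"]
          ideal_power_1[OF max_ideal] unfolding co_def by blast
        then have "b (Suc n) \<ominus> v \<oplus> v \<in> \<mm>" using v idealD(3)[OF max_ideal] by blast
        moreover have "b (Suc n) \<ominus> v \<oplus> v = b (Suc n)" using ab(4)[of "Suc n"] c by algebra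
        ultimately show ?thesis using ab by simp
      qed
      moreover have "a (Suc n) \<in> MS n"
      proof -
        have "a (Suc n) \<ominus> a n \<oplus> a n \<in> MS n" using a MS(3) unfolding co_def by blast
        moreover have "a (Suc n) \<ominus> a n \<oplus> a n = a (Suc n)" using ab(3)[of "Suc n"] ab(3)[of n] by algebra
        ultimately show ?thesis by simp
      qed
      ultimately have "co (\<lambda>k. a k \<otimes> b k) (u \<otimes> v) \<and> a (Suc n) \<otimes> b (Suc n) \<in> MS (Suc n)"
        using S.ideal_power_mult[of "a (Suc n)" M n "b (Suc n)"] by simp
      then show "u \<otimes> v \<in> {t \<in> carrier T. \<exists>a. co a t \<and> a (Suc n) \<in> MS (Suc n)}" using c by blast
    next
      fix x y assume "x \<in> {t \<in> carrier T. \<exists>a. co a t \<and> a (Suc n) \<in> MS (Suc n)}"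
        "y \<in> {t \<in> carrier T. \<exists>a. co a t \<and> a (Suc n) \<in> MS (Suc n)}"
      then obtain a b where c: "x \<in> carrier T" "y \<in> carrier T" and a: "co a x" "a (Suc n) \<in> MS (Suc n)"
        and b: "co b y" "b (Suc n) \<in> MS (Suc n)" by blast
      have ab: "a k \<in> A" "b k \<in> A" "a k \<in> carrier T" "b k \<in> carrier T" for k
        using a b A(1) by (auto simp: co_def)
      have "co (\<lambda>k. a k \<oplus> b k) (x \<oplus> y)" unfolding co_def
      proof (intro allI conjI)
        fix k
        show "a k \<oplus> b k \<in> A" using ab A by simp
        show "(a k \<oplus> b k) \<ominus> (x \<oplus> y) \<in> MT k"
          by (rule add_diff_mem[OF power_ideal]) (use ab c a b in \<open>auto simp: co_def\<close>)
        have "(a (Suc k) \<oplus> b (Suc k)) \<ominus>\<^bsub>S\<^esub> (a k \<oplus> b k) \<in> MS k"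
          using S.add_diff_mem[OF MS_ideal, of "a (Suc k)" "a k" "b (Suc k)" "b k" k] ab a b
            a_minus_subring[OF subring] by (auto simp: co_def)
        then show "(a (Suc k) \<oplus> b (Suc k)) \<ominus> (a k \<oplus> b k) \<in> MS k"
          using a_minus_subring[OF subring] ab A(5) by simp
      qed
      moreover have "a (Suc n) \<oplus> b (Suc n) \<in> MS (Suc n)" using a b MS(3) by blast
      ultimately show "x \<oplus> y \<in> {t \<in> carrier T. \<exists>a. co a t \<and> a (Suc n) \<in> MS (Suc n)}" using c by blast
    qed
  qed
  show "MT n \<inter> A \<subseteq> MS n" for n
  proof
    fix a assume a: "a \<in> MT n \<inter> A"
    then obtain b where b: "co b a" "b n \<in> MS n" using J by auto
    have c: "a \<in> carrier T" "b n \<in> carrier T" using a b A(1) by (auto simp: co_def)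
    have "co (\<lambda>_. a) a" using a c MS(2) MT(2) by (auto simp: co_def a_minus_def r_neg)
    then have "a \<ominus> b n \<in> MS n" using un[OF c(1) _ b(1)] by blast
    then have "a \<ominus> b n \<oplus> b n \<in> MS n" using b MS(3) by blast
    moreover have "a \<ominus> b n \<oplus> b n = a" using c by algebra
    ultimately show "a \<in> MS n" by simp
  qed
qed

text \<open>The second hypothesis turns congruences in \<open>T\<close> between elements of
  \<open>A\<close> into congruences in \<open>A\<close>. This yields injectivity, and it makes the
  approximations supplied by density coherent, which yields surjectivity.\<close>

lemma completion_eqI:
  assumes dense: "\<And>t n. t \<in> carrier T \<Longrightarrow> \<exists>a\<in>A. t \<ominus> a \<in> MT n"
    and power: "\<And>n. MT n \<inter> A \<subseteq> MS n"
    and max: "maximalideal M S"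
  shows "completion_eq T \<mm> A"
proof -
  have rep: "\<exists>a. (\<forall>n. a n \<in> A) \<and> (\<forall>n. a n \<ominus> \<phi> x \<in> MT n) \<and> x = (\<lambda>n. coset n (a n)) \<and> \<phi> x \<in> carrier T"
    if x: "x \<in> carrier Ahat" for x
  proof -
    obtain a where "\<And>n. a n \<in> A" "\<And>n. a (Suc n) \<ominus> a n \<in> MS n" "x = (\<lambda>n. coset n (a n))"
      using x unfolding carrier_completion by blast
    then show ?thesis using completion_map_eq[of a] by blast
  qed
  have "\<phi> \<in> ring_hom Ahat T"
  proof (rule ring_hom_memI)
    fix x assume x: "x \<in> carrier Ahat"
    then show "\<phi> x \<in> carrier T" using rep by blast
    fix y assume y: "y \<in> carrier Ahat"
    obtain a where a: "\<And>n. a n \<in> A" "\<And>n. a n \<ominus> \<phi> x \<in> MT n" "x = (\<lambda>n. coset n (a n))" "\<phi> x \<in> carrier T"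
      using rep[OF x] by blast
    obtain b where b: "\<And>n. b n \<in> A" "\<And>n. b n \<ominus> \<phi> y \<in> MT n" "y = (\<lambda>n. coset n (b n))" "\<phi> y \<in> carrier T"
      using rep[OF y] by blast
    have "x \<otimes>\<^bsub>Ahat\<^esub> y = (\<lambda>n. coset n (a n \<otimes> b n))"
      using S.quot_simps(5)[OF MS_ideal] a(1) b(1) unfolding a(3) b(3) by (simp add: adic_completion_def)
    then show "\<phi> (x \<otimes>\<^bsub>Ahat\<^esub> y) = \<phi> x \<otimes> \<phi> y"
      using completion_map_unique[of "\<lambda>n. a n \<otimes> b n" "\<phi> x \<otimes> \<phi> y"] a b A
        mult_diff_mem[OF power_ideal _ a(4) _ b(4) a(2) b(2)] by simp
    have "x \<oplus>\<^bsub>Ahat\<^esub> y = (\<lambda>n. coset n (a n \<oplus> b n))"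
      using S.quot_simps(4)[OF MS_ideal] a(1) b(1) unfolding a(3) b(3) by (simp add: adic_completion_def)
    then show "\<phi> (x \<oplus>\<^bsub>Ahat\<^esub> y) = \<phi> x \<oplus> \<phi> y"
      using completion_map_unique[of "\<lambda>n. a n \<oplus> b n" "\<phi> x \<oplus> \<phi> y"] a b A
        add_diff_mem[OF power_ideal _ a(4) _ b(4) a(2) b(2)] by simp
  next
    have "\<one>\<^bsub>Ahat\<^esub> = (\<lambda>n. coset n \<one>)" by (simp add: adic_completion_def S.quot_simps)
    then show "\<phi> \<one>\<^bsub>Ahat\<^esub> = \<one>"
      using completion_map_unique[of "\<lambda>n. \<one>" \<one>] A MT(2) by (simp add: a_minus_def r_neg)
  qed
  moreover have "inj_on \<phi> (carrier Ahat)"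
  proof (rule inj_onI)
    fix x y assume x: "x \<in> carrier Ahat" and y: "y \<in> carrier Ahat" and e: "\<phi> x = \<phi> y"
    obtain a where a: "\<And>n. a n \<in> A" "\<And>n. a n \<ominus> \<phi> x \<in> MT n" "x = (\<lambda>n. coset n (a n))" "\<phi> x \<in> carrier T"
      using rep[OF x] by blast
    obtain b where b: "\<And>n. b n \<in> A" "\<And>n. b n \<ominus> \<phi> x \<in> MT n" "y = (\<lambda>n. coset n (b n))"
      using rep[OF y] e by auto
    have "a n \<ominus> b n \<in> MT n" for n
      using diff_trans[OF power_ideal _ a(4) _ a(2) diff_sym[OF power_ideal _ a(4) b(2)]] A(1) a(1) b(1) by simp
    then have "a n \<ominus> b n \<in> MS n" for n using power[of n] A(6)[OF a(1) b(1), of n n] by auto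
    then have "coset n (a n) = coset n (b n)" for n using coset_eq_subring[OF a(1) b(1)] by simp
    then show "x = y" unfolding a(3) b(3) by simp
  qed
  moreover have "t \<in> \<phi> ` carrier Ahat" if t: "t \<in> carrier T" for t
  proof -
    obtain a where a: "\<And>n. a n \<in> A" "\<And>n. t \<ominus> a n \<in> MT n" using dense[OF t] by metis
    have at: "a n \<ominus> t \<in> MT n" for n using diff_sym[OF power_ideal t _ a(2)] A(1)[OF a(1)] by simp
    have "a (Suc n) \<ominus> a n \<in> MS n" for n
    proof -
      have "a (Suc n) \<ominus> t \<in> MT n" using at[of "Suc n"] ideal_power_decreasing[OF max_ideal, of n "Suc n"] by auto
      then have "a (Suc n) \<ominus> a n \<in> MT n" using diff_trans[OF power_ideal _ t _ _ a(2)] A(1)[OF a(1)] by simp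
      then show ?thesis using power[of n] A(6)[OF a(1) a(1), of "Suc n" n] by auto
    qed
    then have "(\<lambda>n. coset n (a n)) \<in> carrier Ahat" unfolding carrier_completion using a(1) by blast
    moreover have "\<phi> (\<lambda>n. coset n (a n)) = t" using completion_map_unique[OF a(1) t at] .
    ultimately show ?thesis by force
  qed
  moreover have "\<phi> x \<in> carrier T" if "x \<in> carrier Ahat" for x using rep[OF that] by blast
  ultimately have "\<phi> \<in> ring_iso Ahat T"
    by (auto simp: ring_iso_def bij_betw_def)
  then show ?thesis using max by (simp add: completion_eq_def)
qed

end

section \<open>Necessity of the conditions\<close>

context subring_of_complete begin

text \<open>Replaces the flatness of \<open>T/bT\<close> over \<open>A/bA\<close>; the case \<open>b = \<zero>\<close> is that of \<open>T\<close> over the domain \<open>A\<close>.\<close>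

lemma zero_divisor_mod_principal_prime:
  assumes comp: "completion_eq T \<mm> A" and noeth: "noetherian_ring S"
    and b: "b \<in> A" and prime: "primeideal (PS b) S"
    and a: "a \<in> A" "a \<notin> PS b" and t: "t \<in> carrier T" "a \<otimes> t \<in> PIdl b"
  shows "t \<in> PIdl b"
proof (rule closed)
  have ac: "a \<in> carrier T" "b \<in> carrier T" using a b A by auto
  show "ideal (PIdl b) T" using cgenideal_ideal ac by simp
  show "t \<in> carrier T" by fact
  fix n
  interpret S: noetherian_cring S using noeth S.is_cring by (simp add: noetherian_cring_def)
  have Pb: "ideal (PS b) S" using S.cgenideal_ideal b by simp
  \<comment> \<open>\<open>N = bA + aA\<close> and \<open>B0 = bA + a MS n\<close>. As
    \<open>MS n\<close> multiplies \<open>N\<close> into \<open>B0\<close>, the weak Artin-Rees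
    lemma says that an element of \<open>N\<close> in a high power of \<open>M\<close> can be
    written with a coefficient of \<open>a\<close> in \<open>MS n\<close>.\<close>
  define N where "N = {y \<oplus>\<^bsub>S\<^esub> a \<otimes>\<^bsub>S\<^esub> r | y r. y \<in> PS b \<and> r \<in> carrier S}"
  define B0 where "B0 = {y \<oplus>\<^bsub>S\<^esub> a \<otimes>\<^bsub>S\<^esub> r | y r. y \<in> PS b \<and> r \<in> MS n}"
  have N: "ideal N S" unfolding N_def by (rule S.ideal_add_scaled) (use Pb S.oneideal a in auto)
  have B0: "ideal B0 S" unfolding B0_def by (rule S.ideal_add_scaled) (use Pb MS_ideal a in auto)
  have le: "B0 \<subseteq> N" using MS(1) by (auto simp: B0_def N_def)
  have "\<exists>k. MS k \<inter> N \<subseteq> B0"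
  proof (rule S.power_inter_subset[OF M_ideal N B0 le])
    fix m z assume m: "m \<in> MS n" and "z \<in> N"
    then obtain y r where z: "z = y \<oplus> a \<otimes> r" "y \<in> PS b" "r \<in> A" by (auto simp: N_def)
    have c: "m \<in> carrier T" "y \<in> carrier T" "r \<in> carrier T"
      using A(1) MS(1)[OF m] subring_idealD(1)[OF subring Pb z(2)] z(3) by auto
    have "m \<otimes> z = m \<otimes> y \<oplus> a \<otimes> (r \<otimes> m)" unfolding z using c ac by algebra
    moreover have "r \<otimes> m \<in> MS n" using MS(5) m z by auto
    moreover have "m \<otimes> y \<in> PS b" using subring_idealD(5)[OF subring Pb] z MS(1)[OF m] by auto
    ultimately show "m \<otimes>\<^bsub>S\<^esub> z \<in> B0" by (auto simp: B0_def)
  qed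
  then obtain k where k: "MS k \<inter> N \<subseteq> B0" ..
  \<comment> \<open>\<open>k\<close> is the order demanded by Artin-Rees and \<open>n\<close> the
    wanted precision. Approximating the relation \<open>a t = b w\<close> in \<open>A\<close> up to
    order \<open>K\<close> leaves an error \<open>d\<close> in \<open>N\<close>. Rewriting
    \<open>d\<close> with a small coefficient \<open>\<mu>\<close> of \<open>a\<close> shows that
    \<open>a (t' - \<mu>)\<close> is in \<open>bA\<close>, where \<open>a\<close> cancels by
    primality.\<close>
  define K where "K = max k n"
  obtain t' where t': "t' \<in> A" "t \<ominus> t' \<in> MT K" using completion_eq_dense[OF comp t(1)] by blast
  obtain w where w: "w \<in> carrier T" "a \<otimes> t = b \<otimes> w" using t(2) mem_PIdl[OF ac(2)] by auto
  obtain w' where w': "w' \<in> A" "w \<ominus> w' \<in> MT K" using completion_eq_dense[OF comp w(1)] by blast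
  have c: "t' \<in> carrier T" "w' \<in> carrier T" using t' w' A by auto
  define d where "d = a \<otimes> t' \<ominus> b \<otimes> w'"
  have dA: "d \<in> A" unfolding d_def using A a b t' w' by auto
  have "d = a \<otimes> t \<ominus> a \<otimes> (t \<ominus> t') \<ominus> b \<otimes> w'" unfolding d_def using c ac t by algebra
  also have "\<dots> = b \<otimes> (w \<ominus> w') \<ominus> a \<otimes> (t \<ominus> t')" unfolding w(2) using c ac t w by algebra
  finally have "d \<in> MT K" using MT(4)[of _ K] MT(6)[of _ K] t' w' ac by simp
  then have "d \<in> MT k" using ideal_power_decreasing[OF max_ideal, of k K] by (auto simp: K_def)
  then have "d \<in> MS k" using completion_eq_power[OF comp] dA by auto
  moreover have "d \<in> N"
  proof -
    have "d = b \<otimes> (\<ominus> w') \<oplus> a \<otimes> t'" unfolding d_def using ac c by algebra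
    moreover have "b \<otimes> (\<ominus> w') \<in> PS b" using mem_PIdl_subring[OF subring b] A(4)[OF w'(1)] by blast
    ultimately show ?thesis using t' unfolding N_def by auto
  qed
  ultimately have "d \<in> B0" using k by auto
  then obtain y \<mu> where y: "d = y \<oplus> a \<otimes> \<mu>" "y \<in> PS b" "\<mu> \<in> MS n" by (auto simp: B0_def)
  then obtain s where s: "s \<in> A" "y = b \<otimes> s" using mem_PIdl_subring[OF subring b] by auto
  have c2: "\<mu> \<in> A" "\<mu> \<in> carrier T" "s \<in> carrier T" using MS(1) y s A by auto
  have "a \<otimes> (t' \<ominus> \<mu>) = d \<oplus> b \<otimes> w' \<ominus> a \<otimes> \<mu>" unfolding d_def using ac c c2 by algebra
  also have "\<dots> = b \<otimes> (s \<oplus> w')" unfolding y(1) s(2) using ac c c2 by algebra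
  finally have "a \<otimes> (t' \<ominus> \<mu>) \<in> PS b" using mem_PIdl_subring[OF subring b] A(5) s w' by blast
  then have "t' \<ominus> \<mu> \<in> PS b"
    using S.primeD(3)[OF prime, of a "t' \<ominus> \<mu>"] a t' c2 A(6) by simp
  then obtain v where v: "v \<in> A" "t' \<ominus> \<mu> = b \<otimes> v" using mem_PIdl_subring[OF subring b] by auto
  have vc: "v \<in> carrier T" using v A by auto
  have "t \<ominus> b \<otimes> v = (t \<ominus> t') \<oplus> \<mu>" unfolding v(2)[symmetric] using t c c2 by algebra
  moreover have "t \<ominus> t' \<in> MT n" using t'(2) ideal_power_decreasing[OF max_ideal, of n K] by (auto simp: K_def)
  moreover have "\<mu> \<in> MT n" using y MS_le by auto
  ultimately have "t \<ominus> b \<otimes> v \<in> MT n" using MT(3) by simp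
  then show "\<exists>y\<in>PIdl b. t \<ominus> y \<in> MT n" using mem_PIdl[OF ac(2)] vc by blast
qed

end

lemma (in cring) mem_associated_primes_quotient:
  assumes I: "ideal I R"
  shows "P \<in> associated_primes R (quotient_module R I) \<longleftrightarrow>
     primeideal P R \<and> (\<exists>w\<in>carrier R. P = {r \<in> carrier R. r \<otimes> w \<in> I})"
proof -
  have "(I +> r) \<otimes>\<^bsub>R Quot I\<^esub> (I +> w) = I \<longleftrightarrow> r \<otimes> w \<in> I" if "r \<in> carrier R" "w \<in> carrier R" for r w
  proof -
    have "I +> \<zero> = I" using a_coset_add_zero[of I] idealD(1)[OF I] by (simp add: subsetI)
    then show ?thesis
      using quot_simps(5)[OF I that] quotient_eq_iff_same_a_r_cos[OF I, of "r \<otimes> w" \<zero>] that by (simp add: minus_eq)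
  qed
  then show ?thesis
    unfolding associated_primes_def quotient_module_def by (auto simp: quot_simps cong: conj_cong)
qed

lemma (in cring) mem_associated_primes_regular:
  "P \<in> associated_primes R (regular_module R) \<longleftrightarrow>
     primeideal P R \<and> (\<exists>w\<in>carrier R. P = {r \<in> carrier R. r \<otimes> w = \<zero>})"
  by (auto simp: associated_primes_def regular_module_def)

lemma (in ring) prime_subring_adjoin_subset:
  assumes "subring A R" "p \<in> A" shows "prime_subring_adjoin R p \<subseteq> A"
proof -
  have "prime_subring R \<subseteq> A" unfolding prime_subring_def
    using generate_ring_min_subring1[OF _ assms(1), of "{}"] by simp
  then have "prime_subring R \<union> {p} \<subseteq> A" using assms by simp
  then show ?thesis unfolding prime_subring_adjoin_def
    using generate_ring_min_subring1[OF _ assms(1)] subringE(1)[OF assms(1)] by (meson subset_trans)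
qed

lemma (in ring) prime_subring_adjoin_subring:
  assumes "p \<in> carrier R"
  shows "subring (prime_subring_adjoin R p) R" "p \<in> prime_subring_adjoin R p"
proof -
  have "prime_subring R \<subseteq> carrier R" unfolding prime_subring_def
    using generate_ring_incl[of "{}"] by simp
  then show "subring (prime_subring_adjoin R p) R" unfolding prime_subring_adjoin_def
    using assms by (intro generate_ring_is_subring) auto
  show "p \<in> prime_subring_adjoin R p"
    unfolding prime_subring_adjoin_def by (simp add: generate_ring.incl)
qed

locale prime_family = complete_local_ring +
  fixes C p
  assumes C: "finite C" "C \<noteq> {}" "\<And>Q. Q \<in> C \<Longrightarrow> primeideal Q T" "\<And>Q. Q \<in> C \<Longrightarrow> \<not> maximalideal Q T"
    "\<And>Q Q'. Q \<in> C \<Longrightarrow> Q' \<in> C \<Longrightarrow> Q \<noteq> Q' \<Longrightarrow> \<not> Q \<subseteq> Q'"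
    and p: "p \<in> \<Inter>C" "p \<noteq> \<zero>"
begin

abbreviation "\<Pi>p \<equiv> prime_subring_adjoin T p"
abbreviation "pT \<equiv> PIdl p"

lemma C_ideal: "Q \<in> C \<Longrightarrow> ideal Q T" using C(3) primeD(1) by blast

lemma p_max: "p \<in> \<mm>"
  using C(2,3) p prime_le_max by blast

lemma p_carrier: "p \<in> carrier T" using p_max idealD(1)[OF max_ideal] by simp

lemma mem_pT: "x \<in> pT \<longleftrightarrow> (\<exists>t\<in>carrier T. x = p \<otimes> t)" using mem_PIdl[OF p_carrier] .

lemma pT_ideal: "ideal pT T" using cgenideal_ideal[OF p_carrier] .

lemma power_p_zero:
  assumes "x \<in> carrier T" "\<And>n. \<exists>y\<in>carrier T. x = p [^] (n::nat) \<otimes> y" shows "x = \<zero>"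
proof (rule hausdorff[OF assms(1)])
  fix n :: nat
  obtain y where "y \<in> carrier T" "x = p [^] n \<otimes> y" using assms(2) by blast
  then show "x \<in> MT n"
    using elem_power_mem[OF max_ideal p_max, of n] idealD(7)[OF power_ideal] by simp
qed

theorem conditions_necessary:
  assumes sub: "subring A T" and loc: "local_ring (subring_of T A)" and dom: "domain (subring_of T A)"
    and pA: "p \<in> A" and comp: "completion_eq T \<mm> A"
    and prime: "primeideal (PIdl\<^bsub>subring_of T A\<^esub> p) (subring_of T A)"
    and fiber: "formal_fiber_maximal T A (PIdl\<^bsub>subring_of T A\<^esub> p) = C"
  shows "\<And>P. P \<in> associated_primes T (regular_module T) \<Longrightarrow> P \<inter> \<Pi>p = {\<zero>}"
    "\<And>P. P \<in> associated_primes T (quotient_module T pT) \<Longrightarrow> \<exists>Q\<in>C. P \<subseteq> Q"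
    "\<And>Q. Q \<in> C \<Longrightarrow> ((Q - pT) <#>\<^bsub>T\<^esub> \<Pi>p) \<inter> \<Pi>p \<subseteq> {\<zero>}"
proof -
  interpret subring_of_complete T \<mm> A
    by (intro subring_of_complete.intro subring_of_complete_axioms.intro complete_local_ring_axioms sub)
  note a = subringD[OF sub]
  have noeth: "noetherian_ring S" using loc by (simp add: local_ring_def)
  have \<Pi>A: "\<Pi>p \<subseteq> A" using prime_subring_adjoin_subset[OF sub pA] .
  \<comment> \<open>With \<open>b = \<zero>\<close> the principal ideal is prime because
    \<open>A\<close> is a domain, and the preceding lemma makes nonzero elements of \<open>A\<close>
    regular on \<open>T\<close>.\<close>
  have zero: "PS \<zero> = {\<zero>}" "PIdl \<zero> = {\<zero>}"
    using mem_PIdl_subring[OF sub a(2)] mem_PIdl[OF A(1)[OF A(2)]] a by auto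
  have reg: "t = \<zero>" if t: "x \<in> A" "x \<noteq> \<zero>" "t \<in> carrier T" "x \<otimes> t = \<zero>" for x t
    using zero_divisor_mod_principal_prime[OF comp noeth a(2), of x t] domain.zeroprimeideal[OF dom] t
    by (simp add: zero)
  show "P \<inter> \<Pi>p = {\<zero>}" if P: "P \<in> associated_primes T (regular_module T)" for P
  proof -
    obtain w where w: "primeideal P T" "w \<in> carrier T" "P = {r \<in> carrier T. r \<otimes> w = \<zero>}"
      using P by (auto simp: mem_associated_primes_regular)
    have "w \<noteq> \<zero>" using primeD(2)[OF w(1)] w by auto
    then have "P \<inter> \<Pi>p \<subseteq> {\<zero>}" using reg w \<Pi>A by blast
    moreover have "\<zero> \<in> P" "\<zero> \<in> \<Pi>p"
      using w idealD(2)[OF primeD(1)] subringD(2)[OF prime_subring_adjoin_subring(1)[OF p_carrier]] by auto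
    ultimately show ?thesis by auto
  qed
  have pApT: "x \<in> pT" if "x \<in> PS p" for x
    using that mem_PIdl_subring[OF sub pA] mem_pT a(1) by auto
  have regp: "t \<in> pT" if t: "x \<in> A" "x \<notin> PS p" "t \<in> carrier T" "x \<otimes> t \<in> pT" for x t
    using zero_divisor_mod_principal_prime[OF comp noeth pA prime] t by blast
  show "\<exists>Q\<in>C. P \<subseteq> Q" if P: "P \<in> associated_primes T (quotient_module T pT)" for P
  proof -
    obtain w where w: "primeideal P T" "w \<in> carrier T" "P = {r \<in> carrier T. r \<otimes> w \<in> pT}"
      using P by (auto simp: mem_associated_primes_quotient[OF pT_ideal])
    have wp: "w \<notin> pT" using primeD(2)[OF w(1)] w by auto
    have "P \<inter> A \<subseteq> PS p" using regp wp w by blast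
    moreover have "PS p \<subseteq> P \<inter> A"
      using pApT w(2,3) idealD(7)[OF pT_ideal] mem_PIdl_subring[OF sub pA] a pA by auto
    ultimately have PF: "P \<in> formal_fiber T A (PS p)"
      using w(1) by (auto simp: formal_fiber_def)
    \<comment> \<open>\<open>P\<close> is a point of the formal fiber of \<open>pA\<close>. As
      \<open>T\<close> is Noetherian, some maximal point of the fiber contains it, and such a point
      belongs to \<open>C\<close>.\<close>
    define F where "F = {Q \<in> formal_fiber T A (PS p). P \<subseteq> Q}"
    have "P \<in> F" using PF by (simp add: F_def)
    moreover have "\<And>Q. Q \<in> F \<Longrightarrow> ideal Q T" using primeD(1) by (auto simp: F_def formal_fiber_def)
    ultimately obtain Q where Q: "Q \<in> F" "\<And>Q'. Q' \<in> F \<Longrightarrow> Q \<subseteq> Q' \<Longrightarrow> Q' = Q"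
      using ideals_maximalE[of P F] by metis
    then have "Q \<in> formal_fiber_maximal T A (PS p)"
      unfolding formal_fiber_maximal_def F_def by blast
    then show ?thesis using fiber Q(1) by (auto simp: F_def)
  qed
  show "((Q - pT) <#>\<^bsub>T\<^esub> \<Pi>p) \<inter> \<Pi>p \<subseteq> {\<zero>}" if Q: "Q \<in> C" for Q
  proof
    fix x assume "x \<in> ((Q - pT) <#>\<^bsub>T\<^esub> \<Pi>p) \<inter> \<Pi>p"
    then obtain q r where q: "q \<in> Q" "q \<notin> pT" and r: "r \<in> \<Pi>p" and x: "x = q \<otimes> r" "x \<in> \<Pi>p"
      by (auto simp: set_mult_def)
    have qc: "q \<in> carrier T" using idealD(1)[OF C_ideal[OF Q] q(1)] .
    have QA: "Q \<inter> A = PS p" using Q fiber by (auto simp: formal_fiber_maximal_def formal_fiber_def)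
    have *: "s \<in> PS p" if s: "s \<in> A" "q \<otimes> s \<in> A" for s
    proof (rule ccontr)
      assume s': "s \<notin> PS p"
      have "q \<otimes> s \<in> Q" using q(1) s a(1) idealD(7)[OF C_ideal[OF Q]] by auto
      then have "s \<otimes> q \<in> pT" using s QA pApT qc a(1) by (auto simp: m_comm)
      then show False using regp[OF s(1) s' qc] q by simp
    qed
    \<comment> \<open>The induction has to carry \<open>q y\<close> in \<open>A\<close> along. After
      \<open>y = p z\<close>, the product \<open>q z\<close> is at first only in \<open>T\<close>;
      but \<open>q y\<close> lies in \<open>Q \<inter> A = pA\<close>, so \<open>q y = p v\<close>
      with \<open>v\<close> in \<open>A\<close>, and regularity of \<open>p\<close> gives
      \<open>q z = v\<close>.\<close>
    have "\<exists>y\<in>A. r = p [^] n \<otimes> y \<and> q \<otimes> y \<in> A" for n :: nat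
    proof (induct n)
      case 0
      show ?case using r x \<Pi>A a(1) by auto
    next
      case (Suc n)
      then obtain y where y: "y \<in> A" "r = p [^] n \<otimes> y" "q \<otimes> y \<in> A" by blast
      obtain z where z: "z \<in> A" "y = p \<otimes> z" using *[OF y(1,3)] mem_PIdl_subring[OF sub pA] by auto
      have "q \<otimes> y \<in> Q \<inter> A" using y q(1) a(1) idealD(7)[OF C_ideal[OF Q]] by auto
      then obtain v where v: "v \<in> A" "q \<otimes> y = p \<otimes> v" unfolding QA using mem_PIdl_subring[OF sub pA] by auto
      have c: "z \<in> carrier T" "v \<in> carrier T" using z v a(1) by auto
      have "p \<otimes> (q \<otimes> z \<ominus> v) = q \<otimes> y \<ominus> p \<otimes> v" unfolding z using c qc p_carrier by algebra
      also have "\<dots> = \<zero>" unfolding v using c p_carrier by (simp add: a_minus_def r_neg)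
      finally have "q \<otimes> z \<ominus> v = \<zero>" using reg[OF pA p(2)] qc c by simp
      then have "q \<otimes> z = v" using qc c by simp
      then have "q \<otimes> z \<in> A" using v by simp
      moreover have "r = p [^] Suc n \<otimes> z" unfolding y z using p_carrier c by (simp add: m_assoc)
      ultimately show ?case using z by blast
    qed
    then have "r = \<zero>" using power_p_zero[of r] a(1) r \<Pi>A by blast
    then show "x \<in> {\<zero>}" using x qc by simp
  qed
qed

end

section \<open>Power series in an element of the maximal ideal and the cardinality of
  \<open>T\<close>\<close>

lemma (in cring) affine_diff:
  "e \<in> carrier R \<Longrightarrow> z \<in> carrier R \<Longrightarrow> a \<in> carrier R \<Longrightarrow> b \<in> carrier R \<Longrightarrow>
    (e \<oplus> z \<otimes> a) \<ominus> (e \<oplus> z \<otimes> b) = z \<otimes> (a \<ominus> b)"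
  by algebra

context complete_local_ring begin

text \<open>A truncated power series in \<open>z\<close>. Peeling off the constant term gives a
  recursion that survives in the limit as a shift equation.\<close>

primrec power_sum :: "'a \<Rightarrow> nat \<Rightarrow> (nat \<Rightarrow> 'a) \<Rightarrow> 'a" where
  "power_sum z 0 v = \<zero>"
| "power_sum z (Suc n) v = v 0 \<oplus> z \<otimes> power_sum z n (\<lambda>i. v (Suc i))"

lemma power_sum_closed: "z \<in> carrier T \<Longrightarrow> (\<And>i. v i \<in> carrier T) \<Longrightarrow> power_sum z n v \<in> carrier T"
  by (induct n arbitrary: v) (auto simp: zeroideal idealD(2)[OF oneideal])

text \<open>Consecutive truncations differ by a multiple of a power of \<open>z\<close>, so they
  converge. Of the limit only the shift equation is recorded; it suffices to compare two series
  coefficient by coefficient.\<close>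

lemma power_series:
  assumes z: "z \<in> \<mm>"
  shows "\<exists>s. \<forall>v::nat \<Rightarrow> 'a. (\<forall>i. v i \<in> carrier T) \<longrightarrow> s v \<in> carrier T \<and> s v = v 0 \<oplus> z \<otimes> s (\<lambda>i. v (Suc i))"
proof -
  have zc: "z \<in> carrier T" using z idealD(1)[OF max_ideal] by auto
  have lim: "\<exists>l\<in>carrier T. \<forall>n. power_sum z n v \<ominus> l \<in> MT n" if v: "\<And>i. v i \<in> carrier T" for v
  proof (rule limit_exists)
    show "power_sum z n v \<in> carrier T" for n using power_sum_closed[OF zc v] .
    show "power_sum z (Suc n) v \<ominus> power_sum z n v \<in> MT n" for n
      using v
    proof (induct n arbitrary: v)
      case 0
      show ?case using power_sum_closed[OF zc 0] zc 0 by (simp add: ideal_power_0)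
    next
      case (Suc n)
      let ?e = "\<lambda>i. v (Suc i)"
      let ?a = "power_sum z (Suc n) ?e" and ?b = "power_sum z n ?e"
      have c: "?a \<in> carrier T" "?b \<in> carrier T" "v 0 \<in> carrier T"
        using power_sum_closed[OF zc, of ?e] Suc(2) by blast+
      have "(v 0 \<oplus> z \<otimes> ?a) \<ominus> (v 0 \<oplus> z \<otimes> ?b) = (?a \<ominus> ?b) \<otimes> z"
        using affine_diff[OF c(3) zc c(1,2)] c zc by (simp only: m_comm minus_closed)
      moreover have "(?a \<ominus> ?b) \<otimes> z \<in> MT (Suc n)"
        by (rule ideal_power_mult[OF Suc(1) z]) (rule Suc(2))
      ultimately show ?case by (simp del: nat_pow_Suc)
    qed
  qed
  define s where "s v = (SOME l. l \<in> carrier T \<and> (\<forall>n. power_sum z n v \<ominus> l \<in> MT n))" for v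
  have s: "s v \<in> carrier T \<and> (\<forall>n. power_sum z n v \<ominus> s v \<in> MT n)"
    if "\<And>i. v i \<in> carrier T" for v
  proof -
    have "\<exists>l. l \<in> carrier T \<and> (\<forall>n. power_sum z n v \<ominus> l \<in> MT n)" using lim[OF that] unfolding Bex_def .
    then show ?thesis unfolding s_def by (rule someI_ex)
  qed
  have "s v = v 0 \<oplus> z \<otimes> s (\<lambda>i. v (Suc i))" if v: "\<And>i. v i \<in> carrier T" for v
  proof (rule hausdorff_eq)
    let ?e = "\<lambda>i. v (Suc i)"
    have e: "\<And>i. ?e i \<in> carrier T" using v .
    show 1: "s v \<in> carrier T" using s[OF v] by simp
    show 2: "v 0 \<oplus> z \<otimes> s ?e \<in> carrier T" using s[OF e] v zc by simp
    fix k
    have c: "power_sum z k ?e \<in> carrier T" "power_sum z (Suc k) v \<in> carrier T" "v 0 \<in> carrier T" "s ?e \<in> carrier T"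
      using power_sum_closed[OF zc e] power_sum_closed[OF zc v] v[of 0] s[OF e] by (simp_all del: power_sum.simps)
    have "power_sum z (Suc k) v \<ominus> s v \<in> MT k"
      using s[OF v] ideal_power_decreasing[OF max_ideal, of k "Suc k"] by (meson le_SucI order_refl subsetD)
    then have "s v \<ominus> power_sum z (Suc k) v \<in> MT k"
      using diff_sym[OF power_ideal] c 1 by blast
    moreover have "power_sum z (Suc k) v \<ominus> (v 0 \<oplus> z \<otimes> s ?e) = z \<otimes> (power_sum z k ?e \<ominus> s ?e)"
      unfolding power_sum.simps using affine_diff[OF c(3) zc c(1,4)] .
    then have "power_sum z (Suc k) v \<ominus> (v 0 \<oplus> z \<otimes> s ?e) \<in> MT k"
      using s[OF e] idealD(6)[OF power_ideal] zc by simp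
    ultimately show "s v \<ominus> (v 0 \<oplus> z \<otimes> s ?e) \<in> MT k"
      using diff_trans[OF power_ideal 1 c(2) 2] by blast
  qed
  then show ?thesis using s by blast
qed

text \<open>Congruent elements have the same candidates for a representative, so the choice operator
  returns the same one for both.\<close>

lemma residue_representatives:
  "\<exists>rep :: 'a \<Rightarrow> 'a. (\<forall>t\<in>carrier T. rep t \<in> carrier T \<and> t \<ominus> rep t \<in> \<mm>) \<and>
    (\<forall>t\<in>carrier T. \<forall>u\<in>carrier T. t \<ominus> u \<in> \<mm> \<longleftrightarrow> rep t = rep u)"
proof -
  define rep where "rep t = (SOME r. r \<in> carrier T \<and> t \<ominus> r \<in> \<mm>)" for t
  have 1: "rep t \<in> carrier T \<and> t \<ominus> rep t \<in> \<mm>" if "t \<in> carrier T" for t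
    unfolding rep_def
    by (rule someI_ex, rule exI[of _ t]) (use that idealD(2)[OF max_ideal] in \<open>simp add: a_minus_def r_neg\<close>)
  have 2: "rep t = rep u" if tu: "t \<in> carrier T" "u \<in> carrier T" "t \<ominus> u \<in> \<mm>" for t u
  proof -
    have "r \<in> carrier T \<and> t \<ominus> r \<in> \<mm> \<longleftrightarrow> r \<in> carrier T \<and> u \<ominus> r \<in> \<mm>" for r
      using diff_trans[OF max_ideal, of t u r] diff_trans[OF max_ideal, of u t r] diff_sym[OF max_ideal, of t u] tu by blast
    then show ?thesis unfolding rep_def by simp
  qed
  have 3: "t \<ominus> u \<in> \<mm>" if tu: "t \<in> carrier T" "u \<in> carrier T" "rep t = rep u" for t u
    using diff_trans[OF max_ideal tu(1) _ tu(2), of "rep t"] diff_sym[OF max_ideal tu(2), of "rep u"] 1 tu by metis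
  show ?thesis by (rule exI[of _ rep]) (use 1 2 3 in blast)
qed

text \<open>Digit expansions along generators of the powers of \<open>\<mm>\<close> bound the cardinality of \<open>T\<close> by
  that of the sequences in the residue field.\<close>

lemma injection_into_sequences:
  assumes K: "\<And>t. t \<in> carrier T \<Longrightarrow> rep t \<in> K"
    and rep: "\<And>t u. t \<in> carrier T \<Longrightarrow> u \<in> carrier T \<Longrightarrow> rep t = rep u \<Longrightarrow> t \<ominus> u \<in> \<mm>"
  shows "\<exists>E :: 'a \<Rightarrow> nat \<Rightarrow> 'k. (\<forall>t j. E t j \<in> K) \<and> inj_on E (carrier T)"
proof -
  have one: "\<one> \<in> carrier T" and zero: "\<zero> \<in> carrier T" using idealD(2)[OF oneideal] by auto
  have K0: "rep \<one> \<in> K" using K one .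
  have zz: "\<zero> \<ominus> \<zero> = \<zero>" using zero r_neg[of \<zero>] by (simp only: a_minus_def)
  \<comment> \<open>If \<open>x\<close> is a combination of generators from \<open>MT n\<close>, the
    residues of its coefficients determine \<open>x\<close> modulo \<open>MT (Suc n)\<close>; these
    are its digits. The tail of the sequence is filled with \<open>rep \<one>\<close>.\<close>
  have digit: "\<exists>d::'a \<Rightarrow> nat \<Rightarrow> 'k. (\<forall>x j. d x j \<in> K) \<and> (\<forall>x\<in>lin_span (carrier T) G. \<forall>y\<in>lin_span (carrier T) G.
      d x = d y \<longrightarrow> x \<ominus> y \<in> MT (Suc n))" if "set G \<subseteq> MT n" for G n
    using that
  proof (induct G)
    case Nil
    have "\<zero> \<ominus> \<zero> \<in> MT (Suc n)" unfolding zz using idealD(2)[OF power_ideal] .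
    then show ?case by (intro exI[of _ "\<lambda>_ _. rep \<one>"]) (use K0 in \<open>auto simp del: nat_pow_Suc\<close>)
  next
    case (Cons f G)
    then obtain d :: "'a \<Rightarrow> nat \<Rightarrow> 'k" where d: "\<And>x j. d x j \<in> K"
      "\<And>x y. x \<in> lin_span (carrier T) G \<Longrightarrow> y \<in> lin_span (carrier T) G \<Longrightarrow> d x = d y \<Longrightarrow> x \<ominus> y \<in> MT (Suc n)"
      by (metis list.set_intros(2) subset_code(1))
    have f: "f \<in> MT n" "f \<in> carrier T" "set G \<subseteq> carrier T" using Cons(2) idealD(1)[OF power_ideal] by auto
    have "\<forall>x. \<exists>a s. a \<in> carrier T \<and> (x \<in> lin_span (carrier T) (f # G) \<longrightarrow> s \<in> lin_span (carrier T) G \<and> x = a \<otimes> f \<oplus> s)"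
      using one by auto
    then obtain a s where as: "\<And>x. a x \<in> carrier T"
      "\<And>x. x \<in> lin_span (carrier T) (f # G) \<Longrightarrow> s x \<in> lin_span (carrier T) G \<and> x = a x \<otimes> f \<oplus> s x"
      by metis
    define d' where "d' x j = (case j of 0 \<Rightarrow> rep (a x) | Suc i \<Rightarrow> d (s x) i)" for x j
    have "x \<ominus> y \<in> MT (Suc n)" if x: "x \<in> lin_span (carrier T) (f # G)"
      and y: "y \<in> lin_span (carrier T) (f # G)" and e: "d' x = d' y" for x y
    proof -
      have "rep (a x) = rep (a y)" using fun_cong[OF e, of 0] by (simp add: d'_def)
      then have 1: "a x \<ominus> a y \<in> \<mm>" using rep[OF as(1) as(1)] by simp
      have "d (s x) = d (s y)" using fun_cong[OF e, of "Suc _"] by (auto simp: d'_def)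
      then have 2: "s x \<ominus> s y \<in> MT (Suc n)" using d(2) as(2) x y by blast
      have c: "s x \<in> carrier T" "s y \<in> carrier T" "a x \<in> carrier T" "a y \<in> carrier T"
        using as x y idealD(1)[OF lin_span_carrier(1)[OF f(3)]] by blast+
      have "x \<ominus> y = (a x \<otimes> f \<oplus> s x) \<ominus> (a y \<otimes> f \<oplus> s y)" using as(2) x y by metis
      also have "\<dots> = f \<otimes> (a x \<ominus> a y) \<oplus> (s x \<ominus> s y)" using c f(2) by algebra
      finally show ?thesis using 2 ideal_power_mult[OF f(1) 1] idealD(3)[OF power_ideal, of _ "Suc n"] by metis
    qed
    moreover have "d' x j \<in> K" for x j using d(1) K as(1) by (auto simp: d'_def split: nat.split)
    ultimately show ?case by blast
  qed
  have "\<exists>D::'a \<Rightarrow> nat \<Rightarrow> 'k. (\<forall>t j. D t j \<in> K) \<and>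
    (\<forall>t\<in>carrier T. \<forall>u\<in>carrier T. D t = D u \<longrightarrow> t \<ominus> u \<in> MT n)" for n
  proof (induct n)
    case 0
    show ?case by (rule exI[of _ "\<lambda>_ _. rep \<one>"]) (use K0 in \<open>auto simp: ideal_power_0\<close>)
  next
    case (Suc n)
    then obtain D :: "'a \<Rightarrow> nat \<Rightarrow> 'k" where D: "\<And>t j. D t j \<in> K"
      "\<And>t u. t \<in> carrier T \<Longrightarrow> u \<in> carrier T \<Longrightarrow> D t = D u \<Longrightarrow> t \<ominus> u \<in> MT n" by blast
    obtain G where G: "set G \<subseteq> MT n" "MT n = lin_span (carrier T) G"
      using ideal_generated_list[OF power_ideal] .
    obtain d :: "'a \<Rightarrow> nat \<Rightarrow> 'k" where d: "\<And>x j. d x j \<in> K" "\<And>x y. x \<in> MT n \<Longrightarrow> y \<in> MT n \<Longrightarrow>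
      d x = d y \<Longrightarrow> x \<ominus> y \<in> MT (Suc n)"
      using digit[OF G(1)] unfolding G(2)[symmetric] by metis
    \<comment> \<open>\<open>\<tau>\<close> depends on the digits alone: if
      \<open>D t = D u\<close>, the same element is subtracted from \<open>t\<close> and
      \<open>u\<close>, and the digits of the two remainders in \<open>MT n\<close> then compare
      \<open>t\<close> with \<open>u\<close>. Old digits go to the even places of \<open>D'\<close>,
      new ones to the odd places.\<close>
    define \<tau> where "\<tau> v = (SOME t. t \<in> carrier T \<and> D t = v)" for v
    have \<tau>: "\<tau> (D t) \<in> carrier T \<and> t \<ominus> \<tau> (D t) \<in> MT n" if t: "t \<in> carrier T" for t
    proof -
      have "\<tau> (D t) \<in> carrier T \<and> D (\<tau> (D t)) = D t" unfolding \<tau>_def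
        by (rule someI_ex) (use t in blast)
      then show ?thesis using D(2)[OF t] by simp
    qed
    define D' where "D' t j = (if even j then D t (j div 2) else d (t \<ominus> \<tau> (D t)) (j div 2))" for t j
    have "t \<ominus> u \<in> MT (Suc n)" if t: "t \<in> carrier T" "u \<in> carrier T" and e: "D' t = D' u" for t u
    proof -
      have "D t j = D u j" for j using fun_cong[OF e, of "2 * j"] by (simp add: D'_def)
      then have 1: "D t = D u" by blast
      have "d (t \<ominus> \<tau> (D t)) j = d (u \<ominus> \<tau> (D u)) j" for j using fun_cong[OF e, of "2 * j + 1"] by (simp add: D'_def)
      then have "d (t \<ominus> \<tau> (D t)) = d (u \<ominus> \<tau> (D u))" by blast
      then have "(t \<ominus> \<tau> (D t)) \<ominus> (u \<ominus> \<tau> (D u)) \<in> MT (Suc n)"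
        using d(2) \<tau> t by blast
      moreover have "(t \<ominus> \<tau> (D u)) \<ominus> (u \<ominus> \<tau> (D u)) = t \<ominus> u"
        using t \<tau>[OF t(2)] by (algebra)
      ultimately show ?thesis using 1 by (simp del: nat_pow_Suc)
    qed
    moreover have "D' t j \<in> K" for t j using D(1) d(1) by (simp add: D'_def)
    ultimately show ?case by blast
  qed
  then obtain D :: "nat \<Rightarrow> 'a \<Rightarrow> nat \<Rightarrow> 'k" where D: "\<And>n t j. D n t j \<in> K"
      "\<And>n t u. t \<in> carrier T \<Longrightarrow> u \<in> carrier T \<Longrightarrow> D n t = D n u \<Longrightarrow> t \<ominus> u \<in> MT n" by metis
  define E where "E t m = D (fst (prod_decode m)) t (snd (prod_decode m))" for t m
  have "inj_on E (carrier T)"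
  proof (rule inj_onI)
    fix t u assume t: "t \<in> carrier T" "u \<in> carrier T" "E t = E u"
    have "D n t j = D n u j" for n j using fun_cong[OF t(3), of "prod_encode (n, j)"] by (simp add: E_def)
    then have "D n t = D n u" for n by blast
    then show "t = u" using hausdorff_eq[OF t(1,2)] D(2) t by blast
  qed
  moreover have "\<forall>t j. E t j \<in> K" using D(1) by (simp add: E_def)
  ultimately show ?thesis by blast
qed

end

context prime_family begin

lemma max_not_subset: "Q \<in> C \<Longrightarrow> \<not> \<mm> \<subseteq> Q"
  using C(3,4) prime_le_max is_maximalideal by (metis subset_antisym)

lemma max_avoids: "\<exists>z\<in>\<mm>. \<forall>Q\<in>C. z \<notin> Q"
  by (rule prime_avoidance) (use C max_not_subset max_ideal in auto)

lemma incongruent_series: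
  "\<exists>(rep :: 'a \<Rightarrow> 'a) s. (\<forall>t\<in>carrier T. rep t \<in> carrier T) \<and>
    (\<forall>t\<in>carrier T. \<forall>u\<in>carrier T. t \<ominus> u \<in> \<mm> \<longleftrightarrow> rep t = rep u) \<and>
    (\<forall>v::nat \<Rightarrow> 'a. (\<forall>i. v i \<in> rep ` carrier T) \<longrightarrow> s v \<in> carrier T) \<and>
    (\<forall>v (w::nat \<Rightarrow> 'a). (\<forall>i. v i \<in> rep ` carrier T) \<longrightarrow> (\<forall>i. w i \<in> rep ` carrier T) \<longrightarrow>
      v \<noteq> w \<longrightarrow> (\<forall>Q\<in>C. s v \<ominus> s w \<notin> Q))"
proof -
  obtain z where z: "z \<in> \<mm>" "\<And>Q. Q \<in> C \<Longrightarrow> z \<notin> Q" using max_avoids by blast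
  have zc: "z \<in> carrier T" using z(1) idealD(1)[OF max_ideal] by auto
  obtain s where s: "\<forall>v::nat \<Rightarrow> 'a. (\<forall>i. v i \<in> carrier T) \<longrightarrow> s v \<in> carrier T \<and> s v = v 0 \<oplus> z \<otimes> s (\<lambda>i. v (Suc i))"
    using power_series[OF z(1)] ..
  obtain rep :: "'a \<Rightarrow> 'a" where rep': "\<forall>t\<in>carrier T. rep t \<in> carrier T \<and> t \<ominus> rep t \<in> \<mm>"
    "\<forall>t\<in>carrier T. \<forall>u\<in>carrier T. t \<ominus> u \<in> \<mm> \<longleftrightarrow> rep t = rep u"
    using residue_representatives by (elim exE conjE) (rule that)
  then have rep: "\<And>t. t \<in> carrier T \<Longrightarrow> rep t \<in> carrier T \<and> t \<ominus> rep t \<in> \<mm>"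
    "\<And>t u. t \<in> carrier T \<Longrightarrow> u \<in> carrier T \<Longrightarrow> t \<ominus> u \<in> \<mm> \<longleftrightarrow> rep t = rep u" by blast+
  have idem: "rep (rep t) = rep t" if "t \<in> carrier T" for t using rep that by metis
  let ?K = "rep ` carrier T"
  have Kc: "x \<in> carrier T" if "x \<in> ?K" for x using that rep by auto
  have Kd: "x = y" if xy: "x \<in> ?K" "y \<in> ?K" "x \<ominus> y \<in> \<mm>" for x y
    using rep(2)[OF Kc[OF xy(1)] Kc[OF xy(2)]] xy idem by auto
  have main: "s v \<ominus> s w \<notin> Q" if "\<And>i. v i \<in> ?K" "\<And>i. w i \<in> ?K" "Q \<in> C" "\<And>i. i < n \<Longrightarrow> v i = w i" "v n \<noteq> w n"
    for v w Q n
    using that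
  proof (induct n arbitrary: v w)
    case (0 v w)
    let ?e = "\<lambda>i. v (Suc i)" and ?h = "\<lambda>i. w (Suc i)"
    have c: "v i \<in> carrier T" "w i \<in> carrier T" for i using 0 Kc by auto
    have "\<forall>i. ?e i \<in> carrier T" "\<forall>i. ?h i \<in> carrier T" using c by auto
    then have sc: "s ?e \<in> carrier T" "s ?h \<in> carrier T" using s by meson+
    show ?case
    proof
      assume "s v \<ominus> s w \<in> Q"
      then have 1: "s v \<ominus> s w \<in> \<mm>" using prime_le_max C(3) 0(3) by blast
      have "a \<ominus> b = ((a \<oplus> z \<otimes> x) \<ominus> (b \<oplus> z \<otimes> y)) \<ominus> z \<otimes> (x \<ominus> y)"
        if "a \<in> carrier T" "b \<in> carrier T" "x \<in> carrier T" "y \<in> carrier T" for a b x y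
        using that zc by algebra
      from this[OF c(1)[of 0] c(2)[of 0] sc]
      have "v 0 \<ominus> w 0 = ((v 0 \<oplus> z \<otimes> s ?e) \<ominus> (w 0 \<oplus> z \<otimes> s ?h)) \<ominus> z \<otimes> (s ?e \<ominus> s ?h)" .
      also have "\<dots> = (s v \<ominus> s w) \<ominus> z \<otimes> (s ?e \<ominus> s ?h)" using s c by metis
      finally have "v 0 \<ominus> w 0 \<in> \<mm>" using 1 z(1) sc idealD(4,7)[OF max_ideal] by simp
      then have "v 0 = w 0" using Kd 0(1,2) by blast
      then show False using 0(5) by simp
    qed
  next
    case (Suc n v w)
    let ?e = "\<lambda>i. v (Suc i)" and ?h = "\<lambda>i. w (Suc i)"
    have c: "v i \<in> carrier T" "w i \<in> carrier T" for i using Suc Kc by auto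
    have "\<forall>i. ?e i \<in> carrier T" "\<forall>i. ?h i \<in> carrier T" using c by auto
    then have sc: "s ?e \<in> carrier T" "s ?h \<in> carrier T" using s by meson+
    have "s ?e \<ominus> s ?h \<notin> Q" by (rule Suc(1)) (use Suc in auto)
    moreover have "s v \<ominus> s w = (v 0 \<oplus> z \<otimes> s ?e) \<ominus> (w 0 \<oplus> z \<otimes> s ?h)" using s c by metis
    moreover have "v 0 = w 0" using Suc by simp
    moreover have "(w 0 \<oplus> z \<otimes> s ?e) \<ominus> (w 0 \<oplus> z \<otimes> s ?h) = z \<otimes> (s ?e \<ominus> s ?h)"
      using affine_diff[OF c(2)[of 0] zc sc] .
    ultimately show ?case using primeD(3)[OF C(3)[OF Suc(4)] zc, of "s ?e \<ominus> s ?h"] z(2)[OF Suc(4)] sc by simp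
  qed
  have 1: "s v \<ominus> s w \<notin> Q" if v: "\<forall>i. v i \<in> ?K" "\<forall>i. w i \<in> ?K" "Q \<in> C" "v \<noteq> w" for v w Q
  proof -
    have "\<exists>n. v n \<noteq> w n" using v by auto
    then obtain n where "v n \<noteq> w n" "\<And>i. i < n \<Longrightarrow> v i = w i"
      using exists_least_iff[of "\<lambda>n. v n \<noteq> w n"] by auto
    then show ?thesis using main[of v w Q n] v by simp
  qed
  have 2: "s v \<in> carrier T" if "\<forall>i. v i \<in> ?K" for v using s Kc that by blast
  show ?thesis
    by (rule exI[of _ rep], rule exI[of _ s]) (use 1 2 rep in simp)
qed

text \<open>Composing the series with the injection of \<open>T\<close> into residue sequences gives
  as many incongruent elements as \<open>T\<close> has elements. For uncountability, the
  representatives of \<open>\<zero>\<close> and \<open>\<one>\<close> as coefficients already give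
  one series for each set of natural numbers.\<close>

lemma
  shows incongruent_family: "\<exists>g. (\<forall>t\<in>carrier T. g t \<in> carrier T) \<and>
      (\<forall>t\<in>carrier T. \<forall>u\<in>carrier T. t \<noteq> u \<longrightarrow> (\<forall>Q\<in>C. g t \<ominus> g u \<notin> Q))"
    and uncountable_carrier: "|UNIV :: nat set| <o |carrier T|"
proof -
  obtain rep :: "'a \<Rightarrow> 'a" and s where *: "\<forall>t\<in>carrier T. rep t \<in> carrier T"
    "\<forall>t\<in>carrier T. \<forall>u\<in>carrier T. t \<ominus> u \<in> \<mm> \<longleftrightarrow> rep t = rep u"
    "\<forall>v::nat \<Rightarrow> 'a. (\<forall>i. v i \<in> rep ` carrier T) \<longrightarrow> s v \<in> carrier T"
    "\<forall>v (w::nat \<Rightarrow> 'a). (\<forall>i. v i \<in> rep ` carrier T) \<longrightarrow> (\<forall>i. w i \<in> rep ` carrier T) \<longrightarrow>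
      v \<noteq> w \<longrightarrow> (\<forall>Q\<in>C. s v \<ominus> s w \<notin> Q)"
    using incongruent_series by (elim exE conjE) (rule that)
  have "\<exists>E :: 'a \<Rightarrow> nat \<Rightarrow> 'a. (\<forall>t j. E t j \<in> rep ` carrier T) \<and> inj_on E (carrier T)"
    by (rule injection_into_sequences[of rep]) (use *(2) in auto)
  then obtain E :: "'a \<Rightarrow> nat \<Rightarrow> 'a" where E: "\<And>t j. E t j \<in> rep ` carrier T" "inj_on E (carrier T)"
    by blast
  show "\<exists>g. (\<forall>t\<in>carrier T. g t \<in> carrier T) \<and>
      (\<forall>t\<in>carrier T. \<forall>u\<in>carrier T. t \<noteq> u \<longrightarrow> (\<forall>Q\<in>C. g t \<ominus> g u \<notin> Q))"
  proof (intro exI[of _ "\<lambda>t. s (E t)"] conjI ballI impI)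
    show "s (E t) \<in> carrier T" for t using *(3) E(1) by simp
    show "s (E t) \<ominus> s (E u) \<notin> Q" if "t \<in> carrier T" "u \<in> carrier T" "t \<noteq> u" "Q \<in> C" for t u Q
      using *(4) E(1) inj_onD[OF E(2), of t u] that by metis
  qed
  have c: "\<one> \<in> carrier T" "\<zero> \<in> carrier T" using idealD(2)[OF oneideal] by auto
  have "\<one> \<ominus> \<zero> = \<one>" using c by algebra
  then have ne: "rep \<one> \<noteq> rep \<zero>" using *(2) c one_not_max by metis
  obtain Q where Q: "Q \<in> C" using C by blast
  define f where "f U = s (\<lambda>i::nat. if i \<in> U then rep \<one> else rep \<zero>)" for U
  have "inj_on f (Pow UNIV)"
  proof (rule inj_onI)
    fix U V assume XY: "f U = f V"
    let ?x = "\<lambda>(U::nat set) i. if i \<in> U then rep \<one> else rep \<zero>"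
    have K: "?x U i \<in> rep ` carrier T" for U and i :: nat using c by auto
    have "f U \<in> carrier T" unfolding f_def by (rule *(3)[rule_format]) (rule K)
    then have "f U \<ominus> f V \<in> Q" using XY idealD(2)[OF C_ideal[OF Q]] by (simp add: a_minus_def r_neg)
    moreover have "s (?x U) \<ominus> s (?x V) \<notin> Q" if "?x U \<noteq> ?x V" by (rule *(4)[rule_format, OF _ _ that Q]) (rule K)+
    ultimately have "?x U = ?x V" unfolding f_def by blast
    then have "i \<in> U \<longleftrightarrow> i \<in> V" for i using fun_cong[of "?x U" "?x V" i] ne by (simp split: if_splits)
    then show "U = V" by blast
  qed
  moreover have "f ` Pow UNIV \<subseteq> carrier T" using *(3) c by (auto simp: f_def)
  ultimately have "|Pow (UNIV::nat set)| \<le>o |carrier T|" using card_of_ordLeqI[of f "Pow UNIV" "carrier T"] by auto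
  then show "|UNIV :: nat set| <o |carrier T|" using card_of_Pow ordLess_ordLeq_trans by blast
qed

end

section \<open>Roots of polynomials modulo primes\<close>

context ring begin

text \<open>Polynomials are coefficient lists, constant term first, with trailing zeros allowed.
  Being nonzero modulo \<open>Q\<close> is then just \<open>\<not> set cs \<subseteq> Q\<close>,
  without degrees or quotient rings.\<close>

primrec horner :: "'a \<Rightarrow> 'a list \<Rightarrow> 'a" where
  "horner x [] = \<zero>"
| "horner x (c # cs) = c \<oplus> x \<otimes> horner x cs"

end

context cring begin

lemma horner_closed: "x \<in> carrier R \<Longrightarrow> set cs \<subseteq> carrier R \<Longrightarrow> horner x cs \<in> carrier R"
  by (induct cs) auto

lemma horner_mem_ideal: "ideal Q R \<Longrightarrow> x \<in> carrier R \<Longrightarrow> set cs \<subseteq> Q \<Longrightarrow> horner x cs \<in> Q"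
  by (induct cs) (auto simp: idealD)

text \<open>This is synthetic division: the new coefficient \<open>h\<close> of the quotient is the
  value of the tail at \<open>a\<close>. The clause about ideals replaces the comparison of degrees
  modulo \<open>Q\<close>: a quotient that vanishes modulo \<open>Q\<close> comes from a polynomial
  constant modulo \<open>Q\<close>.\<close>

lemma horner_divide:
  assumes "a \<in> carrier R" "set (c # cs) \<subseteq> carrier R"
  shows "\<exists>qs. length qs = length cs \<and> set qs \<subseteq> carrier R \<and>
    (\<forall>x\<in>carrier R. horner x (c # cs) \<ominus> horner a (c # cs) = (x \<ominus> a) \<otimes> horner x qs) \<and>
    (\<forall>Q. ideal Q R \<longrightarrow> set qs \<subseteq> Q \<longrightarrow> set cs \<subseteq> Q)"
  using assms(2)
proof (induct cs arbitrary: c)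
  case Nil
  then show ?case using assms(1) by (intro exI[of _ "[]"]) (auto simp: a_minus_def r_neg)
next
  case (Cons d ds)
  then have "set (d # ds) \<subseteq> carrier R" by simp
  from Cons(1)[OF this] obtain qs where qs: "length qs = length ds" "set qs \<subseteq> carrier R"
    "\<And>x. x \<in> carrier R \<Longrightarrow> horner x (d # ds) \<ominus> horner a (d # ds) = (x \<ominus> a) \<otimes> horner x qs"
    "\<And>Q. ideal Q R \<Longrightarrow> set qs \<subseteq> Q \<Longrightarrow> set ds \<subseteq> Q" by metis
  define h where "h = horner a (d # ds)"
  have h: "h \<in> carrier R" unfolding h_def using assms(1) Cons(2) by (intro horner_closed) auto
  have c: "c \<in> carrier R" "d \<in> carrier R" "set ds \<subseteq> carrier R" using Cons(2) by auto
  have "horner x (c # d # ds) \<ominus> horner a (c # d # ds) = (x \<ominus> a) \<otimes> horner x (h # qs)" if x: "x \<in> carrier R" for x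
  proof -
    define y e where "y = horner x (d # ds)" and "e = horner x qs"
    have yc: "y \<in> carrier R" "e \<in> carrier R" unfolding y_def e_def using x c qs(2) by (auto intro!: horner_closed simp del: horner.simps)
    have "y = (y \<ominus> h) \<oplus> h" using yc h by algebra
    then have y: "y = (x \<ominus> a) \<otimes> e \<oplus> h" using qs(3)[OF x] by (simp add: y_def e_def h_def del: horner.simps)
    have "(c \<oplus> x \<otimes> y) \<ominus> (c \<oplus> a \<otimes> h) = (x \<ominus> a) \<otimes> (h \<oplus> x \<otimes> e)"
      unfolding y using c(1) x assms(1) yc(2) h by algebra
    then show ?thesis by (simp add: y_def e_def h_def)
  qed
  moreover have "set (d # ds) \<subseteq> Q" if Q: "ideal Q R" "set (h # qs) \<subseteq> Q" for Q
  proof -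
    have ds: "set ds \<subseteq> Q" using qs(4) Q by auto
    then have 1: "a \<otimes> horner a ds \<in> Q" using horner_mem_ideal[OF Q(1) assms(1)] idealD(6)[OF Q(1)] assms(1) by simp
    have "horner a ds \<in> carrier R" using horner_closed assms(1) c by simp
    then have "d = h \<ominus> a \<otimes> horner a ds" unfolding h_def horner.simps using c(2) assms(1) by algebra
    then show ?thesis using ds 1 Q idealD(4)[OF Q(1), of h] by auto
  qed
  moreover have "set (h # qs) \<subseteq> carrier R" "length (h # qs) = length (d # ds)" using h qs by auto
  ultimately show ?case by blast
qed

text \<open>The usual root count in the domain \<open>R/Q\<close>: splitting off a root
  \<open>a\<close> shortens the list, and incongruence of the elements of \<open>Z\<close> allows to
  cancel \<open>x - a\<close>.\<close>

lemma finite_roots_mod_prime: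
  assumes Q: "primeideal Q R" and cs: "set cs \<subseteq> carrier R" "\<not> set cs \<subseteq> Q"
    and Z: "Z \<subseteq> carrier R" "\<And>x y. x \<in> Z \<Longrightarrow> y \<in> Z \<Longrightarrow> x \<noteq> y \<Longrightarrow> x \<ominus> y \<notin> Q" "\<And>x. x \<in> Z \<Longrightarrow> horner x cs \<in> Q"
  shows "finite Z"
  using cs Z
proof (induct "length cs" arbitrary: cs Z)
  case 0
  then show ?case by simp
next
  case (Suc n)
  then obtain c ds where cs: "cs = c # ds" by (metis length_Suc_conv)
  note iQ = primeD(1)[OF Q]
  show ?case
  proof (cases "Z = {}")
    case False
    then obtain a where a: "a \<in> Z" by auto
    have ac: "a \<in> carrier R" and csc: "set (c # ds) \<subseteq> carrier R" using a Suc cs by auto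
    obtain qs where qs: "length qs = length ds" "set qs \<subseteq> carrier R"
      "\<And>x. x \<in> carrier R \<Longrightarrow> horner x cs \<ominus> horner a cs = (x \<ominus> a) \<otimes> horner x qs"
      "\<And>Q. ideal Q R \<Longrightarrow> set qs \<subseteq> Q \<Longrightarrow> set ds \<subseteq> Q"
      using horner_divide[OF ac csc] unfolding cs[symmetric] by blast
    have nq: "\<not> set qs \<subseteq> Q"
    proof
      assume "set qs \<subseteq> Q"
      then have ds: "set ds \<subseteq> Q" using qs(4) iQ by blast
      have "horner a ds \<in> carrier R" "c \<in> carrier R" using horner_closed ac csc by auto
      then have "c = horner a cs \<ominus> a \<otimes> horner a ds" unfolding cs horner.simps using ac by algebra
      moreover have "a \<otimes> horner a ds \<in> Q" using horner_mem_ideal[OF iQ ac ds] idealD(6)[OF iQ] ac by simp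
      ultimately have "c \<in> Q" using Suc.prems(5)[OF a] idealD(4)[OF iQ] by simp
      then show False using ds Suc.prems(2) cs by simp
    qed
    have "finite (Z - {a})"
    proof (rule Suc(1)[OF _ qs(2) nq])
      show "n = length qs" using Suc(2) cs qs(1) by simp
      fix x assume x: "x \<in> Z - {a}"
      then have xc: "x \<in> carrier R" using Suc.prems(3) by auto
      have "(x \<ominus> a) \<otimes> horner x qs \<in> Q"
        using qs(3)[OF xc] Suc.prems(5) x a idealD(4)[OF iQ] by (metis DiffD1)
      moreover have "x \<ominus> a \<notin> Q" using Suc.prems(4)[of x a] x a by auto
      ultimately show "horner x qs \<in> Q"
        using primeD(3)[OF Q, of "x \<ominus> a" "horner x qs"] horner_closed[OF xc qs(2)] xc ac by simp
    qed (use Suc.prems in auto)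
    then show ?thesis by simp
  qed simp
qed

text \<open>The subring \<open>A[x]\<close>.\<close>

definition poly_values :: "'a set \<Rightarrow> 'a \<Rightarrow> 'a set" where
  "poly_values A x = horner x ` lists A"

lemma poly_values_subring:
  assumes A: "subring A R" and x: "x \<in> carrier R"
  shows "subring (poly_values A x) R" "A \<subseteq> poly_values A x" "x \<in> poly_values A x"
proof -
  note a = subringD[OF A]
  let ?P = "poly_values A x"
  have hA: "horner x cs \<in> carrier R" if "set cs \<subseteq> A" for cs
    by (rule horner_closed[OF x]) (use that a(1) in blast)
  have I: "horner x cs \<in> ?P" if "set cs \<subseteq> A" for cs using that by (auto simp: poly_values_def)
  have E: "\<exists>cs. set cs \<subseteq> A \<and> z = horner x cs" if "z \<in> ?P" for z using that by (auto simp: poly_values_def)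
  have c: "?P \<subseteq> carrier R" using hA by (auto simp: poly_values_def)
  have const: "d \<in> ?P" if "d \<in> A" for d using I[of "[d]"] that a(1) x by simp
  then show "A \<subseteq> ?P" by auto
  show "x \<in> ?P" using I[of "[\<zero>, \<one>]"] a x by simp
  have add: "\<exists>es. set es \<subseteq> A \<and> horner x es = horner x cs \<oplus> horner x ds" if "set cs \<subseteq> A" "set ds \<subseteq> A" for cs ds
    using that
  proof (induct cs arbitrary: ds)
    case Nil
    then show ?case using hA[of ds] by (intro exI[of _ ds]) auto
  next
    case (Cons c cs)
    show ?case
    proof (cases ds)
      case Nil
      then show ?thesis using hA[of "c # cs"] Cons(2) by (intro exI[of _ "c # cs"]) (auto simp del: horner.simps(2))
    next
      case d: (Cons d es)
      have s: "set cs \<subseteq> A" "set es \<subseteq> A" "c \<in> A" "d \<in> A" using Cons(2,3) d by auto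
      obtain fs where fs: "set fs \<subseteq> A" "horner x fs = horner x cs \<oplus> horner x es" using Cons(1)[OF s(1,2)] by blast
      have hc: "horner x cs \<in> carrier R" "horner x es \<in> carrier R" "c \<in> carrier R" "d \<in> carrier R"
        using hA s a(1) by auto
      have "(c \<oplus> d) \<oplus> x \<otimes> (horner x cs \<oplus> horner x es) = (c \<oplus> x \<otimes> horner x cs) \<oplus> (d \<oplus> x \<otimes> horner x es)"
        using hc x by algebra
      then show ?thesis using fs Cons d a by (intro exI[of _ "(c \<oplus> d) # fs"]) auto
    qed
  qed
  have scale: "\<exists>es. set es \<subseteq> A \<and> horner x es = d \<otimes> horner x cs" if "set cs \<subseteq> A" "d \<in> A" for cs d
    using that(1)
  proof (induct cs)
    case Nil
    then show ?case using that(2) a(1) by (intro exI[of _ "[]"]) auto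
  next
    case (Cons c cs)
    then obtain es where es: "set es \<subseteq> A" "horner x es = d \<otimes> horner x cs" by auto
    have hc: "horner x cs \<in> carrier R" "c \<in> carrier R" "d \<in> carrier R"
      using hA Cons(2) that a(1) by auto
    have "d \<otimes> c \<oplus> x \<otimes> (d \<otimes> horner x cs) = d \<otimes> (c \<oplus> x \<otimes> horner x cs)" using hc x by algebra
    then show ?case using es Cons that a by (intro exI[of _ "(d \<otimes> c) # es"]) auto
  qed
  have add': "y \<oplus> z \<in> ?P" if "y \<in> ?P" "z \<in> ?P" for y z using E[OF that(1)] E[OF that(2)] add I by metis
  have mult: "horner x cs \<otimes> z \<in> ?P" if "set cs \<subseteq> A" and z: "z \<in> ?P" for cs z
    using that(1)
  proof (induct cs)
    case Nil
    then show ?case using const[OF a(2)] c z by auto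
  next
    case (Cons d cs)
    have zc: "z \<in> carrier R" using c z by auto
    have hc: "horner x cs \<in> carrier R" "d \<in> carrier R" using hA Cons(2) a(1) by auto
    obtain es where es: "set es \<subseteq> A" "horner x cs \<otimes> z = horner x es" using Cons E by force
    have "horner x (\<zero> # es) \<in> ?P" by (rule I) (use es a(2) in simp)
    then have "x \<otimes> (horner x cs \<otimes> z) \<in> ?P" using es(2)[symmetric] hA[OF es(1)] x by simp
    moreover have "d \<otimes> z \<in> ?P" using E[OF z] scale[of _ d] I Cons(2) by (metis list.set_intros(1) subsetD)
    moreover have "(d \<oplus> x \<otimes> horner x cs) \<otimes> z = d \<otimes> z \<oplus> x \<otimes> (horner x cs \<otimes> z)" using hc zc x by algebra
    ultimately show ?case using add' by simp
  qed
  show "subring ?P R"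
  proof (rule subringI)
    show "?P \<subseteq> carrier R" by (rule c)
    show "\<one> \<in> ?P" by (rule const) (rule a)
    show m: "h1 \<otimes> h2 \<in> ?P" if "h1 \<in> ?P" "h2 \<in> ?P" for h1 h2 using E[OF that(1)] mult that(2) by blast
    show "\<ominus> h \<in> ?P" if "h \<in> ?P" for h
    proof -
      have "(\<ominus> \<one>) \<otimes> h \<in> ?P" by (rule m[OF const that]) (simp add: a)
      then show ?thesis using c that by (auto simp: l_minus)
    qed
    show "h1 \<oplus> h2 \<in> ?P" if "h1 \<in> ?P" "h2 \<in> ?P" for h1 h2 using add' that .
  qed
qed

end

section \<open>Cardinality\<close>

lemma card_of_Times_le:
  assumes "infinite Y" "|A| \<le>o |Y|" "|B| \<le>o |Y|" shows "|A \<times> B| \<le>o |Y|"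
  using card_of_Times_ordLeq_infinite_Field[of "|Y|" A B] assms by (simp add: Field_card_of card_of_Card_order)

lemma card_of_lists_le:
  assumes Y: "infinite Y" and A: "|A| \<le>o |Y|"
  shows "|lists A| \<le>o |Y|"
proof -
  have 1: "|{xs \<in> lists A. length xs = n}| \<le>o |Y|" for n
  proof (induct n)
    case 0
    have "{xs \<in> lists A. length xs = 0} = {[]}" by auto
    then show ?case using Y card_of_singl_ordLeq[of Y "[]"] by (metis finite.emptyI)
  next
    case (Suc n)
    have "{xs \<in> lists A. length xs = Suc n} = (\<lambda>(x, xs). x # xs) ` (A \<times> {xs \<in> lists A. length xs = n})"
      by (auto simp: length_Suc_conv image_iff)
    then have "|{xs \<in> lists A. length xs = Suc n}| \<le>o |A \<times> {xs \<in> lists A. length xs = n}|"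
      by (simp add: card_of_image)
    then show ?case using card_of_Times_le[OF Y A Suc] ordLeq_transitive by blast
  qed
  have "lists A = (\<Union>n\<in>(UNIV::nat set). {xs \<in> lists A. length xs = n})" by auto
  moreover have "|\<Union>n\<in>(UNIV::nat set). {xs \<in> lists A. length xs = n}| \<le>o |Y|"
    by (rule card_of_UNION_ordLeq_infinite[OF Y]) (use 1 Y infinite_iff_card_of_nat in auto)
  ultimately show ?thesis by simp
qed

lemma card_of_finite_le: "infinite Y \<Longrightarrow> finite A \<Longrightarrow> |A| \<le>o |Y|"
  by (metis card_of_ordLeq_infinite ordLeq_total card_of_Well_order)

text \<open>The generated ring is exhausted by countably many rounds of closing under the
  operations, each of which preserves countability.\<close>

lemma countable_generate_ring:
  assumes "countable H" shows "countable (generate_ring R H)"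
proof -
  define step where "step U = U \<union> a_inv R ` U \<union> (\<lambda>(x, y). x \<otimes>\<^bsub>R\<^esub> y) ` (U \<times> U) \<union> (\<lambda>(x, y). x \<oplus>\<^bsub>R\<^esub> y) ` (U \<times> U)" for U
  define G where "G n = (step ^^ n) (insert \<one>\<^bsub>R\<^esub> H)" for n :: nat
  have G_Suc: "G (Suc n) = step (G n)" for n by (simp add: G_def)
  have "countable (G n)" for n
    by (induct n) (auto simp: assms G_Suc step_def, simp_all add: G_def assms)
  then have c: "countable (\<Union>n. G n)" by simp
  have mono: "G n \<subseteq> G m" if "n \<le> m" for n m
    using that by (induct rule: dec_induct) (auto simp: G_Suc step_def)
  have two: "\<exists>n. x \<in> G n \<and> y \<in> G n" if "x \<in> G k" "y \<in> G l" for x y k l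
    using that mono[of k "max k l"] mono[of l "max k l"] by auto
  have "x \<in> (\<Union>n. G n)" if "x \<in> generate_ring R H" for x
    using that
  proof induct
    case one
    have "\<one>\<^bsub>R\<^esub> \<in> G 0" by (simp add: G_def)
    then show ?case by blast
  next
    case (incl h)
    then have "h \<in> G 0" by (simp add: G_def)
    then show ?case by blast
  next
    case (a_inv h)
    then obtain n where "h \<in> G n" by auto
    then have "\<ominus>\<^bsub>R\<^esub> h \<in> G (Suc n)" unfolding G_Suc step_def by auto
    then show ?case by blast
  next
    case (eng_add h k)
    then obtain n where "h \<in> G n" "k \<in> G n" using two by blast
    then have "h \<oplus>\<^bsub>R\<^esub> k \<in> G (Suc n)" unfolding G_Suc step_def by auto
    then show ?case by blast
  next
    case (eng_mult h k)
    then obtain n where "h \<in> G n" "k \<in> G n" using two by blast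
    then have "h \<otimes>\<^bsub>R\<^esub> k \<in> G (Suc n)" unfolding G_Suc step_def by auto
    then show ?case by blast
  qed
  then show ?thesis using countable_subset[OF _ c] by blast
qed

lemma card_of_countable_le:
  assumes "infinite Y" "countable A" shows "|A| \<le>o |Y|"
proof -
  obtain f :: "_ \<Rightarrow> nat" where "inj_on f A" using assms(2) by (auto simp: countable_def)
  then have "|A| \<le>o |UNIV :: nat set|" using card_of_ordLeqI[of f A UNIV] by auto
  moreover have "|UNIV :: nat set| \<le>o |Y|" using assms(1) infinite_iff_card_of_nat by auto
  ultimately show ?thesis using ordLeq_transitive by blast
qed

context prime_family begin

text \<open>If every parameter failed, \<open>carrier T\<close> would be covered by the sets
  \<open>F (Q, cs)\<close>. Each is finite, since \<open>y\<close> outside \<open>Q\<close> keeps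
  the elements \<open>u + y g t\<close> incongruent and \<open>cs\<close> has finitely many roots
  modulo \<open>Q\<close>. There are at most \<open>|Y|\<close> pairs \<open>(Q, cs)\<close>, too
  few to cover \<open>T\<close>.\<close>

lemma transcendental_exists:
  assumes Y: "infinite Y" "|Y| <o |carrier T|" and R: "R \<subseteq> carrier T" "|R| \<le>o |Y|"
    and u: "u \<in> carrier T" and y: "y \<in> carrier T" "\<And>Q. Q \<in> C \<Longrightarrow> y \<notin> Q"
  shows "\<exists>t\<in>carrier T. \<forall>Q\<in>C. \<forall>cs\<in>lists R. horner (u \<oplus> y \<otimes> t) cs \<in> Q \<longrightarrow> set cs \<subseteq> Q"
proof (rule ccontr)
  assume neg: "\<not> ?thesis"
  obtain g where g: "\<And>t. t \<in> carrier T \<Longrightarrow> g t \<in> carrier T"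
    "\<And>t u Q. t \<in> carrier T \<Longrightarrow> u \<in> carrier T \<Longrightarrow> t \<noteq> u \<Longrightarrow> Q \<in> C \<Longrightarrow> g t \<ominus> g u \<notin> Q"
    using incongruent_family by blast
  define x where "x t = u \<oplus> y \<otimes> g t" for t
  have xc: "x t \<in> carrier T" if "t \<in> carrier T" for t using u y g that by (simp add: x_def)
  have xd: "x t \<ominus> x s \<notin> Q" if "t \<in> carrier T" "s \<in> carrier T" "t \<noteq> s" "Q \<in> C" for t s Q
    unfolding x_def affine_diff[OF u y(1) g(1)[OF that(1)] g(1)[OF that(2)]]
    using primeD(3)[OF C(3)[OF that(4)] y(1), of "g t \<ominus> g s"] y(2) g that by simp
  define F where "F = (\<lambda>(Q, cs). {t \<in> carrier T. horner (x t) cs \<in> Q \<and> \<not> set cs \<subseteq> Q})"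
  have "carrier T \<subseteq> (\<Union>i\<in>C \<times> lists R. F i)"
    using neg g(1) unfolding F_def x_def by (fastforce simp del: in_lists_conv_set)
  moreover have "|\<Union>i\<in>C \<times> lists R. F i| \<le>o |Y|"
  proof (rule card_of_UNION_ordLeq_infinite[OF Y(1)])
    show "|C \<times> lists R| \<le>o |Y|"
      by (rule card_of_Times_le[OF Y(1) card_of_finite_le[OF Y(1) C(1)] card_of_lists_le[OF Y(1) R(2)]])
    show "\<forall>i\<in>C \<times> lists R. |F i| \<le>o |Y|"
    proof
      fix i assume "i \<in> C \<times> lists R"
      then obtain Q cs where i: "i = (Q, cs)" "Q \<in> C" "set cs \<subseteq> R" by auto
      have "finite (F i)"
      proof (cases "set cs \<subseteq> Q")
        case False
        have "finite (x ` F i)"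
          by (rule finite_roots_mod_prime[OF C(3)[OF i(2)] _ False])
            (use i R(1) xc in \<open>auto simp: F_def intro: xd[OF _ _ _ i(2), THEN notE]\<close>)
        moreover have "inj_on x (F i)"
        proof (rule inj_onI)
          fix t s assume ts: "t \<in> F i" "s \<in> F i" "x t = x s"
          then have c: "t \<in> carrier T" "s \<in> carrier T" by (auto simp: F_def i)
          have "x t \<ominus> x s \<in> Q" using ts xc[OF c(2)] idealD(2)[OF C_ideal[OF i(2)]] by (simp add: a_minus_def r_neg)
          then show "t = s" using xd[OF c _ i(2)] by blast
        qed
        ultimately show ?thesis using finite_imageD by blast
      qed (simp add: F_def i)
      then show "|F i| \<le>o |Y|" using card_of_finite_le Y(1) by blast
    qed
  qed
  ultimately have "|carrier T| \<le>o |Y|" using card_of_mono1 ordLeq_transitive by blast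
  then show False using Y(2) not_ordLess_ordLeq by blast
qed

end

section \<open>Good subrings\<close>

locale sufficient_conditions = prime_family +
  assumes cond_ass: "\<And>P. P \<in> associated_primes T (regular_module T) \<Longrightarrow> P \<inter> \<Pi>p = {\<zero>}"
    and cond_quot: "\<And>P. P \<in> associated_primes T (quotient_module T pT) \<Longrightarrow> \<exists>Q\<in>C. P \<subseteq> Q"
    and cond_prod: "\<And>Q. Q \<in> C \<Longrightarrow> ((Q - pT) <#>\<^bsub>T\<^esub> \<Pi>p) \<inter> \<Pi>p \<subseteq> {\<zero>}"
begin

lemma ring_zero_one: "\<zero> \<in> carrier T" "\<one> \<in> carrier T"
  using idealD(2)[OF oneideal] by auto

text \<open>A zero divisor lies in an associated prime, and condition (i) applies because
  \<open>p\<close> itself is a nonzero element of \<open>\<Pi>p\<close>.\<close>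

lemma p_regular:
  assumes t: "t \<in> carrier T" "p \<otimes> t = \<zero>" shows "t = \<zero>"
proof (rule ccontr)
  assume "t \<noteq> \<zero>"
  then obtain P w where P: "primeideal P T" "w \<in> carrier T" "P = {s \<in> carrier T. s \<otimes> w \<in> {\<zero>}}" "p \<in> P"
    using zero_divisor_in_associated_prime[OF zeroideal t(1) _ p_carrier] t by auto
  then have "P \<in> associated_primes T (regular_module T)"
    by (auto simp: mem_associated_primes_regular)
  then have "p = \<zero>" using cond_ass P(4) prime_subring_adjoin_subring(2)[OF p_carrier] by blast
  then show False using p by simp
qed

lemma p_cancel: "x \<in> carrier T \<Longrightarrow> y \<in> carrier T \<Longrightarrow> p \<otimes> x = p \<otimes> y \<Longrightarrow> x = y"
proof -
  assume c: "x \<in> carrier T" "y \<in> carrier T" and e: "p \<otimes> x = p \<otimes> y"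
  have "p \<otimes> (x \<ominus> y) = p \<otimes> x \<ominus> p \<otimes> y" using c p_carrier by algebra
  also have "\<dots> = \<zero>" using e c p_carrier by (simp add: a_minus_def r_neg)
  finally show "x = y" using p_regular[of "x \<ominus> y"] c by simp
qed

lemma p_power_closed: "p [^] (n::nat) \<in> carrier T"
  using p_carrier by simp

lemma p_power_cancel:
  assumes "x \<in> carrier T" "y \<in> carrier T" "p [^] (n::nat) \<otimes> x = p [^] n \<otimes> y" shows "x = y"
  using assms(3)
proof (induct n)
  case (Suc n)
  have "p \<otimes> (p [^] n \<otimes> x) = p \<otimes> (p [^] n \<otimes> y)" using Suc(2) assms(1,2) p_carrier by (simp add: m_ac)
  then show ?case using Suc(1) p_cancel assms(1,2) p_power_closed by simp
qed (use assms in simp)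

lemma p_power_regular:
  assumes "x \<in> carrier T" "p [^] (n::nat) \<otimes> x = \<zero>" shows "x = \<zero>"
  using p_power_cancel[of x \<zero> n] assms p_power_closed by simp

text \<open>Zero divisors modulo \<open>p\<close> lie in associated primes of \<open>T/pT\<close>,
  which condition (ii) places below members of \<open>C\<close>.\<close>

lemma regular_mod_p:
  assumes r: "r \<in> carrier T" "\<And>Q. Q \<in> C \<Longrightarrow> r \<notin> Q" and z: "z \<in> carrier T" "r \<otimes> z \<in> pT"
  shows "z \<in> pT"
proof (rule ccontr)
  assume "z \<notin> pT"
  then obtain P w where P: "primeideal P T" "w \<in> carrier T" "P = {s \<in> carrier T. s \<otimes> w \<in> pT}" "r \<in> P"
    using zero_divisor_in_associated_prime[OF pT_ideal z(1) _ r(1)] z by auto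
  then have "P \<in> associated_primes T (quotient_module T pT)"
    by (auto simp: mem_associated_primes_quotient[OF pT_ideal])
  then show False using cond_quot P(4) r(2) by blast
qed

text \<open>The part of goodness that a polynomial ring over a good ring inherits: only division by
  \<open>p\<close> stays inside. It is enough for nonzero elements to be regular, and
  \<open>fraction_closure\<close> then restores goodness.\<close>

definition saturated :: "'a set \<Rightarrow> bool" where
  "saturated S \<longleftrightarrow> subring S T \<and> p \<in> S \<and> (\<forall>t\<in>carrier T. p \<otimes> t \<in> S \<longrightarrow> t \<in> S) \<and> (\<forall>Q\<in>C. S \<inter> Q \<subseteq> pT)"

text \<open>The condition on \<open>r\<close> and \<open>t\<close> says that \<open>S = T \<inter> Frac S\<close>.\<close>

definition good :: "'a set \<Rightarrow> bool" where
  "good S \<longleftrightarrow> subring S T \<and> p \<in> S \<and> (\<forall>r\<in>S. \<forall>t\<in>carrier T. r \<noteq> \<zero> \<longrightarrow> r \<otimes> t \<in> S \<longrightarrow> t \<in> S) \<and>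
    (\<forall>Q\<in>C. S \<inter> Q \<subseteq> pT)"

lemma good_saturated: "good S \<Longrightarrow> saturated S"
  unfolding good_def saturated_def using p(2) by blast

lemma saturatedD:
  assumes "saturated S"
  shows "subring S T" "p \<in> S" "\<And>t. t \<in> carrier T \<Longrightarrow> p \<otimes> t \<in> S \<Longrightarrow> t \<in> S" "\<And>Q x. Q \<in> C \<Longrightarrow> x \<in> S \<Longrightarrow> x \<in> Q \<Longrightarrow> x \<in> pT"
  using assms by (auto simp: saturated_def)

lemma goodD:
  assumes "good S"
  shows "subring S T" "p \<in> S" "\<And>r t. r \<in> S \<Longrightarrow> t \<in> carrier T \<Longrightarrow> r \<noteq> \<zero> \<Longrightarrow> r \<otimes> t \<in> S \<Longrightarrow> t \<in> S"
    "\<And>Q x. Q \<in> C \<Longrightarrow> x \<in> S \<Longrightarrow> x \<in> Q \<Longrightarrow> x \<in> pT"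
  using assms unfolding good_def by blast+

lemma saturated_power:
  assumes S: "saturated S" and y: "y \<in> carrier T" "p [^] (n::nat) \<otimes> y \<in> S" shows "y \<in> S"
  using y(2)
proof (induct n)
  case (Suc n)
  have "p [^] Suc n \<otimes> y = p \<otimes> (p [^] n \<otimes> y)" using p_carrier y by (simp add: m_ac)
  then show ?case using Suc saturatedD(3)[OF S, of "p [^] n \<otimes> y"] y p_power_closed by simp
qed (use y in simp)

text \<open>By Krull's theorem some power of \<open>p\<close> does not divide \<open>r\<close>. The
  least such exponent \<open>n\<close> is positive, and \<open>k = n - 1\<close>. The cofactor stays
  in \<open>S\<close> by saturation and is not in \<open>pT\<close>, so it lies outside every
  \<open>Q\<close>.\<close>

lemma saturated_factor:
  assumes S: "saturated S" and r: "r \<in> S" "r \<noteq> \<zero>"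
  obtains k r' where "r = p [^] (k::nat) \<otimes> r'" "r' \<in> S" "\<forall>Q\<in>C. r' \<notin> Q"
proof -
  note s = subringD[OF saturatedD(1)[OF S]] saturatedD[OF S]
  have rc: "r \<in> carrier T" using s(1)[OF r(1)] .
  define n where "n = (LEAST n. \<not> (\<exists>y\<in>carrier T. r = p [^] (n::nat) \<otimes> y))"
  have "\<exists>n. \<not> (\<exists>y\<in>carrier T. r = p [^] (n::nat) \<otimes> y)" using power_p_zero[OF rc] r by blast
  then have n: "\<not> (\<exists>y\<in>carrier T. r = p [^] n \<otimes> y)" unfolding n_def by (rule LeastI_ex)
  have "n \<noteq> 0" using n rc by (metis l_one nat_pow_0)
  then obtain k where k: "n = Suc k" by (cases n) auto
  then have "k < n" by simp
  from not_less_Least[OF this[unfolded n_def]] obtain y where y: "y \<in> carrier T" "r = p [^] k \<otimes> y" by auto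
  have yS: "y \<in> S" using saturated_power[OF S y(1), of k] y(2) r by simp
  have "y \<notin> pT"
  proof
    assume "y \<in> pT"
    then obtain z where z: "z \<in> carrier T" "y = p \<otimes> z" using mem_pT by blast
    then have "r = p [^] n \<otimes> z" unfolding y k using p_carrier by (simp add: m_assoc)
    then show False using n z by blast
  qed
  then show thesis using that y(2) yS s(12) by blast
qed

text \<open>Regularity modulo \<open>p\<close> gives \<open>z = p x\<close>, and regularity of
  \<open>p\<close> gives \<open>r x = 0\<close>. Repeating this puts \<open>z\<close> into every
  \<open>p^n T\<close>.\<close>

lemma regular_outside:
  assumes r: "r \<in> carrier T" "\<And>Q. Q \<in> C \<Longrightarrow> r \<notin> Q" and z: "z \<in> carrier T" "r \<otimes> z = \<zero>"
  shows "z = \<zero>"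
proof -
  have "\<exists>y\<in>carrier T. z = p [^] (n::nat) \<otimes> y \<and> r \<otimes> y = \<zero>" for n
  proof (induct n)
    case 0
    then show ?case using z by auto
  next
    case (Suc n)
    then obtain y where y: "y \<in> carrier T" "z = p [^] n \<otimes> y" "r \<otimes> y = \<zero>" by blast
    have "y \<in> pT" using regular_mod_p[OF r y(1)] y(3) idealD(2)[OF pT_ideal] by simp
    then obtain x where x: "x \<in> carrier T" "y = p \<otimes> x" using mem_pT by blast
    have "p \<otimes> (r \<otimes> x) = \<zero>" using y(3) x r p_carrier by (simp add: m_lcomm)
    then have "r \<otimes> x = \<zero>" using p_regular x r by simp
    moreover have "z = p [^] Suc n \<otimes> x" using y x p_carrier by (simp add: m_assoc)
    ultimately show ?case using x by blast
  qed
  then show ?thesis using power_p_zero[OF z(1)] by blast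
qed

lemma saturated_regular:
  assumes S: "saturated S" and r: "r \<in> S" "r \<noteq> \<zero>" and z: "z \<in> carrier T" "r \<otimes> z = \<zero>"
  shows "z = \<zero>"
proof -
  obtain k r' where k: "r = p [^] (k::nat) \<otimes> r'" "r' \<in> S" "\<forall>Q\<in>C. r' \<notin> Q"
    using saturated_factor[OF S r] .
  have rc: "r' \<in> carrier T" using subringD(1)[OF saturatedD(1)[OF S]] k by auto
  have "p [^] k \<otimes> (r' \<otimes> z) = \<zero>" using z k rc p_carrier by (simp add: m_assoc)
  then have "r' \<otimes> z = \<zero>" using p_power_regular[of "r' \<otimes> z" k] rc z by simp
  then show ?thesis using regular_outside[OF rc k(3)[rule_format] z(1)] by simp
qed

text \<open>The ring \<open>T \<inter> Frac S\<close>, expressed by denominators from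
  \<open>S\<close>, since \<open>T\<close> need not be a domain.\<close>

definition fraction_closure :: "'a set \<Rightarrow> 'a set" where
  "fraction_closure S = {t \<in> carrier T. \<exists>r\<in>S. r \<noteq> \<zero> \<and> r \<otimes> t \<in> S}"

lemma fraction_closure:
  assumes S: "saturated S"
  shows "good (fraction_closure S)" "S \<subseteq> fraction_closure S"
    "infinite Y \<Longrightarrow> |S| \<le>o |Y| \<Longrightarrow> |fraction_closure S| \<le>o |Y|"
proof -
  note s = subringD[OF saturatedD(1)[OF S]] and sat = saturatedD[OF S]
  let ?F = "fraction_closure S"
  have one: "\<one> \<noteq> \<zero>" using one_not_max idealD(2)[OF max_ideal] by metis
  have FE: "\<exists>r. t \<in> carrier T \<and> r \<in> S \<and> r \<in> carrier T \<and> r \<noteq> \<zero> \<and> r \<otimes> t \<in> S" if "t \<in> ?F" for t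
    using that s(1) by (auto simp: fraction_closure_def)
  have FI: "t \<in> ?F" if "t \<in> carrier T" "r \<in> S" "r \<noteq> \<zero>" "r \<otimes> t \<in> S" for t r
    using that by (auto simp: fraction_closure_def)
  have nz: "r \<otimes> q \<noteq> \<zero>" if "r \<in> S" "r \<noteq> \<zero>" "q \<in> carrier T" "q \<noteq> \<zero>" for r q
    using saturated_regular[OF S that(1,2,3)] that by blast
  show SF: "S \<subseteq> ?F" using FI[of _ \<one>] one s by auto
  have sub: "subring ?F T"
  proof (rule subringI)
    show "?F \<subseteq> carrier T" by (auto simp: fraction_closure_def)
    show "\<one> \<in> ?F" using SF s by auto
    fix h assume h: "h \<in> ?F"
    then obtain r where r: "h \<in> carrier T" "r \<in> S" "r \<in> carrier T" "r \<noteq> \<zero>" "r \<otimes> h \<in> S" using FE by blast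
    then have "r \<otimes> (\<ominus> h) \<in> S" using s(4)[OF r(5)] by (simp add: r_minus)
    then show "\<ominus> h \<in> ?F" using FI[of "\<ominus> h" r] r by simp
    fix g assume "g \<in> ?F"
    then obtain q where q: "g \<in> carrier T" "q \<in> S" "q \<in> carrier T" "q \<noteq> \<zero>" "q \<otimes> g \<in> S" using FE by blast
    have rq: "r \<otimes> q \<in> S" "r \<otimes> q \<noteq> \<zero>" using s r q nz by auto
    have "(r \<otimes> q) \<otimes> (h \<otimes> g) = (r \<otimes> h) \<otimes> (q \<otimes> g)" using r q by (simp add: m_ac)
    then show "h \<otimes> g \<in> ?F" using FI[OF _ rq] r q s by simp
    have "(r \<otimes> q) \<otimes> (h \<oplus> g) = q \<otimes> (r \<otimes> h) \<oplus> r \<otimes> (q \<otimes> g)" using r(1,3) q(1,3) by algebra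
    then show "h \<oplus> g \<in> ?F" using FI[OF _ rq] r q s by simp
  qed
  show "good ?F" unfolding good_def
  proof (intro conjI ballI impI subsetI)
    show "subring ?F T" by (rule sub)
    show "p \<in> ?F" using SF sat by auto
  next
    fix r t assume r: "r \<in> ?F" and t: "t \<in> carrier T" and r0: "r \<noteq> \<zero>" and rt: "r \<otimes> t \<in> ?F"
    obtain a where a: "r \<in> carrier T" "a \<in> S" "a \<in> carrier T" "a \<noteq> \<zero>" "a \<otimes> r \<in> S" using FE[OF r] by blast
    obtain b where b: "b \<in> S" "b \<in> carrier T" "b \<noteq> \<zero>" "b \<otimes> (r \<otimes> t) \<in> S" using FE[OF rt] by blast
    have "(b \<otimes> (a \<otimes> r)) \<otimes> t = a \<otimes> (b \<otimes> (r \<otimes> t))" using a b t by (simp add: m_ac)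
    moreover have "b \<otimes> (a \<otimes> r) \<in> S" "b \<otimes> (a \<otimes> r) \<noteq> \<zero>" using a b s nz r0 by auto
    ultimately show "t \<in> ?F" using FI[OF t, of "b \<otimes> (a \<otimes> r)"] a b s by simp
  next
    fix Q t assume Q: "Q \<in> C" and t: "t \<in> ?F \<inter> Q"
    then obtain r where r: "t \<in> carrier T" "r \<in> S" "r \<noteq> \<zero>" "r \<otimes> t \<in> S" using FE by blast
    \<comment> \<open>Without the power of \<open>p\<close> in the denominator, the numerator
      \<open>r' t\<close> still lies in \<open>S\<close> and in \<open>Q\<close>, hence in
      \<open>pT\<close>; regularity of \<open>r'\<close> modulo \<open>p\<close> passes this on to
      \<open>t\<close>.\<close>
    obtain k r' where k: "r = p [^] (k::nat) \<otimes> r'" "r' \<in> S" "\<forall>Q\<in>C. r' \<notin> Q"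
      using saturated_factor[OF S r(2,3)] .
    have rc: "r' \<in> carrier T" using k s by auto
    have "p [^] k \<otimes> (r' \<otimes> t) \<in> S" using r k rc p_carrier by (simp add: m_assoc)
    then have "r' \<otimes> t \<in> S" using saturated_power[OF S] r rc by simp
    moreover have "r' \<otimes> t \<in> Q" using t rc idealD(6)[OF C_ideal[OF Q]] by blast
    ultimately have "r' \<otimes> t \<in> pT" using sat(4)[OF Q] by blast
    then show "t \<in> pT" using regular_mod_p[OF rc k(3)[rule_format] r(1)] by blast
  qed
  show "|?F| \<le>o |Y|" if Y: "infinite Y" "|S| \<le>o |Y|"
  proof -
    have "\<forall>t\<in>?F. \<exists>r. r \<in> S \<and> r \<noteq> \<zero> \<and> r \<otimes> t \<in> S" using FE by blast
    then obtain r where r: "\<And>t. t \<in> ?F \<Longrightarrow> r t \<in> S \<and> r t \<noteq> \<zero> \<and> r t \<otimes> t \<in> S" by metis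
    \<comment> \<open>Denominator and numerator together determine \<open>t\<close>, because
      denominators are regular on \<open>T\<close>.\<close>
    have "inj_on (\<lambda>t. (r t, r t \<otimes> t)) ?F"
    proof (rule inj_onI)
      fix t u assume tu: "t \<in> ?F" "u \<in> ?F" "(r t, r t \<otimes> t) = (r u, r u \<otimes> u)"
      have c: "t \<in> carrier T" "u \<in> carrier T" "r t \<in> carrier T" using FE tu r s by blast+
      have "r t \<otimes> (t \<ominus> u) = r t \<otimes> t \<ominus> r t \<otimes> u" using c by algebra
      also have "r t \<otimes> t = r t \<otimes> u" using tu(3) by (metis prod.inject)
      also have "r t \<otimes> u \<ominus> r t \<otimes> u = \<zero>" using c by (simp add: a_minus_def r_neg)
      finally show "t = u" using saturated_regular[OF S, of "r t" "t \<ominus> u"] r[OF tu(1)] c by simp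
    qed
    moreover have "(\<lambda>t. (r t, r t \<otimes> t)) ` ?F \<subseteq> S \<times> S" using r by auto
    ultimately have "|?F| \<le>o |S \<times> S|" using card_of_ordLeqI[of "\<lambda>t. (r t, r t \<otimes> t)" ?F "S \<times> S"] by auto
    then show ?thesis using card_of_Times_le[OF Y(1) Y(2) Y(2)] ordLeq_transitive by blast
  qed
qed

text \<open>If a polynomial value lies in \<open>Q\<close> although \<open>x\<close> is transcendental modulo \<open>Q\<close>, all the
  coefficients lie in \<open>S \<inter> Q = pS\<close>, so \<open>p\<close> can be divided out of the polynomial.\<close>

lemma saturated_poly_values:
  assumes S: "good S" and x: "x \<in> carrier T"
    and tr: "\<And>Q cs. Q \<in> C \<Longrightarrow> set cs \<subseteq> S \<Longrightarrow> horner x cs \<in> Q \<Longrightarrow> set cs \<subseteq> Q"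
  shows "saturated (poly_values S x)"
proof -
  note s = subringD[OF goodD(1)[OF S]] and g = goodD[OF S]
  note P = poly_values_subring[OF g(1) x]
  have div: "\<exists>ds. set ds \<subseteq> S \<and> horner x cs = p \<otimes> horner x ds" if "set cs \<subseteq> S" "set cs \<subseteq> pT" for cs
    using that
  proof (induct cs)
    case Nil
    then show ?case using p_carrier by (intro exI[of _ "[]"]) auto
  next
    case (Cons c cs)
    then obtain ds where ds: "set ds \<subseteq> S" "horner x cs = p \<otimes> horner x ds" by auto
    obtain d where d: "d \<in> carrier T" "c = p \<otimes> d" using Cons(3) mem_pT by auto
    have "d \<in> S" using g(3)[OF g(2) d(1)] p(2) d Cons(2) by simp
    moreover have "horner x (c # cs) = p \<otimes> horner x (d # ds)"
    proof -
      have "horner x ds \<in> carrier T" using horner_closed[OF x] ds s by auto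
      then show ?thesis using ds d p_carrier x by (simp add: r_distr m_lcomm)
    qed
    ultimately show ?case using ds by (intro exI[of _ "d # ds"]) auto
  qed
  have main: "\<exists>ds. set ds \<subseteq> S \<and> z = p \<otimes> horner x ds" if Q: "Q \<in> C" "z \<in> poly_values S x" "z \<in> Q" for Q z
  proof -
    obtain cs where cs: "set cs \<subseteq> S" "z = horner x cs" using Q(2) by (auto simp: poly_values_def)
    then have "set cs \<subseteq> Q" using tr Q by blast
    then have "set cs \<subseteq> pT" using g(4)[OF Q(1)] cs by blast
    then show ?thesis using div cs by blast
  qed
  obtain Q0 where Q0: "Q0 \<in> C" using C by blast
  have hc: "horner x ds \<in> carrier T" if "set ds \<subseteq> S" for ds
    by (rule horner_closed[OF x]) (use that s in auto)
  show ?thesis unfolding saturated_def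
  proof (intro conjI ballI impI subsetI)
    show "subring (poly_values S x) T" by (rule P)
    show "p \<in> poly_values S x" using P g by auto
    fix t assume t: "t \<in> carrier T" "p \<otimes> t \<in> poly_values S x"
    have "p \<otimes> t \<in> Q0" using idealD(7)[OF C_ideal[OF Q0]] p Q0 t by blast
    then obtain ds where "set ds \<subseteq> S" "p \<otimes> t = p \<otimes> horner x ds" using main[OF Q0 t(2)] by blast
    then show "t \<in> poly_values S x" using p_cancel[OF t(1) hc] by (auto simp: poly_values_def)
  next
    fix Q z assume "Q \<in> C" "z \<in> poly_values S x \<inter> Q"
    then obtain ds where "set ds \<subseteq> S" "z = p \<otimes> horner x ds" using main by blast
    then show "z \<in> pT" using mem_pT hc by blast
  qed
qed

section \<open>Adjoining elements to good rings and moving coefficients into them\<close>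

lemma good_adjoin:
  assumes Y: "infinite Y" "|Y| <o |carrier T|" and S: "good S" "|S| \<le>o |Y|"
    and u: "u \<in> carrier T" and y: "y \<in> carrier T" "\<And>Q. Q \<in> C \<Longrightarrow> y \<notin> Q"
  obtains S' t where "good S'" "S \<subseteq> S'" "|S'| \<le>o |Y|" "t \<in> carrier T" "u \<oplus> y \<otimes> t \<in> S'"
proof -
  note s = subringD[OF goodD(1)[OF S(1)]]
  have "S \<subseteq> carrier T" using s by auto
  then obtain t where t: "t \<in> carrier T"
    "\<forall>Q\<in>C. \<forall>cs\<in>lists S. horner (u \<oplus> y \<otimes> t) cs \<in> Q \<longrightarrow> set cs \<subseteq> Q"
    using transcendental_exists[OF Y _ S(2) u y] by metis
  define x where "x = u \<oplus> y \<otimes> t"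
  have x: "x \<in> carrier T" using u y t by (simp add: x_def)
  have sat: "saturated (poly_values S x)"
    by (rule saturated_poly_values[OF S(1) x]) (use t(2) in \<open>auto simp: x_def\<close>)
  note P = poly_values_subring[OF goodD(1)[OF S(1)] x]
  have "|poly_values S x| \<le>o |lists S|" unfolding poly_values_def by (rule card_of_image)
  then have "|poly_values S x| \<le>o |Y|" using card_of_lists_le[OF Y(1) S(2)] ordLeq_transitive by blast
  then show thesis
    using that[of "fraction_closure (poly_values S x)" t] fraction_closure[OF sat] P t(1) Y(1)
    unfolding x_def by blast
qed

lemma lin_span_zero_cons: "set (f # F) \<subseteq> A \<Longrightarrow> subring A T \<Longrightarrow> lin_span A F \<subseteq> lin_span A (f # F)"
proof
  fix x assume a: "set (f # F) \<subseteq> A" "subring A T" and x: "x \<in> lin_span A F"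
  note s = subringD[OF a(2)]
  have "x \<in> A" using subring_idealD(1)[OF a(2) lin_span_ideal[OF a(2)]] x a(1) by auto
  then have "x = \<zero> \<otimes> f \<oplus> x" using a(1) s(1) by simp
  then show "x \<in> lin_span A (f # F)" by (rule lin_spanI) (use x s in auto)
qed

text \<open>Both lists generate the same ideal. The exchange is needed because the recursion exposes
  only the head, whereas Heitmann's step treats the first two generators differently.\<close>

lemma lin_span_swap:
  assumes "set (a # b # F) \<subseteq> A" "subring A T"
  shows "lin_span A (a # b # F) = lin_span A (b # a # F)"
proof -
  have "lin_span A (a # b # F) = Idl\<^bsub>subring_of T A\<^esub> (set (a # b # F))"
    using Idl_eq_lin_span[OF assms(2,1)] by simp
  also have "set (a # b # F) = set (b # a # F)" by auto
  also have "Idl\<^bsub>subring_of T A\<^esub> (set (b # a # F)) = lin_span A (b # a # F)"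
    using Idl_eq_lin_span[OF assms(2), of "b # a # F"] assms(1) by auto
  finally show ?thesis .
qed

text \<open>Heitmann's step. Given \<open>c = a t\<^sub>1 + b t\<^sub>2 + \<dots>\<close> with \<open>a\<close> and \<open>b\<close> not both \<open>0\<close>, dividing by a
  power of \<open>p\<close> allows to assume that \<open>a' = a / p\<^sup>k\<close> lies outside all \<open>Q \<in> C\<close> and
  \<open>b'' = b / p\<^sup>k\<close> is in the ring; then \<open>t\<^sub>2\<close> may be replaced by \<open>t\<^sub>2 + a' t\<close> at the expense of
  changing \<open>t\<^sub>1\<close> to \<open>t\<^sub>1 - b'' t\<close>, and the former can be adjoined.\<close>

lemma good_span:
  assumes Y: "infinite Y" "|Y| <o |carrier T|"
  shows "good S \<Longrightarrow> |S| \<le>o |Y| \<Longrightarrow> set F \<subseteq> S \<Longrightarrow> c \<in> S \<Longrightarrow> c \<in> lin_span (carrier T) F \<Longrightarrow>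
    \<exists>S'. good S' \<and> S \<subseteq> S' \<and> |S'| \<le>o |Y| \<and> c \<in> lin_span S' F"
proof (induct "length F" arbitrary: F S c)
  case 0
  then show ?case by (intro exI[of _ S]) auto
next
  case (Suc n)
  note S = Suc.prems
  note IH = Suc(1)
  note g = goodD[OF S(1)] and s = subringD[OF goodD(1)[OF S(1)]]
  obtain a F1 where F: "F = a # F1" using Suc(2) by (metis length_Suc_conv)
  show ?case
  proof (cases F1)
    case Nil
    have ac: "a \<in> S" "a \<in> carrier T" using S F s by auto
    \<comment> \<open>With a single generator \<open>c = a t\<close>, so \<open>t\<close> is a
      fraction over \<open>S\<close> unless \<open>a = \<zero>\<close>, and no extension is
      required.\<close>
    obtain t where t: "t \<in> carrier T" "c = t \<otimes> a \<oplus> \<zero>" using S(5) F Nil by auto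
    have ct: "c = a \<otimes> t" using t ac by (simp add: m_comm)
    show ?thesis
    proof (cases "a = \<zero>")
      case True
      then have "c = \<one> \<otimes> a \<oplus> \<zero>" using ct t ring_zero_one by simp
      then have "c \<in> lin_span S F" unfolding F Nil by (rule lin_spanI) (use s in auto)
      then show ?thesis using S by blast
    next
      case False
      then have "t \<in> S" using g(3)[OF ac(1) t(1) False] ct S(4) by simp
      then have "c \<in> lin_span S F" unfolding F Nil using t(2) by (intro lin_spanI) (use s in auto)
      then show ?thesis using S by blast
    qed
  next
    case (Cons b G)
    \<comment> \<open>The two generators enter asymmetrically: \<open>a'\<close> has to avoid
      \<open>C\<close>, while \<open>b'\<close> only has to lie in \<open>S\<close>. Below the step
      is applied in either order.\<close>
    have step: "\<exists>S'. good S' \<and> S \<subseteq> S' \<and> |S'| \<le>o |Y| \<and> c \<in> lin_span S' (a # b # G)"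
      if F: "length (a # G) = n" "set (a # b # G) \<subseteq> S" "c \<in> lin_span (carrier T) (a # b # G)"
        and ab: "a = p [^] (k::nat) \<otimes> a'" "b = p [^] k \<otimes> b'" "a' \<in> S" "b' \<in> S" "\<And>Q. Q \<in> C \<Longrightarrow> a' \<notin> Q"
      for a b k a' b'
    proof -
      have ac: "a \<in> carrier T" "b \<in> carrier T" "a' \<in> carrier T" "b' \<in> carrier T" "set G \<subseteq> carrier T"
        "p [^] k \<in> carrier T" "c \<in> carrier T"
        using F(2) ab(3,4) s(1) p_carrier S(4) by (simp_all add: subset_iff)
      obtain t1 w1 where w1: "t1 \<in> carrier T" "w1 \<in> lin_span (carrier T) (b # G)" "c = t1 \<otimes> a \<oplus> w1"
        using F(3) by auto
      obtain t2 w where w: "t2 \<in> carrier T" "w \<in> lin_span (carrier T) G" "w1 = t2 \<otimes> b \<oplus> w"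
        using w1(2) by auto
      have wc: "w \<in> carrier T" using w(2) idealD(1)[OF lin_span_carrier(1)[OF ac(5)]] by simp
      obtain S1 t where S1: "good S1" "S \<subseteq> S1" "|S1| \<le>o |Y|" and t: "t \<in> carrier T" "t2 \<oplus> a' \<otimes> t \<in> S1"
        using good_adjoin[OF Y S(1,2) w(1) ac(3) ab(5)] .
      note s1 = subringD[OF goodD(1)[OF S1(1)]]
      define x where "x = t2 \<oplus> a' \<otimes> t"
      have xc: "x \<in> carrier T" "x \<in> S1" using w t ac by (auto simp: x_def)
      define c' where "c' = c \<ominus> x \<otimes> b"
      have bS: "b \<in> S1" using F(2) S1(2) by auto
      have c'S: "c' \<in> S1" unfolding c'_def using S(4) S1(2) xc bS s1 by auto
      have "c' = (t1 \<ominus> b' \<otimes> t) \<otimes> a \<oplus> w"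
      proof -
        \<comment> \<open>Both products are \<open>p^k a' b'\<close>. Hence the summand
          \<open>a' t b\<close> that arises when \<open>x\<close> replaces \<open>t2\<close> can be
          charged to the generator \<open>a\<close>.\<close>
        have "a' \<otimes> b = b' \<otimes> a" unfolding ab(1,2) using ac by (simp add: m_ac)
        then have e: "(a' \<otimes> t) \<otimes> b = (b' \<otimes> t) \<otimes> a" using ac t by (metis m_assoc m_comm)
        have "c' = t1 \<otimes> a \<oplus> w \<ominus> (a' \<otimes> t) \<otimes> b" unfolding c'_def w1(3) w(3) x_def
          using ac(1-4) w(1) w1(1) t(1) wc by algebra
        then show ?thesis unfolding e using ac(1-4) w(1) w1(1) t(1) wc by algebra
      qed
      then have "c' \<in> lin_span (carrier T) (a # G)"
        by (rule lin_spanI) (use w1 w ac t in auto)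
      moreover have "set (a # G) \<subseteq> S1" using F(2) S1(2) by auto
      \<comment> \<open>\<open>b\<close> has been split off with a coefficient in \<open>S1\<close>,
        so one generator fewer is left for the induction.\<close>
      ultimately obtain S2 where S2: "good S2" "S1 \<subseteq> S2" "|S2| \<le>o |Y|" "c' \<in> lin_span S2 (a # G)"
        using IH[of "a # G" S1 c'] F(1) S1 c'S by auto
      have G2: "set (b # a # G) \<subseteq> S2" using F(2) S1(2) S2(2) by auto
      have "c = x \<otimes> b \<oplus> c'" unfolding c'_def using ac xc by algebra
      then have "c \<in> lin_span S2 (b # a # G)"
        by (rule lin_spanI) (use xc S2 in auto)
      then have "c \<in> lin_span S2 (a # b # G)" unfolding lin_span_swap[OF G2 goodD(1)[OF S2(1)]] .
      then show ?thesis using S2 S1(2) by (meson subset_trans)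
    qed
    have F': "F = a # b # G" using F Cons by simp
    have len: "length (a # G) = n" "length (b # G) = n" using Suc(2) F' by auto
    have FS: "set (a # b # G) \<subseteq> S" "set (b # a # G) \<subseteq> S" "a \<in> S" "b \<in> S" using S(3) F' by auto
    have Fc: "set (a # b # G) \<subseteq> carrier T" using FS s by auto
    have cF: "c \<in> lin_span (carrier T) (a # b # G)" using S(5) unfolding F' .
    note cF = cF cF[unfolded lin_span_swap[OF Fc carrier_is_subring]]
    have swap: "lin_span S' (b # a # G) = lin_span S' (a # b # G)" if "good S'" "S \<subseteq> S'" for S'
      by (rule lin_span_swap[OF _ goodD(1)[OF that(1)]]) (use FS that(2) in auto)
    have zero: "\<zero> = p [^] (k::nat) \<otimes> \<zero>" for k using p_carrier by simp
    show ?thesis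
    proof (cases "a = \<zero>")
      case a0: True
      show ?thesis
      proof (cases "b = \<zero>")
        case True
        have "lin_span (carrier T) (a # b # G) \<subseteq> lin_span (carrier T) (b # G)"
          unfolding a0 using idealD(1)[OF lin_span_carrier(1), of "b # G"] Fc by (fastforce simp del: lin_span.simps(2) simp: lin_span.simps(2)[of _ \<zero>])
        then have "c \<in> lin_span (carrier T) (b # G)" using cF by blast
        then obtain S' where S': "good S'" "S \<subseteq> S'" "|S'| \<le>o |Y|" "c \<in> lin_span S' (b # G)"
          using IH[of "b # G" S c] len S FS by auto
        then have "c \<in> lin_span S' (a # b # G)"
          using lin_span_zero_cons[of a "b # G" S'] goodD(1)[OF S'(1)] FS by auto
        then show ?thesis using S' F' by blast
      next
        case False
        obtain k b' where k: "b = p [^] (k::nat) \<otimes> b'" "b' \<in> S" "\<forall>Q\<in>C. b' \<notin> Q"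
          using saturated_factor[OF good_saturated[OF S(1)] FS(4) False] .
        show ?thesis using step[OF len(2) FS(2) cF(2) k(1) zero[of k, folded a0] k(2) _ k(3)[rule_format]] s(2) a0 swap F' by blast
      qed
    next
      case a0: False
      obtain k a' where k: "a = p [^] (k::nat) \<otimes> a'" "a' \<in> S" "\<forall>Q\<in>C. a' \<notin> Q"
        using saturated_factor[OF good_saturated[OF S(1)] FS(3) a0] .
      show ?thesis
      proof (cases "b = \<zero>")
        case True
        show ?thesis using step[OF len(1) FS(1) cF(1) k(1) zero[of k, folded True] k(2) _ k(3)[rule_format]] s(2) True F' by blast
      next
        case False
        obtain l b' where l: "b = p [^] (l::nat) \<otimes> b'" "b' \<in> S" "\<forall>Q\<in>C. b' \<notin> Q"
          using saturated_factor[OF good_saturated[OF S(1)] FS(4) False] .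
        have pp: "p [^] j \<otimes> y = p [^] i \<otimes> (p [^] (j - i) \<otimes> y)" "p [^] (j - i) \<otimes> y \<in> S"
          if "i \<le> j" "y \<in> S" for i j :: nat and y
        proof -
          have "y \<in> carrier T" using that s by auto
          then show "p [^] j \<otimes> y = p [^] i \<otimes> (p [^] (j - i) \<otimes> y)"
            using nat_pow_mult[OF p_carrier, of i "j - i"] p_carrier that by (simp add: m_assoc[symmetric])
          show "p [^] (j - i) \<otimes> y \<in> S" using s g(2) that by auto
        qed
        show ?thesis
        \<comment> \<open>The generator with the smaller exponent takes the part of
          \<open>a\<close>; dividing the other one by the same power of \<open>p\<close> then leaves
          a quotient in \<open>S\<close>.\<close>
        proof (cases "k \<le> l")
          case True
          show ?thesis
            using step[OF len(1) FS(1) cF(1) k(1) _ k(2) pp(2)[OF True l(2)] k(3)[rule_format]] pp(1)[OF True l(2)] l(1) F' by metis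
        next
          case False
          then have lk: "l \<le> k" by simp
          show ?thesis
            using step[OF len(2) FS(2) cF(2) l(1) _ l(2) pp(2)[OF lk k(2)] l(3)[rule_format]] pp(1)[OF lk k(2)] k(1) swap F' by metis
        qed
      qed
    qed
  qed
qed

text \<open>It is enough to adjoin denominators that are powers of \<open>p\<close>: the ring
  \<open>T \<inter> \<Pi>[p][1/p]\<close> is saturated, and \<open>fraction_closure\<close> makes it
  good.\<close>

lemma good_initial:
  assumes "infinite Y" shows "\<exists>S. good S \<and> |S| \<le>o |Y|"
proof -
  note P = prime_subring_adjoin_subring[OF p_carrier]
  note s = subringD[OF P(1)]
  define S where "S = {t \<in> carrier T. \<exists>n::nat. p [^] n \<otimes> t \<in> \<Pi>p}"
  have pS: "p [^] (n::nat) \<in> \<Pi>p" for n using s P(2) by simp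
  note pc = p_power_closed
  have up: "p [^] (n + m) \<otimes> t \<in> \<Pi>p" if "t \<in> carrier T" "p [^] n \<otimes> t \<in> \<Pi>p" for n m :: nat and t
  proof -
    have "p [^] (n + m) \<otimes> t = p [^] m \<otimes> (p [^] n \<otimes> t)"
      using that(1) pc nat_pow_mult[OF p_carrier, of m n] by (simp add: m_assoc[symmetric] add.commute)
    then show ?thesis using s(7)[OF pS that(2)] by simp
  qed
  have two: "\<exists>n::nat. p [^] n \<otimes> t \<in> \<Pi>p \<and> p [^] n \<otimes> u \<in> \<Pi>p" if tu: "t \<in> S" "u \<in> S" for t u
  proof -
    obtain n m :: nat where "t \<in> carrier T" "u \<in> carrier T" "p [^] n \<otimes> t \<in> \<Pi>p" "p [^] m \<otimes> u \<in> \<Pi>p"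
      using tu by (auto simp: S_def)
    then have "p [^] (n + m) \<otimes> t \<in> \<Pi>p \<and> p [^] (m + n) \<otimes> u \<in> \<Pi>p" using up by blast
    then show ?thesis by (auto simp: add.commute)
  qed
  have sub: "\<Pi>p \<subseteq> S"
  proof
    fix x assume x: "x \<in> \<Pi>p"
    then have "p [^] (0::nat) \<otimes> x \<in> \<Pi>p" using s by simp
    then show "x \<in> S" unfolding S_def using x s(1) by blast
  qed
  have "saturated S" unfolding saturated_def
  proof (intro conjI ballI impI subsetI)
    show "subring S T"
    proof (rule subringI)
      show "S \<subseteq> carrier T" by (auto simp: S_def)
      show "\<one> \<in> S" using sub s by auto
      fix h assume h: "h \<in> S"
      then obtain n :: nat where "h \<in> carrier T" "p [^] n \<otimes> h \<in> \<Pi>p" by (auto simp: S_def)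
      then have "h \<in> carrier T" "p [^] n \<otimes> (\<ominus> h) \<in> \<Pi>p" using s(4) pc by (auto simp: r_minus)
      then show "\<ominus> h \<in> S" by (auto simp: S_def)
      fix g assume "g \<in> S"
      then obtain n :: nat where n: "p [^] n \<otimes> h \<in> \<Pi>p" "p [^] n \<otimes> g \<in> \<Pi>p" using two[OF h] by blast
      have c: "h \<in> carrier T" "g \<in> carrier T" using h \<open>g \<in> S\<close> by (auto simp: S_def)
      have "p [^] n \<otimes> (h \<oplus> g) \<in> \<Pi>p" using n s(5) c pc by (simp add: r_distr)
      then show "h \<oplus> g \<in> S" using c unfolding S_def by blast
      have "p [^] (n + n) \<otimes> (h \<otimes> g) = (p [^] n \<otimes> h) \<otimes> (p [^] n \<otimes> g)"
        using c pc[of n] by (simp add: nat_pow_mult[OF p_carrier, symmetric] m_ac)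
      then have "p [^] (n + n) \<otimes> (h \<otimes> g) \<in> \<Pi>p" using n s(7) by simp
      then show "h \<otimes> g \<in> S" using c unfolding S_def by blast
    qed
    show "p \<in> S" using sub P by auto
    fix t assume t: "t \<in> carrier T" "p \<otimes> t \<in> S"
    then obtain n :: nat where "p [^] n \<otimes> (p \<otimes> t) \<in> \<Pi>p" by (auto simp: S_def)
    then have "p [^] Suc n \<otimes> t \<in> \<Pi>p" using t p_carrier by (simp add: m_assoc)
    then show "t \<in> S" using t unfolding S_def by blast
  next
    fix Q t assume Q: "Q \<in> C" and t: "t \<in> S \<inter> Q"
    show "t \<in> pT"
    proof (rule ccontr)
      assume nt: "t \<notin> pT"
      obtain n :: nat where n: "p [^] n \<otimes> t \<in> \<Pi>p" "t \<in> carrier T" using t by (auto simp: S_def)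
      then have e: "t \<otimes> p [^] n = p [^] n \<otimes> t" using pc by (simp add: m_comm)
      \<comment> \<open>This is a product of the kind that condition (iii) forbids in
        \<open>\<Pi>p\<close> unless it is zero; regularity of \<open>p\<close> then gives
        \<open>t = 0\<close>, which lies in \<open>pT\<close>.\<close>
      have "t \<otimes> p [^] n \<in> (Q - pT) <#>\<^bsub>T\<^esub> \<Pi>p" using t nt pS by (auto simp: set_mult_def)
      then have "p [^] n \<otimes> t = \<zero>" using cond_prod[OF Q] n e by auto
      then have "t = \<zero>" using p_power_regular n(2) by blast
      then show False using nt idealD(2)[OF pT_ideal] by simp
    qed
  qed
  moreover have "|S| \<le>o |Y|"
  proof -
    have "countable \<Pi>p" unfolding prime_subring_adjoin_def prime_subring_def
      by (intro countable_generate_ring) (simp add: countable_generate_ring)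
    then have "|\<Pi>p| \<le>o |Y|" by (rule card_of_countable_le[OF assms])
    moreover have "|UNIV :: nat set| \<le>o |Y|" by (rule card_of_countable_le[OF assms]) simp
    ultimately have c: "|UNIV \<times> \<Pi>p :: (nat \<times> 'a) set| \<le>o |Y|" by (intro card_of_Times_le[OF assms])
    have "\<forall>t\<in>S. \<exists>n::nat. p [^] n \<otimes> t \<in> \<Pi>p" by (auto simp: S_def)
    then obtain n :: "'a \<Rightarrow> nat" where n: "\<And>t. t \<in> S \<Longrightarrow> p [^] n t \<otimes> t \<in> \<Pi>p" by metis
    have "inj_on (\<lambda>t. (n t, p [^] n t \<otimes> t)) S"
      by (rule inj_onI) (use p_power_cancel in \<open>auto simp: S_def\<close>)
    moreover have "(\<lambda>t. (n t, p [^] n t \<otimes> t)) ` S \<subseteq> UNIV \<times> \<Pi>p" using n by auto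
    ultimately have "|S| \<le>o |UNIV \<times> \<Pi>p :: (nat \<times> 'a) set|"
      using card_of_ordLeqI[of "\<lambda>t. (n t, p [^] n t \<otimes> t)" S "UNIV \<times> \<Pi>p"] by auto
    then show ?thesis using c ordLeq_transitive by blast
  qed
  ultimately show ?thesis using fraction_closure(1)[of S] fraction_closure(3)[of S Y] assms by blast
qed

end

section \<open>Transfinite construction\<close>

text \<open>Each requirement \<open>w\<close> becomes applicable once the finite set \<open>supp w\<close> has been captured.
  The recursion runs along the initial well-order of \<open>U\<close>; the bookkeeping function \<open>b\<close> takes
  every value \<open>w\<close> at arbitrarily late stages, so that no requirement is missed.\<close>

lemma transfinite_closure:
  fixes U :: "'a set" and W :: "'w set" and good :: "'a set \<Rightarrow> bool"
  assumes unc: "|UNIV :: nat set| <o |U|"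
    and init: "good S0" "|S0| \<le>o |UNIV :: nat set|"
    and chain: "\<And>\<C>. \<C> \<noteq> {} \<Longrightarrow> (\<And>S. S \<in> \<C> \<Longrightarrow> good S) \<Longrightarrow>
      (\<And>S S'. S \<in> \<C> \<Longrightarrow> S' \<in> \<C> \<Longrightarrow> S \<subseteq> S' \<or> S' \<subseteq> S) \<Longrightarrow> good (\<Union>\<C>)"
    and W: "|W| \<le>o |U|"
    and fin: "\<And>w. w \<in> W \<Longrightarrow> finite (supp w)"
    and step: "\<And>w S (Y :: (nat + 'a) set). good S \<Longrightarrow> |S| \<le>o |Y| \<Longrightarrow> infinite Y \<Longrightarrow> |Y| <o |U| \<Longrightarrow>
      w \<in> W \<Longrightarrow> supp w \<subseteq> S \<Longrightarrow> \<exists>S'. good S' \<and> S \<subseteq> S' \<and> |S'| \<le>o |Y| \<and> met w S'"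
    and mono: "\<And>w S S'. met w S \<Longrightarrow> S \<subseteq> S' \<Longrightarrow> met w S'"
  shows "\<exists>A. good A \<and> (\<forall>w\<in>W. supp w \<subseteq> A \<longrightarrow> met w A)"
proof -
  define r where "r = |U|"
  have card: "Card_order r" and field: "Field r = U"
    unfolding r_def by (rule card_of_Card_order, rule Field_card_of)
  have Well: "Well_order r" using card unfolding card_order_on_def by blast
  have wf: "wf (r - Id)" using Well by (simp add: well_order_on_def)
  have trans: "trans r" using Well by (simp add: well_order_on_def linear_order_on_def partial_order_on_def preorder_on_def)
  have antisym: "antisym r" using Well by (simp add: well_order_on_def linear_order_on_def partial_order_on_def)
  have total: "(x, y) \<in> r \<or> (y, x) \<in> r \<or> x = y" if "x \<in> U" "y \<in> U" for x y
    using Well that field by (auto simp: well_order_on_def linear_order_on_def total_on_def)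
  have inf: "infinite U" using unc by (meson infinite_iff_card_of_nat ordLess_imp_ordLeq)
  have "|W \<times> U| \<le>o |U|" by (rule card_of_Times_le[OF inf W]) simp
  then obtain h where h: "inj_on h (W \<times> U)" "h ` (W \<times> U) \<subseteq> U" using card_of_ordLeq[of "W \<times> U" U] by auto
  define b where "b i = fst (inv_into (W \<times> U) h i)" for i
  \<comment> \<open>\<open>h\<close> reserves \<open>|U|\<close> many stages for \<open>w\<close>.
    Were none of them after \<open>j\<close>, they would all lie strictly below some
    \<open>k\<close> beyond \<open>j\<close>, and that initial segment has fewer than
    \<open>|U|\<close> elements.\<close>
  have late: "\<exists>i\<in>U. (j, i) \<in> r \<and> j \<noteq> i \<and> b i = w" if w: "w \<in> W" and j: "j \<in> U" for w j
  proof (rule ccontr)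
    assume neg: "\<not> ?thesis"
    obtain k where k: "k \<in> U" "j \<noteq> k" "(j, k) \<in> r"
      using infinite_Card_order_limit[OF card _ , of j] field inf j by auto
    have "h (w, u) \<in> underS r k" if u: "u \<in> U" for u
    proof -
      let ?a = "h (w, u)"
      have a: "?a \<in> U" using h(2) w u by auto
      have "b ?a = w" unfolding b_def using inv_into_f_f[OF h(1), of "(w, u)"] w u by simp
      then have "(?a, j) \<in> r \<or> ?a = j" using neg total[OF j a] a by blast
      then have "(?a, k) \<in> r" using k trans by (auto elim: transE)
      moreover have "?a \<noteq> k" using \<open>(?a, j) \<in> r \<or> ?a = j\<close> k antisymD[OF antisym, of j ?a] by auto
      ultimately show ?thesis by (simp add: underS_def)
    qed
    then have "(\<lambda>u. h (w, u)) ` U \<subseteq> underS r k" by auto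
    moreover have "inj_on (\<lambda>u. h (w, u)) U" using h(1) w by (auto simp: inj_on_def)
    ultimately have "|U| \<le>o |underS r k|" using card_of_ordLeq by blast
    moreover have "|underS r k| <o |U|" using card_of_underS[OF card, of k] field k by (simp add: r_def)
    ultimately show False using not_ordLess_ordLeq by blast
  qed
  \<comment> \<open>The size allowed at stage \<open>i\<close>. The predecessors bound the union of
    the earlier stages; the natural numbers keep the bound infinite at the first stages, and by
    uncountability the sum is still smaller than \<open>|U|\<close>.\<close>
  define Y where "Y i = (UNIV :: nat set) <+> underS r i" for i
  have Y_inf: "infinite (Y i)" for i by (simp add: Y_def)
  have Y_nat: "|UNIV :: nat set| \<le>o |Y i|" for i unfolding Y_def by (rule card_of_Plus1)
  have Y_less: "|Y i| <o |U|" if "i \<in> U" for i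
    unfolding Y_def
    by (rule card_of_Plus_ordLess_infinite[OF inf unc]) (use card_of_underS[OF card, of i] field that in \<open>simp add: r_def\<close>)
  have under_mono: "underS r j \<subseteq> underS r i" if "j \<in> underS r i" for i j
  proof
    fix k assume "k \<in> underS r j"
    then show "k \<in> underS r i" using that transD[OF trans, of k j i] antisymD[OF antisym, of j i]
      by (auto simp: underS_def)
  qed
  have Y_mono: "|Y j| \<le>o |Y i|" if "j \<in> underS r i" for i j
    by (rule card_of_mono1) (use under_mono[OF that] in \<open>auto simp: Y_def\<close>)
  define P where "P i S S' \<longleftrightarrow> good S' \<and> S \<subseteq> S' \<and> |S'| \<le>o |Y i| \<and>
      (b i \<in> W \<and> supp (b i) \<subseteq> S \<longrightarrow> met (b i) S')" for i S S'
  \<comment> \<open>Each stage starts from the union of \<open>S0\<close> and all earlier stages, so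
    successor and limit stages need no separate treatment.\<close>
  define f where "f = wfrec (r - Id) (\<lambda>f i. SOME S'. P i (S0 \<union> \<Union>(f ` underS r i)) S')"
  define prev where "prev i = S0 \<union> \<Union>(f ` underS r i)" for i
  have f: "f i = (SOME S'. P i (prev i) S')" for i
  proof -
    have "cut f (r - Id) i ` underS r i = f ` underS r i"
      by (rule image_cong) (auto simp: cut_def underS_def)
    then show ?thesis unfolding prev_def using wfrec[OF wf, of "\<lambda>f i. SOME S'. P i (S0 \<union> \<Union>(f ` underS r i)) S'" i]
      unfolding f_def[symmetric] by simp
  qed
  have main: "i \<in> U \<longrightarrow> P i (prev i) (f i)" for i
  proof (rule wf_induct[OF wf, where P = "\<lambda>i. i \<in> U \<longrightarrow> P i (prev i) (f i)"], rule impI)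
    fix i assume ih: "\<forall>j. (j, i) \<in> r - Id \<longrightarrow> j \<in> U \<longrightarrow> P j (prev j) (f j)" and i: "i \<in> U"
    have IH: "P j (prev j) (f j)" and jU: "j \<in> U" if "j \<in> underS r i" for j
      using that ih field by (auto simp: underS_def Field_def)
    have le: "f j \<subseteq> f k" if "j \<in> underS r k" "k \<in> underS r i" for j k
      using IH[OF that(2)] that(1) by (auto simp: P_def prev_def)
    have "prev i = \<Union>(insert S0 (f ` underS r i))" by (simp add: prev_def)
    moreover have "good (\<Union>(insert S0 (f ` underS r i)))"
    proof (rule chain)
      show "good S" if "S \<in> insert S0 (f ` underS r i)" for S using that init IH by (auto simp: P_def)
      have "S0 \<subseteq> f j" if "j \<in> underS r i" for j using IH[OF that] by (auto simp: P_def prev_def)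
      moreover have "f j \<subseteq> f k \<or> f k \<subseteq> f j" if "j \<in> underS r i" "k \<in> underS r i" for j k
      proof (cases "j = k")
        case False
        then have "j \<in> underS r k \<or> k \<in> underS r j"
          using total[OF jU[OF that(1)] jU[OF that(2)]] by (auto simp: underS_def)
        then show ?thesis using le[OF _ that(1)] le[OF _ that(2)] by metis
      qed simp
      ultimately show "S \<subseteq> S' \<or> S' \<subseteq> S"
        if "S \<in> insert S0 (f ` underS r i)" "S' \<in> insert S0 (f ` underS r i)" for S S'
        using that by (elim insertE imageE) simp_all
    qed simp
    ultimately have good: "good (prev i)" by simp
    have "|\<Union>j\<in>underS r i. f j| \<le>o |Y i|"
    proof (rule card_of_UNION_ordLeq_infinite[OF Y_inf])
      show "|underS r i| \<le>o |Y i|" unfolding Y_def by (rule card_of_Plus2)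
      show "\<forall>j\<in>underS r i. |f j| \<le>o |Y i|"
        using IH Y_mono unfolding P_def by (blast intro: ordLeq_transitive)
    qed
    then have small: "|prev i| \<le>o |Y i|" unfolding prev_def
      by (intro card_of_Un_ordLeq_infinite_Field)
        (use Y_inf[of i] init(2) Y_nat[of i] ordLeq_transitive in \<open>auto simp: Field_card_of card_of_Card_order\<close>)
    have "\<exists>S'. P i (prev i) S'"
    proof (cases "b i \<in> W \<and> supp (b i) \<subseteq> prev i")
      case True
      then show ?thesis using step[OF good small Y_inf Y_less[OF i], of "b i"] by (auto simp: P_def)
    next
      case False
      then show ?thesis using good small unfolding P_def by blast
    qed
    then show "P i (prev i) (f i)" unfolding f by (rule someI_ex)
  qed
  have le: "f j \<subseteq> prev i" if "j \<in> underS r i" for i j using that by (auto simp: prev_def)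
  have P: "P i (prev i) (f i)" if "i \<in> U" for i using main that by blast
  have ne: "U \<noteq> {}" using inf by auto
  have ch: "f j \<subseteq> f k \<or> f k \<subseteq> f j" if "j \<in> U" "k \<in> U" for j k
  proof (cases "j = k")
    case False
    then have "j \<in> underS r k \<or> k \<in> underS r j" using total[OF that] by (auto simp: underS_def)
    then show ?thesis using le P[OF that(1)] P[OF that(2)] unfolding P_def by blast
  qed simp
  have "good (\<Union>(f ` U))"
  proof (rule chain)
    show "f ` U \<noteq> {}" using ne by simp
    show "good S" if "S \<in> f ` U" for S using that P by (auto simp: P_def)
    show "S \<subseteq> S' \<or> S' \<subseteq> S" if "S \<in> f ` U" "S' \<in> f ` U" for S S'
      using that ch by (elim imageE) simp
  qed
  moreover have "met w (\<Union>(f ` U))" if w: "w \<in> W" "supp w \<subseteq> \<Union>(f ` U)" for w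
  proof -
    \<comment> \<open>A finite support captured by the union of the chain is captured by a single
      stage \<open>j\<close>; the requirement is then met at a later stage at which the bookkeeping
      returns to it.\<close>
    have "subset.chain UNIV (f ` U)" unfolding subset_chain_def using ch by auto
    then obtain S where "S \<in> f ` U" "supp w \<subseteq> S"
      using finite_subset_Union_chain[OF fin[OF w(1)] w(2)] ne by (metis image_is_empty)
    then obtain j where j: "j \<in> U" "supp w \<subseteq> f j" by auto
    obtain i where i: "i \<in> U" "(j, i) \<in> r" "j \<noteq> i" "b i = w" using late[OF w(1) j(1)] by auto
    then have "supp w \<subseteq> prev i" using le[of j i] j by (auto simp: underS_def)
    then have "met w (f i)" using P[OF i(1)] i(4) w(1) by (auto simp: P_def)
    then show ?thesis using mono i(1) by blast
  qed
  ultimately show ?thesis by blast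
qed

text \<open>A maximal span of a finite list from \<open>I\<close> absorbs every element of
  \<open>I\<close>. Taking the generators from \<open>I\<close> itself, not from the ideal it
  generates in \<open>T\<close>, lets the same list serve over a subring that contains
  \<open>I\<close>.\<close>

lemma (in complete_local_ring) finite_generators:
  assumes "I \<subseteq> carrier T"
  obtains F where "set F \<subseteq> I" "I \<subseteq> lin_span (carrier T) F"
proof -
  define \<F> where "\<F> = {lin_span (carrier T) F | F. set F \<subseteq> I}"
  have c: "set F \<subseteq> carrier T" if "set F \<subseteq> I" for F using that assms by auto
  have "lin_span (carrier T) [] \<in> \<F>" unfolding \<F>_def by (rule CollectI, rule exI[of _ "[]"]) simp
  then obtain N where N: "N \<in> \<F>" "\<And>N'. N' \<in> \<F> \<Longrightarrow> N \<subseteq> N' \<Longrightarrow> N' = N"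
    by (rule ideals_maximalE) (use lin_span_carrier(1) c in \<open>auto simp: \<F>_def\<close>)
  then obtain F where F: "set F \<subseteq> I" "N = lin_span (carrier T) F" by (auto simp: \<F>_def)
  have "x \<in> N" if x: "x \<in> I" for x
  proof -
    have "set (x # F) \<subseteq> I" using F x by simp
    then have "lin_span (carrier T) (x # F) \<in> \<F>" unfolding \<F>_def by blast
    moreover have G: "set (x # F) \<subseteq> lin_span (carrier T) (x # F)"
      by (rule lin_span_mem[OF carrier_is_subring]) (rule c, fact)
    have "lin_span (carrier T) F \<subseteq> lin_span (carrier T) (x # F)"
      using lin_span_le[OF carrier_is_subring c[OF F(1)], of "lin_span (carrier T) (x # F)"]
        lin_span_carrier(1)[OF c[OF \<open>set (x # F) \<subseteq> I\<close>]] G by (simp del: lin_span.simps)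
    ultimately show "x \<in> N" using N(2) F(2) G by (metis list.set_intros(1) subsetD)
  qed
  then show thesis using that F by blast
qed

section \<open>Existence of the local domain and verification of its properties\<close>

context sufficient_conditions begin

lemma good_chain:
  assumes "\<C> \<noteq> {}" "\<And>S. S \<in> \<C> \<Longrightarrow> good S" "\<And>S S'. S \<in> \<C> \<Longrightarrow> S' \<in> \<C> \<Longrightarrow> S \<subseteq> S' \<or> S' \<subseteq> S"
  shows "good (\<Union>\<C>)"
proof -
  have two: "\<exists>S\<in>\<C>. x \<in> S \<and> y \<in> S" if "x \<in> \<Union>\<C>" "y \<in> \<Union>\<C>" for x y
    using that assms(3) by blast
  have s: "subring S T" if "S \<in> \<C>" for S using goodD(1)[OF assms(2)[OF that]] .
  obtain S0 where S0: "S0 \<in> \<C>" using assms(1) by blast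
  show ?thesis unfolding good_def
  proof (intro conjI ballI impI subsetI)
    show "subring (\<Union>\<C>) T"
    proof (rule subringI)
      show "\<Union>\<C> \<subseteq> carrier T" using subringD(1)[OF s] by blast
      show "\<one> \<in> \<Union>\<C>" using subringD(3)[OF s[OF S0]] S0 by blast
      show "\<ominus> x \<in> \<Union>\<C>" if "x \<in> \<Union>\<C>" for x using that subringD(4)[OF s] by blast
      show "x \<otimes> y \<in> \<Union>\<C>" if xy: "x \<in> \<Union>\<C>" "y \<in> \<Union>\<C>" for x y
        using two[OF xy] subringD(7)[OF s] by blast
      show "x \<oplus> y \<in> \<Union>\<C>" if xy: "x \<in> \<Union>\<C>" "y \<in> \<Union>\<C>" for x y
        using two[OF xy] subringD(5)[OF s] by blast
    qed
    show "p \<in> \<Union>\<C>" using goodD(2)[OF assms(2)[OF S0]] S0 by blast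
    fix r t assume r: "r \<in> \<Union>\<C>" and t: "t \<in> carrier T" "r \<noteq> \<zero>" "r \<otimes> t \<in> \<Union>\<C>"
    obtain S where "S \<in> \<C>" "r \<in> S" "r \<otimes> t \<in> S" using two[OF r t(3)] by blast
    then show "t \<in> \<Union>\<C>" using goodD(3)[OF assms(2), of S r t] t by blast
  next
    fix Q x assume "Q \<in> C" "x \<in> \<Union>\<C> \<inter> Q"
    then show "x \<in> pT" using goodD(4)[OF assms(2)] by blast
  qed
qed

lemma exists_good_dense_subring:
  obtains A where "good A"
    "\<And>u y. u \<in> carrier T \<Longrightarrow> y \<in> carrier T \<Longrightarrow> (\<And>Q. Q \<in> C \<Longrightarrow> y \<notin> Q) \<Longrightarrow> \<exists>t\<in>carrier T. u \<oplus> y \<otimes> t \<in> A"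
    "\<And>F c. set F \<subseteq> A \<Longrightarrow> c \<in> A \<Longrightarrow> c \<in> lin_span (carrier T) F \<Longrightarrow> c \<in> lin_span A F"
proof -
  have inf: "infinite (carrier T)" using uncountable_carrier by (meson infinite_iff_card_of_nat ordLess_imp_ordLeq)
  \<comment> \<open>A flag and a list encode both kinds of requirement, so that there are at most
    \<open>|carrier T|\<close> of them. Meeting a coset can be asked at any stage; moving
    coefficients has to wait until \<open>c\<close> and the generators are in the ring.\<close>
  define W where "W = {(True, [u, y]) | u y. u \<in> carrier T \<and> y \<in> carrier T \<and> (\<forall>Q\<in>C. y \<notin> Q)} \<union>
    {(False, c # F) | c F. c \<in> lin_span (carrier T) F \<and> c \<in> carrier T \<and> set F \<subseteq> carrier T}"
  define supp where "supp w = (if fst w then {} else set (snd w))" for w :: "bool \<times> 'a list"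
  define met where "met w A \<longleftrightarrow> (if fst w then \<exists>t\<in>carrier T. (snd w ! 0) \<oplus> (snd w ! 1) \<otimes> t \<in> A
    else hd (snd w) \<in> lin_span A (tl (snd w)))" for w :: "bool \<times> 'a list" and A
  obtain S0 where S0: "good S0" "|S0| \<le>o |UNIV :: nat set|" using good_initial[of "UNIV :: nat set"] by auto
  have "\<exists>A. good A \<and> (\<forall>w\<in>W. supp w \<subseteq> A \<longrightarrow> met w A)"
  proof (rule transfinite_closure[where good = good, OF uncountable_carrier S0])
    show "good (\<Union>\<C>)" if "\<C> \<noteq> {}" "\<And>S. S \<in> \<C> \<Longrightarrow> good S"
      "\<And>S S'. S \<in> \<C> \<Longrightarrow> S' \<in> \<C> \<Longrightarrow> S \<subseteq> S' \<or> S' \<subseteq> S" for \<C>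
      using good_chain that by blast
    have "W \<subseteq> UNIV \<times> lists (carrier T)" by (auto simp: W_def)
    moreover have "|(UNIV :: bool set) \<times> lists (carrier T)| \<le>o |carrier T|"
      by (rule card_of_Times_le[OF inf card_of_finite_le[OF inf] card_of_lists_le[OF inf]]) auto
    ultimately show "|W| \<le>o |carrier T|" using card_of_mono1 ordLeq_transitive by blast
    show "finite (supp w)" for w by (simp add: supp_def)
    show "met w S'" if "met w S" "S \<subseteq> S'" for w S S'
      using that lin_span_mono[OF that(2)] by (auto simp: met_def split: if_splits)
    fix w S and Y :: "(nat + 'a) set"
    assume S: "good S" "|S| \<le>o |Y|" and Y: "infinite Y" "|Y| <o |carrier T|" and w: "w \<in> W" "supp w \<subseteq> S"
    show "\<exists>S'. good S' \<and> S \<subseteq> S' \<and> |S'| \<le>o |Y| \<and> met w S'"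
    proof (cases "fst w")
      case True
      then obtain u y where uy: "w = (True, [u, y])" "u \<in> carrier T" "y \<in> carrier T" "\<And>Q. Q \<in> C \<Longrightarrow> y \<notin> Q"
        using w(1) unfolding W_def by fastforce
      obtain S' t where "good S'" "S \<subseteq> S'" "|S'| \<le>o |Y|" "t \<in> carrier T" "u \<oplus> y \<otimes> t \<in> S'"
        using good_adjoin[OF Y S uy(2-4)] .
      then show ?thesis unfolding met_def uy(1) by auto
    next
      case False
      then obtain c F where cF: "w = (False, c # F)" "c \<in> lin_span (carrier T) F"
        using w(1) unfolding W_def by fastforce
      then have "set F \<subseteq> S" "c \<in> S" using w(2) by (auto simp: supp_def)
      then show ?thesis using good_span[OF Y S _ _ cF(2)] unfolding met_def cF(1) by auto
    qed
  qed
  then obtain A where A: "good A" "\<And>w. w \<in> W \<Longrightarrow> supp w \<subseteq> A \<Longrightarrow> met w A" by blast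
  have Ac: "A \<subseteq> carrier T" using subringD(1)[OF goodD(1)[OF A(1)]] by blast
  have 1: "\<exists>t\<in>carrier T. u \<oplus> y \<otimes> t \<in> A" if "u \<in> carrier T" "y \<in> carrier T" "\<And>Q. Q \<in> C \<Longrightarrow> y \<notin> Q" for u y
    using A(2)[of "(True, [u, y])"] that by (auto simp: W_def supp_def met_def)
  have 2: "c \<in> lin_span A F" if "set F \<subseteq> A" "c \<in> A" "c \<in> lin_span (carrier T) F" for F c
  proof -
    have "(False, c # F) \<in> W" unfolding W_def using that Ac by blast
    then show ?thesis using A(2)[of "(False, c # F)"] that by (simp add: supp_def met_def)
  qed
  show thesis using that[OF A(1)] 1 2 by blast
qed

theorem conditions_sufficient:
  "\<exists>A. subring A T \<and> local_ring (subring_of T A) \<and> domain (subring_of T A) \<and>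
      p \<in> A \<and> completion_eq T \<mm> A \<and>
      primeideal (PIdl\<^bsub>subring_of T A\<^esub> p) (subring_of T A) \<and>
      formal_fiber_maximal T A (PIdl\<^bsub>subring_of T A\<^esub> p) = C"
proof -
  obtain A where good: "good A"
    and dense: "\<And>u y. u \<in> carrier T \<Longrightarrow> y \<in> carrier T \<Longrightarrow> (\<And>Q. Q \<in> C \<Longrightarrow> y \<notin> Q) \<Longrightarrow> \<exists>t\<in>carrier T. u \<oplus> y \<otimes> t \<in> A"
    and span: "\<And>F c. set F \<subseteq> A \<Longrightarrow> c \<in> A \<Longrightarrow> c \<in> lin_span (carrier T) F \<Longrightarrow> c \<in> lin_span A F"
    using exists_good_dense_subring by blast
  note g = goodD[OF good]
  interpret subring_of_complete T \<mm> A
    by (intro subring_of_complete.intro subring_of_complete_axioms.intro complete_local_ring_axioms g(1))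
  have Ac: "A \<subseteq> carrier T" using A(1) by blast
  have one: "\<one> \<noteq> \<zero>" using one_not_max idealD(2)[OF max_ideal] by metis
  \<comment> \<open>The powers of \<open>z\<close> tend to zero yet stay outside every member of
    \<open>C\<close>, so \<open>A\<close> meets every coset of \<open>z^k T\<close> and is
    dense.\<close>
  obtain z where z: "z \<in> \<mm>" "\<And>Q. Q \<in> C \<Longrightarrow> z \<notin> Q" using max_avoids by blast
  have zc: "z \<in> carrier T" using z(1) idealD(1)[OF max_ideal] by auto
  have zk: "z [^] (k::nat) \<notin> Q" if "Q \<in> C" for k Q using primeD(4)[OF C(3)[OF that] zc] z(2)[OF that] by blast
  have approx: "\<exists>t\<in>carrier T. x \<oplus> z [^] (k::nat) \<otimes> t \<in> A" if "x \<in> carrier T" for x k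
    by (rule dense) (use that zc zk in auto)
  \<comment> \<open>The inverse solves \<open>u t = \<one>\<close> with \<open>u\<close> and
    \<open>\<one>\<close> in \<open>A\<close>, so it belongs to
    \<open>T \<inter> Frac A = A\<close>.\<close>
  have unit: "inv u \<in> A" if u: "u \<in> A" "u \<notin> \<mm>" for u
  proof -
    have U: "u \<in> Units T" using unit_iff[of u] u Ac by auto
    have "u \<noteq> \<zero>" using u(2) idealD(2)[OF max_ideal] by auto
    then show ?thesis using g(3)[OF u(1) Units_inv_closed[OF U]] Units_r_inv[OF U] A(3) by simp
  qed
  have proper: "J \<subseteq> \<mm>" if J: "ideal J S" "J \<noteq> A" for J
  proof
    fix u assume u: "u \<in> J"
    show "u \<in> \<mm>"
    proof (rule ccontr)
      assume um: "u \<notin> \<mm>"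
      have uA: "u \<in> A" using subring_idealD(1)[OF subring J(1) u] .
      have "u \<otimes> inv u \<in> J" using subring_idealD(6)[OF subring J(1) u unit[OF uA um]] .
      then have "\<one> \<in> J" using unit_iff[of u] um uA Ac by auto
      then have "J = A" using ideal.one_imp_carrier[OF J(1)] by simp
      then show False using J(2) by simp
    qed
  qed
  have maxM: "maximalideal M S"
  proof (rule maximalidealI[OF M_ideal])
    show "carrier S \<noteq> M" using one_not_max A(3) by auto
    fix J assume J: "ideal J S" "M \<subseteq> J" "J \<subseteq> carrier S"
    then show "J = M \<or> J = carrier S" using proper[OF J(1)] by auto
  qed
  have "\<exists>!N. maximalideal N S"
  proof (rule ex1I[where a = M])
    show "maximalideal M S" by (rule maxM)
    fix N assume N: "maximalideal N S"
    interpret N: maximalideal N S by (rule N)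
    have "N \<noteq> A" using N.I_notcarr by simp
    then have "N \<subseteq> M" using proper[OF N.is_ideal] subring_idealD(1)[OF subring N.is_ideal] by blast
    then show "N = M" using N.I_maximal[OF M_ideal] one_not_max A(3) by auto
  qed
  then have quasi: "quasilocal_ring S"
    by (simp add: quasilocal_ring_def quasilocal_ring_axioms_def S.is_cring)
  have noeth: "noetherian_ring S"
  proof (rule S.noetherian_ringI)
    fix I assume I: "ideal I S"
    have IA: "I \<subseteq> A" using subring_idealD(1)[OF subring I] by blast
    \<comment> \<open>A finite list from \<open>I\<close> that spans \<open>I\<close> over
      \<open>T\<close> spans it over \<open>A\<close> as well, because the coefficients can be moved
      into \<open>A\<close>.\<close>
    obtain F where F: "set F \<subseteq> I" "I \<subseteq> lin_span (carrier T) F" using finite_generators[of I] IA Ac by blast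
    have FA: "set F \<subseteq> A" using F(1) IA by blast
    have "I \<subseteq> lin_span A F" using span[OF FA] F(2) IA by blast
    then have "I = Idl\<^bsub>S\<^esub> (set F)"
      using lin_span_le[OF subring FA I F(1)] Idl_eq_lin_span[OF subring FA] by simp
    then show "\<exists>G\<subseteq>carrier S. finite G \<and> I = Idl\<^bsub>S\<^esub> G" using FA by auto
  qed
  have loc: "local_ring S" using quasi noeth by (simp add: local_ring_def)
  have dom: "domain S"
  proof (rule domain.intro[OF S.is_cring], rule domain_axioms.intro)
    show "\<one>\<^bsub>S\<^esub> \<noteq> \<zero>\<^bsub>S\<^esub>" using one by simp
    fix a b assume "a \<otimes>\<^bsub>S\<^esub> b = \<zero>\<^bsub>S\<^esub>" "a \<in> carrier S" "b \<in> carrier S"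
    then show "a = \<zero>\<^bsub>S\<^esub> \<or> b = \<zero>\<^bsub>S\<^esub>"
      using saturated_regular[OF good_saturated[OF good], of a b] Ac by auto
  qed
  obtain F where F: "set F \<subseteq> M" "M \<subseteq> lin_span (carrier T) F" using finite_generators[of M] Ac by blast
  have Fc: "set F \<subseteq> carrier T" using F(1) Ac by auto
  \<comment> \<open>The ideal generated by \<open>M\<close> in \<open>T\<close> is closed, so it
    suffices to approximate each element of \<open>\<mm>\<close> by elements of
    \<open>M\<close>.\<close>
  have max_le: "\<mm> \<subseteq> lin_span (carrier T) F"
  proof
    fix x assume x: "x \<in> \<mm>"
    have xc: "x \<in> carrier T" using x idealD(1)[OF max_ideal] by auto
    show "x \<in> lin_span (carrier T) F"
    proof (rule closed[OF _ lin_span_carrier(1)[OF Fc] xc])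
      fix k
      \<comment> \<open>With exponent \<open>Suc k\<close> instead of \<open>k\<close> the
        correction lies in \<open>\<mm>\<close> even for \<open>k = 0\<close>, so the approximating
        element is in \<open>M\<close>.\<close>
      obtain t where t: "t \<in> carrier T" "x \<oplus> z [^] Suc k \<otimes> t \<in> A" using approx[OF xc] by blast
      let ?z = "z [^] Suc k"
      have zm: "?z \<in> MT (Suc k)" by (rule elem_power_mem[OF max_ideal z(1)])
      have c: "?z \<in> carrier T" using zc by simp
      have "?z \<in> \<mm>" using zm ideal_power_decreasing[OF max_ideal, of "Suc 0" "Suc k"] ideal_power_1[OF max_ideal] by blast
      then have "x \<oplus> ?z \<otimes> t \<in> M" using x t idealD(3,7)[OF max_ideal] by (simp del: nat_pow_Suc)
      moreover have "x \<ominus> (x \<oplus> ?z \<otimes> t) = \<ominus> (?z \<otimes> t)" using xc c t(1) by algebra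
      moreover have "\<ominus> (?z \<otimes> t) \<in> MT k"
        using zm ideal_power_decreasing[OF max_ideal, of k "Suc k"] MT(5,7) t(1) by (meson le_SucI order_refl subsetD)
      ultimately show "\<exists>y\<in>lin_span (carrier T) F. x \<ominus> y \<in> MT k" using F(2) by (metis subsetD)
    qed
  qed
  have power: "MT n \<inter> A \<subseteq> MS n" for n
  proof -
    have gen: "\<exists>G. set G \<subseteq> MS n \<and> MS n \<subseteq> lin_span (carrier T) G" for n
    proof -
      have "MS n \<subseteq> carrier T" using MS(1) Ac by blast
      then obtain G where "set G \<subseteq> MS n" "MS n \<subseteq> lin_span (carrier T) G" by (rule finite_generators)
      then show ?thesis by blast
    qed
    have le: "lin_span (carrier T) G \<subseteq> I" if "ideal I T" "set G \<subseteq> I" for G I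
      using lin_span_le[OF carrier_is_subring, of G I] that idealD(1)[OF that(1)] by auto
    \<comment> \<open>Since \<open>M\<close> generates \<open>\<mm>\<close> over \<open>T\<close>,
      each power of \<open>\<mm>\<close> is generated over \<open>T\<close> by elements of the same
      power of \<open>M\<close>. For elements of \<open>A\<close> the coefficients can then be moved
      into \<open>A\<close>.\<close>
    have "\<exists>G. set G \<subseteq> MS n \<and> MT n \<subseteq> lin_span (carrier T) G" for n
    proof (induct n)
      case 0
      have "\<one> \<in> MS 0" using A(3) by (simp add: ideal_power_0)
      moreover have "ideal (lin_span (carrier T) [\<one>]) T" "\<one> \<in> lin_span (carrier T) [\<one>]"
        using lin_span_carrier(1)[of "[\<one>]"] lin_span_mem[OF carrier_is_subring, of "[\<one>]"] A(1,3)
        by (auto simp del: lin_span.simps)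
      then have "carrier T \<subseteq> lin_span (carrier T) [\<one>]" using ideal.one_imp_carrier by blast
      ultimately show ?case by (intro exI[of _ "[\<one>]"]) (auto simp: ideal_power_0 simp del: lin_span.simps)
    next
      case (Suc n)
      then obtain G where G: "set G \<subseteq> MS n" "MT n \<subseteq> lin_span (carrier T) G" by blast
      obtain H where H: "set H \<subseteq> MS (Suc n)" "MS (Suc n) \<subseteq> lin_span (carrier T) H" using gen by blast
      let ?N = "lin_span (carrier T) H"
      have Gc: "set G \<subseteq> carrier T" "set H \<subseteq> carrier T" using G(1) H(1) MS(1) Ac by blast+
      have N: "ideal ?N T" using lin_span_carrier(1)[OF Gc(2)] .
      have "MT (Suc n) \<subseteq> ?N"
      proof (rule ideal_power_Suc_subset)
        fix x y assume x: "x \<in> MT n" and y: "y \<in> \<mm>"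
        have xc: "x \<in> carrier T" "y \<in> carrier T" using MT(1) x y idealD(1)[OF max_ideal] by auto
        have xf: "x \<otimes> f \<in> ?N" if f: "f \<in> set F" for f
        proof -
          have fc: "f \<in> carrier T" "f \<in> M" using f Fc F(1) by auto
          have "f \<otimes> h \<in> ?N" if h: "h \<in> set G" for h
          proof -
            have "h \<otimes> f \<in> MS (Suc n)" using S.ideal_power_mult[of h M n f] h G(1) fc by auto
            then show ?thesis using H(2) fc(1) Gc h by (metis m_comm subsetD)
          qed
          then have "lin_span (carrier T) G \<subseteq> {r \<in> carrier T. f \<otimes> r \<in> ?N}"
            by (intro le colon_ideal[OF N fc(1)]) (use Gc in auto)
          then show ?thesis using x G(2) fc xc by (auto simp: m_comm simp del: lin_span.simps)
        qed
        have "lin_span (carrier T) F \<subseteq> {r \<in> carrier T. x \<otimes> r \<in> ?N}"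
          by (intro le colon_ideal[OF N xc(1)]) (use Fc xf in auto)
        then show "x \<otimes> y \<in> ?N" using y max_le by blast
      qed (use idealD(3)[OF N] in auto)
      then show ?case using H(1) by blast
    qed
    then obtain G where G: "set G \<subseteq> MS n" "MT n \<subseteq> lin_span (carrier T) G" by blast
    have GA: "set G \<subseteq> A" using G(1) MS(1) by blast
    show ?thesis
      using span[OF GA] G(2) lin_span_le[OF subring GA MS_ideal G(1)] by blast
  qed
  have comp: "completion_eq T \<mm> A"
  proof (rule completion_eqI[OF _ power maxM])
    fix x n assume x: "x \<in> carrier T"
    obtain t where t: "t \<in> carrier T" "x \<oplus> z [^] (n::nat) \<otimes> t \<in> A" using approx[OF x] by blast
    have c: "z [^] n \<in> carrier T" using zc by simp
    have "x \<ominus> (x \<oplus> z [^] n \<otimes> t) = \<ominus> (z [^] n \<otimes> t)" using x c t(1) by algebra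
    moreover have "\<ominus> (z [^] n \<otimes> t) \<in> MT n"
      using elem_power_mem[OF max_ideal z(1), of n] MT(5,7) t(1) by blast
    ultimately show "\<exists>a\<in>A. x \<ominus> a \<in> MT n" using t(2) by metis
  qed
  have QA: "Q \<inter> A = PS p" if Q: "Q \<in> C" for Q
  proof
    show "Q \<inter> A \<subseteq> PS p"
    proof
      fix x assume x: "x \<in> Q \<inter> A"
      then obtain t where t: "t \<in> carrier T" "x = p \<otimes> t" using g(4)[OF Q, of x] mem_pT by blast
      then have "t \<in> A" using g(3)[OF g(2) t(1) p(2)] x by simp
      then show "x \<in> PS p" using mem_PIdl_subring[OF subring g(2)] t by blast
    qed
    show "PS p \<subseteq> Q \<inter> A"
    proof
      fix x assume "x \<in> PS p"
      then obtain r where "r \<in> A" "x = p \<otimes> r" using mem_PIdl_subring[OF subring g(2)] by auto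
      then show "x \<in> Q \<inter> A" using A(1,7) g(2) p(1) Q idealD(7)[OF C_ideal[OF Q]] by blast
    qed
  qed
  obtain Q0 where Q0: "Q0 \<in> C" using C by blast
  have prime: "primeideal (PS p) S"
    using prime_inter_subring[OF subring C(3)[OF Q0]] QA[OF Q0] by simp
  have in_fiber: "Q \<in> formal_fiber T A (PS p)" if "Q \<in> C" for Q
    using C(3) QA that by (simp add: formal_fiber_def)
  have below: "\<exists>Q'\<in>C. Q \<subseteq> Q'" if "Q \<in> formal_fiber T A (PS p)" for Q
  proof (rule ccontr)
    assume neg: "\<not> ?thesis"
    have Q: "primeideal Q T" "Q \<inter> A = PS p" using that by (auto simp: formal_fiber_def)
    have iQ: "ideal Q T" using primeD(1)[OF Q(1)] .
    have "\<exists>y\<in>Q. \<forall>Q'\<in>C. y \<notin> Q'" by (rule prime_avoidance) (use C neg iQ in auto)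
    then obtain y where y: "y \<in> Q" "\<And>Q'. Q' \<in> C \<Longrightarrow> y \<notin> Q'" by blast
    have yc: "y \<in> carrier T" using idealD(1)[OF iQ y(1)] .
    have zy: "z \<otimes> y \<notin> Q'" if "Q' \<in> C" for Q'
      using primeD(3)[OF C(3)[OF that] zc yc] z(2) y(2) that by simp
    \<comment> \<open>The coset is taken modulo \<open>z y\<close> because a coset of
      \<open>y T\<close> might be met in zero only. Here the element found is
      \<open>y (1 + z t)\<close>, that is \<open>y\<close> times a unit: it lies in \<open>Q\<close>
      but outside every member of \<open>C\<close>, contradicting
      \<open>Q \<inter> A = Q0 \<inter> A\<close>.\<close>
    obtain t where t: "t \<in> carrier T" "y \<oplus> z \<otimes> y \<otimes> t \<in> A" using dense[OF yc, of "z \<otimes> y"] zy zc yc by auto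
    have e: "y \<oplus> z \<otimes> y \<otimes> t = y \<otimes> (\<one> \<ominus> (\<ominus> (z \<otimes> t)))" using yc zc t(1) by algebra
    define v where "v = \<one> \<ominus> (\<ominus> (z \<otimes> t))"
    have v: "v \<in> Units T" unfolding v_def
      by (rule one_minus_unit) (use z(1) t(1) idealD(5,7)[OF max_ideal] in simp)
    have "y \<otimes> v \<in> Q \<inter> A" using e t(2) y(1) idealD(7)[OF iQ] v by (auto simp: v_def[symmetric])
    then have "y \<otimes> v \<in> Q0" using Q(2) QA[OF Q0] by blast
    then have "v \<in> Q0" using primeD(3)[OF C(3)[OF Q0] yc, of v] y(2)[OF Q0] v by auto
    then have "v \<in> \<mm>" using prime_le_max[OF C(3)[OF Q0]] by blast
    then show False using unit_iff[of v] v by auto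
  qed
  have "formal_fiber_maximal T A (PS p) = C"
  proof
    show "formal_fiber_maximal T A (PS p) \<subseteq> C"
    proof
      fix Q assume Q: "Q \<in> formal_fiber_maximal T A (PS p)"
      then have "Q \<in> formal_fiber T A (PS p)" by (simp add: formal_fiber_maximal_def)
      then obtain Q' where Q': "Q' \<in> C" "Q \<subseteq> Q'" using below by blast
      then have "Q' = Q" using Q in_fiber[OF Q'(1)] by (simp add: formal_fiber_maximal_def)
      then show "Q \<in> C" using Q'(1) by simp
    qed
    show "C \<subseteq> formal_fiber_maximal T A (PS p)"
    proof
      fix Q assume Q: "Q \<in> C"
      have "Q' = Q" if Q': "Q' \<in> formal_fiber T A (PS p)" "Q \<subseteq> Q'" for Q'
      proof -
        obtain Q2 where "Q2 \<in> C" "Q' \<subseteq> Q2" using below[OF Q'(1)] by blast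
        then show ?thesis using C(5)[OF Q, of Q2] Q'(2) by blast
      qed
      then show "Q \<in> formal_fiber_maximal T A (PS p)"
        using in_fiber[OF Q] by (simp add: formal_fiber_maximal_def)
    qed
  qed
  then show ?thesis using subring loc dom g(2) comp prime by blast
qed

end

theorem theorem2p13:
  fixes T :: "('a, 'b) ring_scheme" and \<mm> :: "'a set" and C :: "'a set set" and p :: 'a
  assumes "complete_local_ring T \<mm>"
    and "finite C" and "C \<noteq> {}"
    and "\<And>Q. Q \<in> C \<Longrightarrow> primeideal Q T"
    and "\<And>Q. Q \<in> C \<Longrightarrow> \<not> maximalideal Q T"
    and "\<And>Q Q'. Q \<in> C \<Longrightarrow> Q' \<in> C \<Longrightarrow> Q \<noteq> Q' \<Longrightarrow> \<not> Q \<subseteq> Q'"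
    and "p \<in> \<Inter>C" and "p \<noteq> \<zero>\<^bsub>T\<^esub>"
  shows "(\<exists>A. subring A T \<and> local_ring (subring_of T A) \<and> domain (subring_of T A) \<and>
              p \<in> A \<and> completion_eq T \<mm> A \<and>
              primeideal (PIdl\<^bsub>subring_of T A\<^esub> p) (subring_of T A) \<and>
              formal_fiber_maximal T A (PIdl\<^bsub>subring_of T A\<^esub> p) = C)
     \<longleftrightarrow>
         ((\<forall>P\<in>associated_primes T (regular_module T).
              P \<inter> prime_subring_adjoin T p = {\<zero>\<^bsub>T\<^esub>}) \<and>
          (\<forall>P'\<in>associated_primes T (quotient_module T (PIdl\<^bsub>T\<^esub> p)). \<exists>Q\<in>C. P' \<subseteq> Q) \<and>
          (\<forall>Q\<in>C. ((Q - PIdl\<^bsub>T\<^esub> p) <#>\<^bsub>T\<^esub> prime_subring_adjoin T p) \<inter> prime_subring_adjoin T p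
                   \<subseteq> {\<zero>\<^bsub>T\<^esub>}))" (is "?ring \<longleftrightarrow> ?conditions")
proof -
  interpret complete_local_ring T \<mm> by fact
  interpret prime_family T \<mm> C p
    by (intro prime_family.intro prime_family_axioms.intro assms)
  have "?conditions" if "?ring"
    using that conditions_necessary by (elim exE conjE) blast
  moreover have "?ring" if c: "?conditions"
  proof -
    interpret sufficient_conditions T \<mm> C p
      by (intro sufficient_conditions.intro sufficient_conditions_axioms.intro prime_family_axioms)
        (use c in blast)+
    show ?thesis by (rule conditions_sufficient)
  qed
  ultimately show ?thesis by blast
qed

end
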